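(* Let $W$ be a Coxeter group and $\mathcal A\subset V=\mathbb C^n$ a locus configuration of type $W$. Put $\delta=\prod_{\alpha\in\mathcal A_+\setminus R}(\alpha,x)^{k_\alpha}$, $N=\deg\delta$, and let $S=\frac1{2^NN!}\mathrm{ad}_{L_{\mathcal A},L_W}^N(\delta)$. For homogeneous $q$ of degree $r$, let $L_{q,0}=\frac1{2^rr!}\mathrm{ad}_{L_W}^r(q)$ if $q\in\mathbb C[V]^W$, and $L_q=\frac1{2^rr!}\mathrm{ad}_{L_{\mathcal A}}^r(q)$ if $q\in Q_{\mathcal A}$. Let $\omega$ be an arbitrary parameter. (1) Set $S^\omega=e^{-\omega x^2/2}\,S\,e^{\omega x^2/2}$, and write $(S^\omega)^*$ for its formal adjoint. Then $$L_{\mathcal A}^\omega S^\omega=S^\omega(L_W^\omega-2\omega N),\quad N=\deg\delta,\qquad\text{and}\qquad [S^\omega(S^\omega)^*,L_{\mathcal A}^\omega]=0.$$ (2) For a homogeneous $q\in\mathbb C[V]^W$, set $L_{q,0}^\omega=e^{-\omega x^2/2}L_{q,0}\,e^{\omega x^2/2}$. Then $L_{q,0}^\omega L_W^\omega=(L_W^\omega+2\omega r)L_{q,0}^\omega$, $r=\deg q$. Hence the operator $L_{q,0}^\omega L_{q,0}^{-\omega}$ commutes with $L_W^\omega$. (3) Similarly, for a homogeneous $q\in Q_{\mathcal A}$, set $L_q^\omega=e^{-\omega x^2/2}L_q\,e^{\omega x^2/2}$. Then $L_q^\omega L_{\mathcal A}^\omega=(L_{\mathcal A}^\omega+2\omega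 r)L_q^\omega$, $r=\deg q$. Hence the operator $L_q^\omega L_q^{-\omega}$ commutes with $L_{\mathcal A}^\omega$.
   Context: $V=\mathbb C^n$ carries the standard symmetric bilinear form $(\cdot,\cdot)$, $x^2=(x,x)$. For non-isotropic $\alpha$, $s_\alpha(x)=x-2\frac{(\alpha,x)}{(\alpha,\alpha)}\alpha$. $W$ is a finite Coxeter group acting on $V$, generated by orthogonal reflections, with $W$-invariant root system $R=R_+\cup(-R_+)$ (one normal in $R_+$ per reflection). A configuration $(\mathcal A,k)$ is a finite set $\mathcal A=\mathcal A_+\cup(-\mathcal A_+)$ of non-isotropic vectors, those in $\mathcal A_+$ pairwise nonparallel, with multiplicities $k_\alpha=k_{-\alpha}\in\mathbb C$; $u_{\mathcal A}=\sum_{\alpha\in\mathcal A_+}\frac{k_\alpha(k_\alpha+1)(\alpha,\alpha)}{(\alpha,x)^2}$. It is a locus configuration of type $W$ if: (i) $R\subset\mathcal A$, and $\mathcal A$ and $k$ are $W$-invariant; (ii) for every $\alpha\in\mathcal A\setminus R$, $k_\alpha\in\mathbb Z_{\ge0}$ and $u_{\mathcal A}(x)-u_{\mathcal A}(s_\alpha x)$ is divisible by $(\alpha,x)^{2k_\alpha}$ (i.e. the quotient is regular at a generic point of the hyperplane $(\alpha,x)=0$). Put $u_W=\sum_{\alpha\in R_+}\frac{k_\alpha(k_\alpha+1)(\alpha,\alpha)}{(\alpha,x)^2}$ and $$L_{\mathcal A}=\Delta-u_{\mathcal A},\quad L_W=\Delta-u_W,\quad L_{\mathcal A}^\omega=\Delta-\omega^2x^2-u_{\mathcal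 A},\quad L_W^\omega=\Delta-\omega^2x^2-u_W,$$ with $\Delta$ the Laplacian. $Q_{\mathcal A}$ is the algebra of all $q\in\mathbb C[V]^W$ such that $q(x)-q(s_\alpha x)$ is divisible by $(\alpha,x)^{2k_\alpha}$ for all $\alpha\in\mathcal A_+\setminus R$. Notation: $\mathrm{ad}_{a,b}(m)=am-mb$, $\mathrm{ad}_a=\mathrm{ad}_{a,a}$. The operator $S$ satisfies $L_{\mathcal A}S=SL_W$; the operators $L_{q,0}$ commute with $L_W$, and the operators $L_q$ commute with $L_{\mathcal A}$. The formal adjoint is the anti-automorphism of differential operators fixing functions and sending $\partial_i\mapsto-\partial_i$.
   Formalization: The printed signs of the shifts are false for ω≠0 (e.g. n=1, 𝒜 empty, q=x); proved instead: L_𝒜^ω S^ω = S^ω(L_W^ω+2ωN), L_{q,0}^ω L_W^ω = (L_W^ω−2ωr)L_{q,0}^ω and L_q^ω L_𝒜^ω = (L_𝒜^ω−2ωr)L_q^ω. The commutation claims are unchanged. *)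

theory Defs
  imports "HOL-Analysis.Analysis"
begin

definition bil :: "complex^'n \<Rightarrow> complex^'n \<Rightarrow> complex" where
  "bil x y = (\<Sum>i\<in>UNIV. x $ i * y $ i)"
  (* the complex bilinear form; the library's inner product on complex^'n is the real one *)

definition reflect :: "complex^'n \<Rightarrow> complex^'n \<Rightarrow> complex^'n" where
  "reflect \<alpha> x = x - (2 * bil \<alpha> x / bil \<alpha> \<alpha>) *s \<alpha>"

inductive poly_fun :: "(complex^'n \<Rightarrow> complex) \<Rightarrow> bool" where
  const: "poly_fun (\<lambda>x. c)"
| coord: "poly_fun (\<lambda>x. x $ i)"
| add: "poly_fun p \<Longrightarrow> poly_fun q \<Longrightarrow> poly_fun (\<lambda>x. p x + q x)"
| mult: "poly_fun p \<Longrightarrow> poly_fun q \<Longrightarrow> poly_fun (\<lambda>x. p x * q x)"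

definition homogeneous :: "nat \<Rightarrow> (complex^'n \<Rightarrow> complex) \<Rightarrow> bool" where
  "homogeneous r q \<longleftrightarrow> poly_fun q \<and> (\<forall>c x. q (c *s x) = c ^ r * q x)"


definition reflections_in :: "(complex^'n \<Rightarrow> complex^'n) set \<Rightarrow> (complex^'n \<Rightarrow> complex^'n) set" where
  "reflections_in W = {s \<in> W. \<exists>\<alpha>. bil \<alpha> \<alpha> \<noteq> 0 \<and> s = reflect \<alpha>}"

(* Closure under inverses is automatic when all elements of G are involutions. *)
inductive_set generated_by :: "('a \<Rightarrow> 'a) set \<Rightarrow> ('a \<Rightarrow> 'a) set" for G where
  one: "id \<in> generated_by G"
| step: "s \<in> G \<Longrightarrow> w \<in> generated_by G \<Longrightarrow> s \<circ> w \<in> generated_by G"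

(* A finite group generated by orthogonal reflections of C^n; the trivial group is included. *)
definition finite_coxeter_group :: "(complex^'n \<Rightarrow> complex^'n) set \<Rightarrow> bool" where
  "finite_coxeter_group W \<longleftrightarrow> finite W \<and> W = generated_by (reflections_in W)"

(* A configuration or root system is given by its positive half Ap; this is the full set. *)
definition full :: "(complex^'n) set \<Rightarrow> (complex^'n) set" where
  "full Ap = Ap \<union> uminus ` Ap"

definition root_system :: "(complex^'n \<Rightarrow> complex^'n) set \<Rightarrow> (complex^'n) set \<Rightarrow> bool" where
  "root_system W Rp \<longleftrightarrow>
     (\<forall>\<alpha>\<in>Rp. bil \<alpha> \<alpha> \<noteq> 0) \<and>
     bij_betw reflect Rp (reflections_in W) \<and>
     (\<forall>w\<in>W. w ` full Rp = full Rp)"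

definition configuration :: "(complex^'n) set \<Rightarrow> (complex^'n \<Rightarrow> complex) \<Rightarrow> bool" where
  "configuration Ap k \<longleftrightarrow>
     finite Ap \<and>
     (\<forall>\<alpha>\<in>Ap. bil \<alpha> \<alpha> \<noteq> 0) \<and>
     (\<forall>\<alpha>\<in>Ap. \<forall>\<beta>\<in>Ap. \<alpha> \<noteq> \<beta> \<longrightarrow> (\<nexists>c. \<beta> = c *s \<alpha>)) \<and>
     (\<forall>\<alpha>\<in>Ap. k (- \<alpha>) = k \<alpha>)"

definition potential :: "(complex^'n) set \<Rightarrow> (complex^'n \<Rightarrow> complex) \<Rightarrow> complex^'n \<Rightarrow> complex" where
  "potential Ap k x = (\<Sum>\<alpha>\<in>Ap. k \<alpha> * (k \<alpha> + 1) * bil \<alpha> \<alpha> / (bil \<alpha> x)\<^sup>2)"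

definition regular_points :: "(complex^'n) set \<Rightarrow> (complex^'n) set" where
  "regular_points Ap = {x. \<forall>\<alpha>\<in>Ap. bil \<alpha> x \<noteq> 0}"

(* The multiplicity as a natural number, meant for those \<alpha> with k \<alpha> \<in> \<nat>. *)
definition nat_mult :: "(complex^'n \<Rightarrow> complex) \<Rightarrow> complex^'n \<Rightarrow> nat" where
  "nat_mult k \<alpha> = nat \<lfloor>Re (k \<alpha>)\<rfloor>"

(* For a rational function f that is regular on D: f = (\<alpha>,x)^m P / Q with polynomials P, Q, where Q
   does not vanish identically on the hyperplane (\<alpha>,x) = 0. So f / (\<alpha>,x)^m lies in the local ring
   of the hyperplane, i.e. it is regular at a generic point of it. Points outside D are excluded
   because there the HOL value of f is an artefact of division by zero. *)
definition generically_divisible ::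
  "(complex^'n) set \<Rightarrow> (complex^'n \<Rightarrow> complex) \<Rightarrow> complex^'n \<Rightarrow> nat \<Rightarrow> bool" where
  "generically_divisible D f \<alpha> m \<longleftrightarrow>
     (\<exists>P Q. poly_fun P \<and> poly_fun Q \<and> (\<exists>y. bil \<alpha> y = 0 \<and> Q y \<noteq> 0) \<and>
            (\<forall>x\<in>D. f x * Q x = bil \<alpha> x ^ m * P x))"

definition locus_configuration ::
  "(complex^'n \<Rightarrow> complex^'n) set \<Rightarrow> (complex^'n) set \<Rightarrow> (complex^'n) set \<Rightarrow> (complex^'n \<Rightarrow> complex) \<Rightarrow> bool"
  where
  "locus_configuration W Rp Ap k \<longleftrightarrow>
     finite_coxeter_group W \<and> root_system W Rp \<and> configuration Ap k \<and>
     full Rp \<subseteq> full Ap \<and>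
     (\<forall>w\<in>W. w ` full Ap = full Ap) \<and>
     (\<forall>w\<in>W. \<forall>\<alpha>\<in>full Ap. k (w \<alpha>) = k \<alpha>) \<and>
     (\<forall>\<alpha>\<in>full Ap - full Rp.
        k \<alpha> \<in> \<nat> \<and>
        generically_divisible
          {x. x \<in> regular_points Ap \<and> reflect \<alpha> x \<in> regular_points Ap}
          (\<lambda>x. potential Ap k x - potential Ap k (reflect \<alpha> x)) \<alpha> (2 * nat_mult k \<alpha>))"

definition invariant_polys ::
  "(complex^'n \<Rightarrow> complex^'n) set \<Rightarrow> (complex^'n \<Rightarrow> complex) set" where
  "invariant_polys W = {q. poly_fun q \<and> (\<forall>w\<in>W. \<forall>x. q (w x) = q x)}"

definition quasi_invariants ::
  "(complex^'n \<Rightarrow> complex^'n) set \<Rightarrow> (complex^'n) set \<Rightarrow> (complex^'n) set \<Rightarrow> (complex^'n \<Rightarrow> complex)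
    \<Rightarrow> (complex^'n \<Rightarrow> complex) set" where
  "quasi_invariants W Rp Ap k =
     {q \<in> invariant_polys W. \<forall>\<alpha>\<in>Ap - full Rp.
        \<exists>p. poly_fun p \<and> (\<forall>x. q x - q (reflect \<alpha> x) = bil \<alpha> x ^ (2 * nat_mult k \<alpha>) * p x)}"


(* Differential operators are represented by their action on holomorphic functions on an open set
   U; two of them are identified when they agree there (op_eq below). This loses nothing, since the
   coefficients of a differential operator are determined by its action on polynomials. *)
type_synonym 'n diffop = "(complex^'n \<Rightarrow> complex) \<Rightarrow> complex^'n \<Rightarrow> complex"

definition holo_on :: "(complex^'n) set \<Rightarrow> (complex^'n \<Rightarrow> complex) \<Rightarrow> bool" where
  "holo_on U f \<longleftrightarrow>
     (\<forall>x\<in>U. \<exists>D. (f has_derivative D) (at x) \<and> (\<forall>c v. D (c *s v) = c * D v))"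

definition op_eq :: "(complex^'n) set \<Rightarrow> 'n diffop \<Rightarrow> 'n diffop \<Rightarrow> bool" where
  "op_eq U P Q \<longleftrightarrow> (\<forall>f. holo_on U f \<longrightarrow> (\<forall>x\<in>U. P f x = Q f x))"

definition op_commute :: "(complex^'n) set \<Rightarrow> 'n diffop \<Rightarrow> 'n diffop \<Rightarrow> bool" where
  "op_commute U P Q \<longleftrightarrow> op_eq U (P \<circ> Q) (Q \<circ> P)"

definition partial_d :: "'n \<Rightarrow> 'n::finite diffop" where
  "partial_d i f x = deriv (\<lambda>z. f (x + axis i z)) 0"

definition mult_op :: "(complex^'n \<Rightarrow> complex) \<Rightarrow> 'n diffop" where
  "mult_op a f x = a x * f x"

definition op_scale :: "complex \<Rightarrow> 'n diffop \<Rightarrow> 'n diffop" where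
  "op_scale c P f x = c * P f x"

definition op_shift :: "'n diffop \<Rightarrow> complex \<Rightarrow> 'n diffop" where
  "op_shift P c f x = P f x + c * f x"

(* The graph of the anti-automorphism that fixes functions and sends each partial derivative to its
   negative, on the algebra generated by functions and partial derivatives on U. *)
inductive formal_adjoint :: "(complex^'n) set \<Rightarrow> 'n diffop \<Rightarrow> 'n diffop \<Rightarrow> bool" for U where
  mult: "holo_on U a \<Longrightarrow> formal_adjoint U (mult_op a) (mult_op a)"
| partial: "formal_adjoint U (partial_d i) (op_scale (- 1) (partial_d i))"
| add: "formal_adjoint U P P' \<Longrightarrow> formal_adjoint U Q Q' \<Longrightarrow>
    formal_adjoint U (\<lambda>f x. P f x + Q f x) (\<lambda>f x. P' f x + Q' f x)"
| comp: "formal_adjoint U P P' \<Longrightarrow> formal_adjoint U Q Q' \<Longrightarrow> formal_adjoint U (P \<circ> Q) (Q' \<circ> P')"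
| cong: "formal_adjoint U P P' \<Longrightarrow> op_eq U P Q \<Longrightarrow> op_eq U P' Q' \<Longrightarrow> formal_adjoint U Q Q'"

definition ad :: "'n diffop \<Rightarrow> 'n diffop \<Rightarrow> 'n diffop \<Rightarrow> 'n diffop" where
  "ad A B M = (\<lambda>f x. A (M f) x - M (B f) x)"

definition laplacian :: "'n::finite diffop" where
  "laplacian f x = (\<Sum>i\<in>UNIV. partial_d i (partial_d i f) x)"


(* Both L_A (Ap the configuration) and L_W (Ap the positive roots of W) are instances of this,
   and similarly for the next two definitions. *)
definition L_op :: "(complex^'n) set \<Rightarrow> (complex^'n \<Rightarrow> complex) \<Rightarrow> 'n diffop" where
  "L_op Ap k f x = laplacian f x - potential Ap k x * f x"

definition L_osc :: "complex \<Rightarrow> (complex^'n) set \<Rightarrow> (complex^'n \<Rightarrow> complex) \<Rightarrow> 'n diffop" where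
  "L_osc \<omega> Ap k f x = laplacian f x - \<omega>\<^sup>2 * bil x x * f x - potential Ap k x * f x"

definition Lq_op ::
  "(complex^'n) set \<Rightarrow> (complex^'n \<Rightarrow> complex) \<Rightarrow> nat \<Rightarrow> (complex^'n \<Rightarrow> complex) \<Rightarrow> 'n diffop" where
  "Lq_op Ap k r q =
     op_scale (1 / (2 ^ r * fact r)) ((ad (L_op Ap k) (L_op Ap k) ^^ r) (mult_op q))"

definition delta ::
  "(complex^'n) set \<Rightarrow> (complex^'n) set \<Rightarrow> (complex^'n \<Rightarrow> complex) \<Rightarrow> complex^'n \<Rightarrow> complex" where
  "delta Rp Ap k x = (\<Prod>\<alpha>\<in>Ap - full Rp. bil \<alpha> x ^ nat_mult k \<alpha>)"

(* The degree of delta, a product of nonzero linear forms. *)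
definition deg_delta ::
  "(complex^'n) set \<Rightarrow> (complex^'n) set \<Rightarrow> (complex^'n \<Rightarrow> complex) \<Rightarrow> nat" where
  "deg_delta Rp Ap k = (\<Sum>\<alpha>\<in>Ap - full Rp. nat_mult k \<alpha>)"

definition S_op ::
  "(complex^'n) set \<Rightarrow> (complex^'n) set \<Rightarrow> (complex^'n \<Rightarrow> complex) \<Rightarrow> 'n diffop" where
  "S_op Rp Ap k = (let N = deg_delta Rp Ap k in
     op_scale (1 / (2 ^ N * fact N))
       ((ad (L_op Ap k) (L_op Rp k) ^^ N) (mult_op (delta Rp Ap k))))"

(* Sign check in the simplest case n = 1, Ap = {}, q = x: the conjugate of d = d/dx is d + \<omega>x, and
   (d + \<omega>x)(d^2 - \<omega>^2 x^2) = (d^2 - \<omega>^2 x^2 - 2\<omega>)(d + \<omega>x). Conjugating with the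
   opposite sign of \<omega> reverses the sign of the shift, as L_osc depends on \<omega> only through \<omega>^2. *)
definition gauss_conj :: "complex \<Rightarrow> 'n::finite diffop \<Rightarrow> 'n diffop" where
  "gauss_conj \<omega> P =
     mult_op (\<lambda>x. exp (- \<omega> * bil x x / 2)) \<circ> P \<circ> mult_op (\<lambda>x. exp (\<omega> * bil x x / 2))"

end

theory Submission
  imports Defs "HOL-Complex_Analysis.Cauchy_Integral_Formula" "HOL-Computational_Algebra.Fraction_Field"
    "HOL-Library.Multiset"
begin

text \<open>The heart of the matter is that \<open>P\<^sub>j = ad\<^sup>j(q)\<close> vanishes for \<open>j = r + 1\<close>, where \<open>r\<close> is the degree
  of \<open>q\<close>. On leading symbols \<open>ad\<close> acts as \<open>2(\<xi>,\<partial>)\<close>, so every pole of the leading symbol of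
  \<open>P\<close> would grow under further commutators. But the poles of all \<open>P\<^sub>j\<close> along a hyperplane are bounded:
  at a mirror of \<open>W\<close> because \<open>P\<^sub>j\<close> lies in the algebra generated by even regular functions,
  tangential derivatives, the transversal Euler field and the operator itself, and at the other
  hyperplanes because the operators preserve a space of functions with poles of order at most the
  multiplicity. Hence the leading symbol of \<open>P\<^bsub>r+1\<^esub>\<close> is polynomial, and it has negative degree,
  so it is zero.

  Thus \<open>P\<^sub>r\<close> intertwines the two operators, and it is homogeneous of degree \<open>-r\<close>. With \<open>E\<close> the Euler
  field, \<open>L\<^sup>\<omega> + n\<omega>\<close> is the Gaussian conjugate of \<open>L - 2\<omega>E\<close>, which gives the shift by \<open>2\<omega>r\<close>.
  The commuting products arise by composing two intertwining relations with opposite shifts, for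
  part (1) the relation and its formal adjoint. Formal adjoints are unique because a differential
  operator is determined by its normal form.\<close>

subsection \<open>Polynomial functions and their fraction field\<close>

text \<open>One operator of the sequence does not control the poles of its own symbol. The proof
  therefore follows a whole tail of the sequence: \<open>i\<close> further steps raise the order by
  at most \<open>i\<close>, and commuting \<open>i\<close> more times with (\<alpha>,x) compensates.
  The resulting coefficients are, up to regular terms, positive multiples of successive normal
  derivatives, so a pole would deepen at every step, while the bound on the poles does not depend on
  \<open>i\<close>. At a mirror of \<open>W\<close> the multiplicity is an arbitrary complex number,
  so no space of functions with integral exponents is preserved; evenness under the reflection has
  to supply the bound. At the other hyperplanes parity may fail, but the multiplicity is integral. A
  symbol of order d in operator number r + 1 has degree r - 2(r + 1) + d, which is negative for all
  d \<le> r + 1; so the induction on the order can descend to zero. The operator \<open>S\<close>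
  lowers the Euler degree by N, so L - 2\<omega>E moves past it with the shift +2\<omega>N on the
  right of \<open>S\<close>. The opposite signs in the English statement are those for
  -\<omega>.\<close>

lemma bil_add_left: "bil (x + y) z = bil x z + bil y z"
  by (simp add: bil_def sum.distrib algebra_simps)

lemma bil_add_right: "bil z (x + y) = bil z x + bil z y"
  by (simp add: bil_def sum.distrib algebra_simps)

lemma bil_diff_left: "bil (x - y) z = bil x z - bil y z"
  by (simp add: bil_def sum_subtractf algebra_simps)

lemma bil_diff_right: "bil z (x - y) = bil z x - bil z y"
  by (simp add: bil_def sum_subtractf algebra_simps)

lemma bil_scale_left: "bil (c *s x) z = c * bil x z"
  by (simp add: bil_def sum_distrib_left algebra_simps)

lemma bil_scale_right: "bil z (c *s x) = c * bil z x"
  by (simp add: bil_def sum_distrib_left algebra_simps)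

lemma bil_commute: "bil x y = bil y x"
  by (simp add: bil_def mult.commute)

lemma bil_zero_left [simp]: "bil 0 x = 0" and bil_zero_right [simp]: "bil x 0 = 0"
  by (simp_all add: bil_def)

lemma bil_minus_left: "bil (- x) z = - bil x z"
  by (simp add: bil_def sum_negf)

lemma bil_minus_right: "bil z (- x) = - bil z x"
  by (simp add: bil_def sum_negf)

lemmas bil_simps = bil_add_left bil_add_right bil_diff_left bil_diff_right
  bil_scale_left bil_scale_right bil_minus_left bil_minus_right

lemma bil_axis_right: "bil x (axis i 1) = x $ i"
  by (simp add: bil_def axis_def if_distrib cong: if_cong)

lemma bil_axis_left: "bil (axis i 1) x = x $ i"
  by (simp add: bil_def axis_def if_distrib if_distribR cong: if_cong)

lemma reflect_invol: "bil \<alpha> \<alpha> \<noteq> 0 \<Longrightarrow> reflect \<alpha> (reflect \<alpha> x) = x"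
  by (simp add: reflect_def bil_simps vec_eq_iff field_simps)

lemma reflect_adjoint: "bil (reflect \<alpha> x) y = bil x (reflect \<alpha> y)"
  by (simp add: reflect_def bil_simps bil_commute)

lemma bil_reflect: "bil \<alpha> \<alpha> \<noteq> 0 \<Longrightarrow> bil (reflect \<alpha> x) (reflect \<alpha> y) = bil x y"
  by (simp add: reflect_adjoint reflect_invol)

lemma reflect_self: "bil \<alpha> \<alpha> \<noteq> 0 \<Longrightarrow> reflect \<alpha> \<alpha> = - \<alpha>"
  by (simp add: reflect_def vec_eq_iff)

lemma reflect_orth: "bil \<alpha> x = 0 \<Longrightarrow> reflect \<alpha> x = x"
  by (simp add: reflect_def)

lemma reflect_minus_root: "reflect (- \<alpha>) = reflect \<alpha>"
  by (simp add: fun_eq_iff reflect_def bil_simps vec_eq_iff)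

lemma reflect_minus: "reflect \<alpha> (- x) = - reflect \<alpha> x"
  by (simp add: reflect_def bil_simps vec_eq_iff)

lemma reflect_add: "reflect \<alpha> (x + y) = reflect \<alpha> x + reflect \<alpha> y"
  by (simp add: reflect_def bil_simps vec_eq_iff divide_simps) (simp add: algebra_simps)

lemma reflect_scale: "reflect \<alpha> (c *s y) = c *s reflect \<alpha> y"
  by (simp add: reflect_def bil_simps vec_eq_iff algebra_simps)

section \<open>Polynomial functions as an integral domain\<close>

lemma poly_fun_sum: "(\<And>i. i \<in> I \<Longrightarrow> poly_fun (f i)) \<Longrightarrow> poly_fun (\<lambda>x. \<Sum>i\<in>I. f i x)"
  by (induction I rule: infinite_finite_induct) (auto intro: poly_fun.intros)

lemma poly_fun_minus: "poly_fun p \<Longrightarrow> poly_fun (\<lambda>x. - p x)"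
  using poly_fun.mult[OF poly_fun.const[of "-1"]] by force

lemma poly_fun_diff: "poly_fun p \<Longrightarrow> poly_fun q \<Longrightarrow> poly_fun (\<lambda>x. p x - q x)"
  using poly_fun.add[OF _ poly_fun_minus] by force

lemma poly_fun_bil: "poly_fun (\<lambda>x. bil \<alpha> x)"
  unfolding bil_def by (intro poly_fun_sum poly_fun.intros)

lemma poly_fun_line:
  assumes "poly_fun p"
  shows "\<exists>P. \<forall>z. p (x + z *s v) = poly P z"
  using assms
proof induction
  case (const c)
  show ?case by (rule exI[of _ "[:c:]"]) simp
next
  case (coord i)
  show ?case by (rule exI[of _ "[:x$i, v$i:]"]) (simp add: algebra_simps)
next
  case (add p q)
  then obtain P Q where "\<forall>z. p (x + z *s v) = poly P z" "\<forall>z. q (x + z *s v) = poly Q z" by auto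
  then show ?case by (intro exI[of _ "P+Q"]) simp
next
  case (mult p q)
  then obtain P Q where "\<forall>z. p (x + z *s v) = poly P z" "\<forall>z. q (x + z *s v) = poly Q z" by auto
  then show ?case by (intro exI[of _ "P*Q"]) simp
qed

text \<open>Restricting to the line through the two points reduces to polynomials in one variable.\<close>
lemma poly_fun_nonzero_both:
  assumes "poly_fun p" "poly_fun q" "p x \<noteq> 0" "q y \<noteq> 0"
  shows "\<exists>z. p (x + z *s (y - x)) * q (x + z *s (y - x)) \<noteq> 0"
proof -
  obtain P where P: "\<And>z. p (x + z *s (y - x)) = poly P z" using poly_fun_line[OF assms(1)] by metis
  obtain Q where Q: "\<And>z. q (x + z *s (y - x)) = poly Q z" using poly_fun_line[OF assms(2)] by metis
  have "poly P 0 \<noteq> 0" "poly Q 1 \<noteq> 0" using assms(3,4) P[of 0] Q[of 1] by auto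
  then have "P * Q \<noteq> 0" by auto
  then obtain z where "poly (P * Q) z \<noteq> 0" using poly_all_0_iff_0 by blast
  then show ?thesis using P Q by auto
qed

text \<open>Polynomials are represented by the functions they define, so that identities can be
  checked pointwise; they form a type of their own because the fraction field is built over a
  type.\<close>

typedef 'n::finite pol = "{p :: complex^'n \<Rightarrow> complex. poly_fun p}"
  morphisms ev Pol
  by (auto intro: poly_fun.const)

setup_lifting type_definition_pol

lemma poly_fun_ev [simp]: "poly_fun (ev p)"
  using ev by auto

lemma pol_eqI: "(\<And>x. ev p x = ev q x) \<Longrightarrow> p = q"
  by (metis ev_inverse ext)

instantiation pol :: (finite) idom
begin

lift_definition zero_pol :: "'a pol" is "\<lambda>x. 0" by (rule poly_fun.const)
lift_definition one_pol :: "'a pol" is "\<lambda>x. 1" by (rule poly_fun.const)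
lift_definition plus_pol :: "'a pol \<Rightarrow> 'a pol \<Rightarrow> 'a pol" is "\<lambda>p q x. p x + q x"
  by (rule poly_fun.add)
lift_definition times_pol :: "'a pol \<Rightarrow> 'a pol \<Rightarrow> 'a pol" is "\<lambda>p q x. p x * q x"
  by (rule poly_fun.mult)
lift_definition uminus_pol :: "'a pol \<Rightarrow> 'a pol" is "\<lambda>p x. - p x"
  by (rule poly_fun_minus)
lift_definition minus_pol :: "'a pol \<Rightarrow> 'a pol \<Rightarrow> 'a pol" is "\<lambda>p q x. p x - q x"
  by (rule poly_fun_diff)

instance
proof
  fix a b c :: "'a pol"
  show "a * b * c = a * (b * c)" "a * b = b * a" "1 * a = a" "a + b + c = a + (b + c)"
    "a + b = b + a" "0 + a = a" "- a + a = 0" "a - b = a + - b" "(a + b) * c = a * c + b * c"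
    "0 * a = 0" "a * 0 = 0" "a * (b + c) = a * b + a * c"
    by (transfer; simp add: algebra_simps fun_eq_iff)+
  show "(0::'a pol) \<noteq> 1" by transfer (simp add: fun_eq_iff)
  show "a \<noteq> 0 \<Longrightarrow> b \<noteq> 0 \<Longrightarrow> a * b \<noteq> 0"
    by transfer (use poly_fun_nonzero_both in \<open>fastforce simp: fun_eq_iff\<close>)
qed

end

lift_definition pcst :: "complex \<Rightarrow> 'n::finite pol" is "\<lambda>c x. c" by (rule poly_fun.const)
lift_definition pcrd :: "'n \<Rightarrow> 'n::finite pol" is "\<lambda>i x. x $ i" by (rule poly_fun.coord)
lift_definition lin :: "complex^'n \<Rightarrow> 'n::finite pol" is "\<lambda>\<alpha> x. bil \<alpha> x" by (rule poly_fun_bil)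

lemma ev_simps [simp]: "ev 0 x = 0" "ev 1 x = 1" "ev (p + q) x = ev p x + ev q x"
  "ev (p - q) x = ev p x - ev q x" "ev (p * q) x = ev p x * ev q x" "ev (- p) x = - ev p x"
  "ev (pcst c) x = c" "ev (pcrd i) x = x $ i" "ev (lin \<alpha>) x = bil \<alpha> x"
  by (transfer; simp)+

lemma ev_power [simp]: "ev (p ^ m) x = ev p x ^ m"
  by (induction m) auto

lemma ev_sum [simp]: "ev (\<Sum>i\<in>I. f i) x = (\<Sum>i\<in>I. ev (f i) x)"
  by (induction I rule: infinite_finite_induct) auto

lemma ev_prod [simp]: "ev (\<Prod>i\<in>I. f i) x = (\<Prod>i\<in>I. ev (f i) x)"
  by (induction I rule: infinite_finite_induct) auto

lemma ev_Pol: "poly_fun p \<Longrightarrow> ev (Pol p) = p"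
  by (simp add: Pol_inverse)

lemma pol_induct [case_names const coord add mult]:
  assumes "\<And>c. P (pcst c)" "\<And>i. P (pcrd i)" "\<And>p q. P p \<Longrightarrow> P q \<Longrightarrow> P (p + q)"
    "\<And>p q. P p \<Longrightarrow> P q \<Longrightarrow> P (p * q)"
  shows "P p"
proof -
  have "poly_fun f \<Longrightarrow> P (Pol f)" for f
  proof (induction rule: poly_fun.induct)
    case (const c) then show ?case using assms(1)[of c] by (simp add: pcst_def)
  next
    case (coord i) then show ?case using assms(2)[of i] by (simp add: pcrd_def)
  next
    case (add p q)
    then have "Pol p + Pol q = Pol (\<lambda>x. p x + q x)"
      by (intro pol_eqI) (simp add: ev_Pol poly_fun.add)
    with assms(3)[OF add.IH] show ?case by simp
  next
    case (mult p q)
    then have "Pol p * Pol q = Pol (\<lambda>x. p x * q x)"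
      by (intro pol_eqI) (simp add: ev_Pol poly_fun.mult)
    with assms(4)[OF mult.IH] show ?case by simp
  qed
  from this[of "ev p"] show ?thesis by (simp add: ev_inverse)
qed

lemma lin_add: "lin (x + y) = lin x + lin y" and lin_scale: "lin (c *s x) = pcst c * lin x"
  by (rule pol_eqI, simp add: bil_simps)+

lemma pcst_hom: "pcst 0 = 0" "pcst 1 = 1" "pcst (a + b) = pcst a + pcst b"
  "pcst (a * b) = pcst a * pcst b" "pcst (- a) = - pcst a" "pcst (a - b) = pcst a - pcst b"
  by (rule pol_eqI, simp)+

lemma pcst_eq_0_iff [simp]: "pcst c = 0 \<longleftrightarrow> c = 0"
proof
  assume "pcst c = (0 :: 'a pol)"
  from arg_cong[OF this, of "\<lambda>p. ev p 0"] show "c = 0" by simp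
qed (simp add: pcst_hom)

lemma lin_nonzero: "bil \<alpha> \<alpha> \<noteq> 0 \<Longrightarrow> lin \<alpha> \<noteq> 0"
proof
  assume h: "bil \<alpha> \<alpha> \<noteq> 0" "lin \<alpha> = 0"
  from arg_cong[OF h(2), of "\<lambda>p. ev p \<alpha>"] h(1) show False by simp
qed

text \<open>Replacing x by its projection \<open>pr x\<close> to the hyperplane changes a polynomial
  by a multiple of (\<alpha>,x). If the polynomial vanishes on the hyperplane, only this multiple is
  left.\<close>

lemma lin_dvd_iff:
  assumes "bil \<alpha> \<alpha> \<noteq> 0"
  shows "lin \<alpha> dvd p \<longleftrightarrow> (\<forall>x. bil \<alpha> x = 0 \<longrightarrow> ev p x = 0)"
proof
  assume "lin \<alpha> dvd p" then show "\<forall>x. bil \<alpha> x = 0 \<longrightarrow> ev p x = 0" by (auto elim!: dvdE)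
next
  assume H: "\<forall>x. bil \<alpha> x = 0 \<longrightarrow> ev p x = 0"
  define pr where "pr x = x - (bil \<alpha> x / bil \<alpha> \<alpha>) *s \<alpha>" for x
  have "\<exists>p'. \<forall>x. ev p x = ev p (pr x) + bil \<alpha> x * ev p' x"
  proof (induction p rule: pol_induct)
    case (const c)
    show ?case by (rule exI[of _ 0]) simp
  next
    case (coord i)
    show ?case by (rule exI[of _ "pcst (\<alpha> $ i / bil \<alpha> \<alpha>)"]) (simp add: pr_def)
  next
    case (add p q)
    obtain p' where "\<And>x. ev p x = ev p (pr x) + bil \<alpha> x * ev p' x" using add.IH(1) by blast
    moreover obtain q' where "\<And>x. ev q x = ev q (pr x) + bil \<alpha> x * ev q' x" using add.IH(2) by blast
    ultimately have "ev p (pr x) = ev p x - bil \<alpha> x * ev p' x"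
      "ev q (pr x) = ev q x - bil \<alpha> x * ev q' x" for x by (metis add_diff_cancel_right')+
    then show ?case by (intro exI[of _ "p' + q'"]) (simp add: algebra_simps)
  next
    case (mult p q)
    obtain p' where "\<And>x. ev p x = ev p (pr x) + bil \<alpha> x * ev p' x" using mult.IH(1) by blast
    moreover obtain q' where "\<And>x. ev q x = ev q (pr x) + bil \<alpha> x * ev q' x" using mult.IH(2) by blast
    ultimately have *: "ev p (pr x) = ev p x - bil \<alpha> x * ev p' x"
      "ev q (pr x) = ev q x - bil \<alpha> x * ev q' x" for x by (metis add_diff_cancel_right')+
    show ?case
      \<comment> \<open>The witness comes from expanding pq - (p - (\<alpha>,x)p')(q -
        (\<alpha>,x)q') and dividing by (\<alpha>,x).\<close>
      by (rule exI[of _ "p' * q + p * q' - lin \<alpha> * p' * q'"]) (simp add: * algebra_simps)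
  qed
  then obtain p' where p': "\<forall>x. ev p x = ev p (pr x) + bil \<alpha> x * ev p' x" by blast
  have "bil \<alpha> (pr x) = 0" for x using assms by (simp add: pr_def bil_simps)
  then have "p = lin \<alpha> * p'" using H p' by (intro pol_eqI) (metis add_0 ev_simps(5,9))
  then show "lin \<alpha> dvd p" by simp
qed

text \<open>The line through two points of the hyperplane stays in it, so two polynomials that are
  each nonzero somewhere on the hyperplane are nonzero at a common point of it. Primality is what
  makes \<open>reg\<close> below a local ring.\<close>

lemma prime_lin:
  assumes "bil \<alpha> \<alpha> \<noteq> 0"
  shows "prime_elem (lin \<alpha>)"
proof (rule prime_elemI)
  show "lin \<alpha> \<noteq> 0" using assms by (rule lin_nonzero)
  show "\<not> lin \<alpha> dvd 1" using assms by (auto simp: lin_dvd_iff intro!: exI[of _ 0])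
  fix p q assume pq: "lin \<alpha> dvd p * q"
  show "lin \<alpha> dvd p \<or> lin \<alpha> dvd q"
  proof (rule ccontr)
    assume "\<not> ?thesis"
    then obtain x y where "bil \<alpha> x = 0" "ev p x \<noteq> 0" "bil \<alpha> y = 0" "ev q y \<noteq> 0"
      using assms by (auto simp: lin_dvd_iff)
    moreover from this obtain z where "ev p (x + z *s (y - x)) * ev q (x + z *s (y - x)) \<noteq> 0"
      using poly_fun_nonzero_both[OF poly_fun_ev poly_fun_ev] by blast
    moreover have "bil \<alpha> (x + z *s (y - x)) = 0" using calculation by (simp add: bil_simps)
    ultimately show False using pq assms by (auto simp: lin_dvd_iff)
  qed
qed

section \<open>Directional derivatives of polynomials\<close>

lemma poly_fun_directional:
  assumes "poly_fun p"
  shows "\<exists>p'. poly_fun p' \<and> (\<forall>x. ((\<lambda>z. p (x + z *s v)) has_field_derivative p' x) (at 0))"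
  using assms
proof induction
  case (const c)
  show ?case by (rule exI[of _ "\<lambda>x. 0"]) (auto intro: poly_fun.const)
next
  case (coord i)
  show ?case by (rule exI[of _ "\<lambda>x. v $ i"]) (auto intro: poly_fun.const intro!: derivative_eq_intros)
next
  case (add p q)
  then obtain p' q' where "poly_fun p'" "poly_fun q'"
    "\<forall>x. ((\<lambda>z. p (x + z *s v)) has_field_derivative p' x) (at 0)"
    "\<forall>x. ((\<lambda>z. q (x + z *s v)) has_field_derivative q' x) (at 0)" by auto
  then show ?case
    by (intro exI[of _ "\<lambda>x. p' x + q' x"]) (auto intro: poly_fun.add intro!: derivative_eq_intros)
next
  case (mult p q)
  then obtain p' q' where "poly_fun p'" "poly_fun q'"
    "\<forall>x. ((\<lambda>z. p (x + z *s v)) has_field_derivative p' x) (at 0)"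
    "\<forall>x. ((\<lambda>z. q (x + z *s v)) has_field_derivative q' x) (at 0)" by auto
  with mult.hyps show ?case
    by (intro exI[of _ "\<lambda>x. p' x * q x + q' x * p x"])
      (auto intro!: poly_fun.add poly_fun.mult DERIV_mult[THEN DERIV_cong])
qed

lift_definition pd :: "complex^'n \<Rightarrow> 'n::finite pol \<Rightarrow> 'n pol"
  is "\<lambda>v p x. deriv (\<lambda>z. p (x + z *s v)) 0"
proof -
  fix v and p :: "complex^'n \<Rightarrow> complex" assume "poly_fun p"
  then obtain p' where "poly_fun p'" "\<forall>x. ((\<lambda>z. p (x + z *s v)) has_field_derivative p' x) (at 0)"
    using poly_fun_directional by blast
  then have "(\<lambda>x. deriv (\<lambda>z. p (x + z *s v)) 0) = p'" "poly_fun p'"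
    by (auto simp: DERIV_imp_deriv)
  then show "poly_fun (\<lambda>x. deriv (\<lambda>z. p (x + z *s v)) 0)"
    by simp
qed

lemma ev_pd: "((\<lambda>z. ev p (x + z *s v)) has_field_derivative ev (pd v p) x) (at 0)"
proof -
  obtain p' where "\<forall>x. ((\<lambda>z. ev p (x + z *s v)) has_field_derivative p' x) (at 0)"
    using poly_fun_directional poly_fun_ev by blast
  then show ?thesis by (metis DERIV_imp_deriv pd.rep_eq)
qed

lemma pd_eqI: "(\<And>x. ((\<lambda>z. ev p (x + z *s v)) has_field_derivative ev q x) (at 0)) \<Longrightarrow> pd v p = q"
  by (rule pol_eqI) (metis DERIV_unique ev_pd)

lemma pd_add [simp]: "pd v (p + q) = pd v p + pd v q"
  by (rule pd_eqI) (auto intro!: derivative_eq_intros ev_pd)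

lemma pd_diff [simp]: "pd v (p - q) = pd v p - pd v q"
  by (rule pd_eqI) (auto intro!: derivative_eq_intros ev_pd)

lemma pd_mult [simp]: "pd v (p * q) = pd v p * q + p * pd v q"
  by (rule pd_eqI) (auto intro!: DERIV_mult[THEN DERIV_cong] ev_pd simp: algebra_simps)

lemma pd_pcst [simp]: "pd v (pcst c) = 0"
  by (rule pd_eqI) simp

lemma pd_pcrd [simp]: "pd v (pcrd i) = pcst (v $ i)"
  by (rule pd_eqI) (auto intro!: derivative_eq_intros)

lemma pd_lin [simp]: "pd v (lin \<alpha>) = pcst (bil \<alpha> v)"
  by (rule pd_eqI) (auto simp: bil_simps intro!: derivative_eq_intros)

lemma pd_0 [simp]: "pd v 0 = 0" and pd_1 [simp]: "pd v 1 = 0"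
  using pd_pcst[of v 0] pd_pcst[of v 1] by (simp_all add: pcst_hom del: pd_pcst)

lemma pd_add_dir: "pd (v + w) p = pd v p + pd w p"
  by (induction p rule: pol_induct) (auto simp: pcst_hom algebra_simps)

lemma pd_scale_dir: "pd (c *s v) p = pcst c * pd v p"
  by (induction p rule: pol_induct) (auto simp: pcst_hom algebra_simps)

lemma pd_commute: "pd v (pd w p) = pd w (pd v p)"
  by (induction p rule: pol_induct) (auto simp: pcst_hom algebra_simps)

section \<open>Substituting a reflection into a polynomial\<close>

lift_definition psub :: "complex^'n \<Rightarrow> 'n::finite pol \<Rightarrow> 'n pol"
  is "\<lambda>\<alpha> p x. p (reflect \<alpha> x)"
proof -
  fix \<alpha> and p :: "complex^'n \<Rightarrow> complex" assume "poly_fun p"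
  then show "poly_fun (\<lambda>x. p (reflect \<alpha> x))"
  proof induction
    case (coord i)
    show ?case
      by (simp add: reflect_def divide_inverse)
        (intro poly_fun_diff poly_fun.mult poly_fun.coord poly_fun.const poly_fun_bil)
  qed (auto intro: poly_fun.intros)
qed

lemma ev_psub [simp]: "ev (psub \<alpha> p) x = ev p (reflect \<alpha> x)"
  by transfer simp

lemma psub_hom [simp]: "psub \<alpha> (p + q) = psub \<alpha> p + psub \<alpha> q" "psub \<alpha> (p - q) = psub \<alpha> p - psub \<alpha> q"
  "psub \<alpha> (p * q) = psub \<alpha> p * psub \<alpha> q" "psub \<alpha> (- p) = - psub \<alpha> p" "psub \<alpha> 0 = 0" "psub \<alpha> 1 = 1"
  "psub \<alpha> (pcst c) = pcst c"
  by (rule pol_eqI, simp)+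

lemma psub_invol: "bil \<alpha> \<alpha> \<noteq> 0 \<Longrightarrow> psub \<alpha> (psub \<alpha> p) = p"
  by (rule pol_eqI) (simp add: reflect_invol)

lemma psub_eq_0_iff: "bil \<alpha> \<alpha> \<noteq> 0 \<Longrightarrow> psub \<alpha> p = 0 \<longleftrightarrow> p = 0"
  by (metis psub_invol psub_hom(5))

lemma pd_psub: "pd v (psub \<alpha> p) = psub \<alpha> (pd (reflect \<alpha> v) p)"
proof (rule pd_eqI)
  fix x
  have "((\<lambda>z. ev p (reflect \<alpha> x + z *s reflect \<alpha> v)) has_field_derivative
      ev (pd (reflect \<alpha> v) p) (reflect \<alpha> x)) (at 0)"
    by (rule ev_pd)
  then show "((\<lambda>z. ev (psub \<alpha> p) (x + z *s v)) has_field_derivative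
      ev (psub \<alpha> (pd (reflect \<alpha> v) p)) x) (at 0)"
    by (simp add: reflect_add reflect_scale)
qed

text \<open>The reflection fixes the hyperplane pointwise, so on it an odd polynomial equals its own
  negative.\<close>

lemma lin_dvd_odd:
  assumes "bil \<alpha> \<alpha> \<noteq> 0" "psub \<alpha> p = - p"
  shows "lin \<alpha> dvd p"
proof (subst lin_dvd_iff[OF assms(1)], intro allI impI)
  fix x assume "bil \<alpha> x = 0"
  then have "ev p x = ev (psub \<alpha> p) x" by (simp add: reflect_orth)
  then show "ev p x = 0" using assms(2) by simp
qed

lemma ev_euler: "ev (pd x p) x = (\<Sum>i\<in>UNIV. x $ i * ev (pd (axis i 1) p) x)"
  by (induction p rule: pol_induct)
    (auto simp: axis_def if_distrib if_distribR sum.distrib sum_distrib_left sum_distrib_right algebra_simps cong: if_cong)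

text \<open>Along a ray from the origin Euler's identity makes \<open>s\<^sup>e p(s x)\<close> constant, with value 0 at \<open>s = 0\<close>.\<close>
lemma euler_negative_degree:
  fixes p :: "'n::finite pol"
  assumes "(\<Sum>i\<in>UNIV. pcrd i * pd (axis i 1) p) = - (of_nat e * p)" and "e > 0"
  shows "p = 0"
proof (rule pol_eqI)
  fix x :: "complex^'n"
  have of_nat: "ev (of_nat e) y = of_nat e" for y by (induction e) auto
  have E: "ev (pd y p) y = - (of_nat e * ev p y)" for y
    using arg_cong[OF assms(1), of "\<lambda>q. ev q y"] ev_euler[of y p] by (simp add: of_nat)
  define g where "g s = ev p (s *s x)" for s
  have dg: "(g has_field_derivative ev (pd x p) (s *s x)) (at s)" for s
  proof -
    have "((\<lambda>z. g (s + z)) has_field_derivative ev (pd x p) (s *s x)) (at 0)"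
      using ev_pd[of p "s *s x" x] by (simp add: g_def vector_sadd_rdistrib)
    then show ?thesis using DERIV_shift[of g _ 0 s] by (simp add: add.commute)
  qed
  have Es: "s * ev (pd x p) (s *s x) = - (of_nat e * g s)" for s
    using E[of "s *s x"] by (simp add: pd_scale_dir g_def)
  have "((\<lambda>s. s ^ e * g s) has_field_derivative 0) (at s)" for s
  proof -
    have "((\<lambda>s. s ^ e * g s) has_field_derivative
        of_nat e * s ^ (e - 1) * g s + s ^ e * ev (pd x p) (s *s x)) (at s)"
      by (auto intro!: derivative_eq_intros dg)
    also have "s ^ e = s ^ (e - 1) * s" using assms(2) by (metis Suc_pred' power_Suc2)
    finally have "((\<lambda>s. s ^ e * g s) has_field_derivative
        s ^ (e - 1) * (of_nat e * g s + s * ev (pd x p) (s *s x))) (at s)"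
      by (simp add: algebra_simps)
    then show ?thesis unfolding Es by simp
  qed
  then obtain c where c: "\<And>s. s ^ e * g s = c"
    using has_field_derivative_zero_constant[of UNIV "\<lambda>s. s ^ e * g s"] by auto
  have "g 1 = 0" using c[of 0] c[of 1] assms(2) by (simp add: zero_power)
  then show "ev p x = ev 0 x" by (simp add: g_def)
qed

subsection \<open>The field of rational functions\<close>

type_synonym 'n rfun = "'n pol fract"

definition emb :: "'n::finite pol \<Rightarrow> 'n rfun" where "emb p = Fract p 1"

abbreviation cst :: "complex \<Rightarrow> 'n::finite rfun" where "cst c \<equiv> emb (pcst c)"

lemma emb_hom: "emb (p + q) = emb p + emb q" "emb (p - q) = emb p - emb q"
  "emb (p * q) = emb p * emb q" "emb (- p) = - emb p" "emb 0 = 0" "emb 1 = 1"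
  by (simp_all add: emb_def fract_collapse)

lemma emb_sum: "emb (sum f I) = (\<Sum>i\<in>I. emb (f i))"
  by (induction I rule: infinite_finite_induct) (auto simp: emb_hom)

lemma emb_power: "emb (p ^ m) = emb p ^ m"
  by (induction m) (auto simp: emb_hom)

lemma emb_inj [simp]: "emb p = emb q \<longleftrightarrow> p = q"
  by (simp add: emb_def eq_fract)

lemma emb_eq_0_iff [simp]: "emb p = 0 \<longleftrightarrow> p = 0"
  by (metis emb_hom(5) emb_inj)

lemma Fract_emb: "Fract a b = emb a / emb b"
  by (simp add: emb_def)

lemma rfun_cases: obtains a b where "\<phi> = emb a / emb b" "b \<noteq> 0"
  by (cases \<phi>) (auto simp: Fract_emb)

lemma cst_of_nat: "cst (of_nat m) = of_nat m"
  by (induction m) (auto simp: pcst_hom emb_hom)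

lift_definition pdf :: "complex^'n \<Rightarrow> 'n::finite rfun \<Rightarrow> 'n rfun"
  is "\<lambda>v q. (pd v (fst q) * snd q - fst q * pd v (snd q), snd q * snd q)"
proof -
  fix v :: "complex^'n" and q r :: "'n pol \<times> 'n pol"
  assume "fractrel q r"
  then have nz: "snd q \<noteq> 0" "snd r \<noteq> 0" and eq: "fst q * snd r = fst r * snd q" by auto
  \<comment> \<open>Differentiating the cross-multiplied equality makes the quotient rule
    independent of the representative.\<close>
  have d: "pd v (fst q) * snd r + fst q * pd v (snd r) = pd v (fst r) * snd q + fst r * pd v (snd q)"
    using arg_cong[OF eq, of "pd v"] by simp
  have "(pd v (fst q) * snd q - fst q * pd v (snd q)) * (snd r * snd r) =
      (pd v (fst r) * snd r - fst r * pd v (snd r)) * (snd q * snd q)"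
    using d eq by algebra
  then show "fractrel (pd v (fst q) * snd q - fst q * pd v (snd q), snd q * snd q)
      (pd v (fst r) * snd r - fst r * pd v (snd r), snd r * snd r)"
    using nz by simp
qed

lemma pdf_Fract: "b \<noteq> 0 \<Longrightarrow> pdf v (Fract a b) = Fract (pd v a * b - a * pd v b) (b * b)"
  by transfer simp

lemma pdf_quot: "b \<noteq> 0 \<Longrightarrow> pdf v (emb a / emb b) = emb (pd v a * b - a * pd v b) / emb (b * b)"
  using pdf_Fract by (simp add: Fract_emb)

lemma pdf_emb [simp]: "pdf v (emb a) = emb (pd v a)"
  using pdf_Fract[of 1 v a] by (simp add: emb_def)

lemma pdf_add [simp]: "pdf v (x + y) = pdf v x + pdf v y"
  by (cases x; cases y) (simp add: pdf_Fract eq_fract algebra_simps)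

lemma pdf_mult [simp]: "pdf v (x * y) = pdf v x * y + x * pdf v y"
  by (cases x; cases y) (simp add: pdf_Fract eq_fract algebra_simps)

lemma pdf_0 [simp]: "pdf v 0 = 0" and pdf_1 [simp]: "pdf v 1 = 0"
  using pdf_emb[of v 0] pdf_emb[of v 1] by (simp_all add: emb_hom del: pdf_emb)

lemma pdf_minus [simp]: "pdf v (- x) = - pdf v x"
  using pdf_add[of v x "- x"] by (simp del: pdf_add add: add_eq_0_iff)

lemma pdf_diff [simp]: "pdf v (x - y) = pdf v x - pdf v y"
  using pdf_add[of v x "- y"] by simp

lemma pdf_of_nat [simp]: "pdf v (of_nat m) = 0"
  by (induction m) auto

lemma pdf_of_int [simp]: "pdf v (of_int m) = 0"
  by (cases m) auto

lemma pdf_inverse: "x \<noteq> 0 \<Longrightarrow> pdf v (inverse x) = - pdf v x * inverse x ^ 2"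
proof -
  assume x: "x \<noteq> 0"
  have "pdf v x * inverse x + x * pdf v (inverse x) = 0"
    using pdf_mult[of v x "inverse x"] x by (simp del: pdf_mult)
  then have "x * pdf v (inverse x) = - (pdf v x * inverse x)" by (metis add_eq_0_iff)
  then have "inverse x * (x * pdf v (inverse x)) = - (pdf v x * inverse x) * inverse x" by simp
  then show ?thesis using x by (simp add: power2_eq_square mult.assoc[symmetric])
qed

lemma pdf_add_dir: "pdf (v + w) x = pdf v x + pdf w x"
  by (cases x) (simp add: pdf_Fract eq_fract pd_add_dir algebra_simps)

lemma pdf_scale_dir: "pdf (c *s v) x = cst c * pdf v x"
  by (cases x) (simp add: pdf_Fract eq_fract pd_scale_dir emb_def algebra_simps)

lemma pdf_commute: "pdf v (pdf w x) = pdf w (pdf v x)"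
  by (cases x) (simp add: pdf_Fract eq_fract pd_commute algebra_simps)

lemma pdf_power: "pdf v (x ^ m) = of_nat m * x ^ (m - 1) * pdf v x"
proof (induction m)
  case (Suc m)
  then show ?case by (cases m) (auto simp: algebra_simps)
qed simp

lemma pdf_powi:
  assumes "x \<noteq> 0"
  shows "pdf v (x powi m) = of_int m * x powi (m - 1) * pdf v x"
proof (induction m rule: int_induct[where k = 0])
  case (step1 i)
  have "x powi (i + 1) = x powi i * x" "x * x powi (i - 1) = x powi i"
    using assms by (simp_all add: power_int_add_1 power_int_diff)
  with step1 show ?case by (simp add: algebra_simps)
next
  case (step2 i)
  have *: "x powi (i - 1) = x powi i * inverse x" "x powi (i - 1 - 1) = x powi i * inverse x ^ 2"
    using assms by (simp_all add: power_int_diff divide_inverse power2_eq_square)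
  show ?case unfolding *(1) pdf_mult step2 pdf_inverse[OF assms] unfolding *
    by (simp add: algebra_simps power2_eq_square)
qed simp

text \<open>The identity for isotropic \<open>\<alpha>\<close>, so that this is always a ring homomorphism.\<close>
lift_definition subf :: "complex^'n \<Rightarrow> 'n::finite rfun \<Rightarrow> 'n rfun"
  is "\<lambda>\<alpha> q. if bil \<alpha> \<alpha> = 0 then q else (psub \<alpha> (fst q), psub \<alpha> (snd q))"
proof -
  fix \<alpha> :: "complex^'n" and q r :: "'n pol \<times> 'n pol"
  assume "fractrel q r"
  then have "snd q \<noteq> 0" "snd r \<noteq> 0" "fst q * snd r = fst r * snd q" by auto
  moreover from this(3) have "psub \<alpha> (fst q) * psub \<alpha> (snd r) = psub \<alpha> (fst r) * psub \<alpha> (snd q)"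
    by (metis psub_hom(3))
  ultimately show "fractrel (if bil \<alpha> \<alpha> = 0 then q else (psub \<alpha> (fst q), psub \<alpha> (snd q)))
     (if bil \<alpha> \<alpha> = 0 then r else (psub \<alpha> (fst r), psub \<alpha> (snd r)))"
    by (auto simp: psub_eq_0_iff)
qed

lemma subf_Fract: "bil \<alpha> \<alpha> \<noteq> 0 \<Longrightarrow> b \<noteq> 0 \<Longrightarrow> subf \<alpha> (Fract a b) = Fract (psub \<alpha> a) (psub \<alpha> b)"
  by (simp add: Fract.abs_eq subf.abs_eq psub_eq_0_iff)

lemma subf_isotropic: "bil \<alpha> \<alpha> = 0 \<Longrightarrow> subf \<alpha> x = x"
  by (cases x) (simp add: Fract.abs_eq subf.abs_eq)

lemma subf_emb: "bil \<alpha> \<alpha> \<noteq> 0 \<Longrightarrow> subf \<alpha> (emb a) = emb (psub \<alpha> a)"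
  by (simp add: emb_def subf_Fract)

lemma subf_0 [simp]: "subf \<alpha> 0 = 0" and subf_1 [simp]: "subf \<alpha> 1 = 1" and subf_cst [simp]: "subf \<alpha> (cst c) = cst c"
  using subf_emb[of \<alpha> 0] subf_emb[of \<alpha> 1] subf_emb[of \<alpha> "pcst c"] subf_isotropic[of \<alpha>]
  by (auto simp: emb_hom)

lemma subf_add [simp]: "subf \<alpha> (x + y) = subf \<alpha> x + subf \<alpha> y"
  by (cases "bil \<alpha> \<alpha> = 0"; cases x; cases y)
    (simp_all add: subf_isotropic subf_Fract psub_eq_0_iff)

lemma subf_mult [simp]: "subf \<alpha> (x * y) = subf \<alpha> x * subf \<alpha> y"
  by (cases "bil \<alpha> \<alpha> = 0"; cases x; cases y)
    (simp_all add: subf_isotropic subf_Fract psub_eq_0_iff)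

lemma subf_minus [simp]: "subf \<alpha> (- x) = - subf \<alpha> x"
  using subf_add[of \<alpha> x "- x"] by (simp del: subf_add add: add_eq_0_iff)

lemma subf_diff [simp]: "subf \<alpha> (x - y) = subf \<alpha> x - subf \<alpha> y"
  using subf_add[of \<alpha> x "- y"] by simp

lemma subf_power [simp]: "subf \<alpha> (x ^ m) = subf \<alpha> x ^ m"
  by (induction m) auto

lemma subf_sum: "subf \<alpha> (sum f I) = (\<Sum>i\<in>I. subf \<alpha> (f i))"
  by (induction I rule: infinite_finite_induct) auto

lemma subf_invol [simp]: "subf \<alpha> (subf \<alpha> x) = x"
  by (cases "bil \<alpha> \<alpha> = 0"; cases x)
    (simp_all add: subf_isotropic subf_Fract psub_eq_0_iff psub_invol)

lemma subf_inverse [simp]: "subf \<alpha> (inverse x) = inverse (subf \<alpha> x)"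
proof (cases "x = 0")
  case False
  then have "subf \<alpha> x * subf \<alpha> (inverse x) = 1" by (simp flip: subf_mult)
  then show ?thesis by (metis inverse_unique)
qed simp

lemma subf_divide [simp]: "subf \<alpha> (x / y) = subf \<alpha> x / subf \<alpha> y"
  by (simp add: divide_inverse)

lemma subf_lin: "bil \<alpha> \<alpha> \<noteq> 0 \<Longrightarrow> subf \<alpha> (emb (lin \<beta>)) = emb (lin (reflect \<alpha> \<beta>))"
  by (simp add: subf_emb) (rule pol_eqI, simp add: reflect_adjoint)

lemma subf_lin_self: "bil \<alpha> \<alpha> \<noteq> 0 \<Longrightarrow> subf \<alpha> (emb (lin \<alpha>)) = - emb (lin \<alpha>)"
proof -
  assume "bil \<alpha> \<alpha> \<noteq> 0"
  moreover have "lin (- \<alpha>) = - lin \<alpha>" by (rule pol_eqI) (simp add: bil_simps)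
  ultimately show ?thesis by (simp add: subf_lin reflect_self emb_hom)
qed

lemma pdf_subf:
  assumes "bil \<alpha> \<alpha> \<noteq> 0"
  shows "pdf v (subf \<alpha> x) = subf \<alpha> (pdf (reflect \<alpha> v) x)"
  using assms by (cases x) (simp add: subf_Fract pdf_Fract psub_eq_0_iff pd_psub)

subsection \<open>Operators on rational functions\<close>

text \<open>All complex-linear endomorphisms of the field of rational functions, a ring in which
  commutators can be computed without expanding differential operators into coefficients. Linearity
  over the constants makes \<open>mul (cst c)\<close> central.\<close>

typedef 'n::finite rop = "{X :: 'n rfun \<Rightarrow> 'n rfun.
    (\<forall>x y. X (x + y) = X x + X y) \<and> (\<forall>c x. X (cst c * x) = cst c * X x)}"
  morphisms app Rop
  by (rule exI[of _ "\<lambda>x. 0"]) simp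

setup_lifting type_definition_rop

lemma app_add [simp]: "app X (x + y) = app X x + app X y"
  and app_cst: "app X (cst c * x) = cst c * app X x"
  using app[of X] by auto

lemma rop_eqI: "(\<And>x. app X x = app Y x) \<Longrightarrow> X = Y"
  by (metis app_inverse ext)

lemma app_0 [simp]: "app X 0 = 0"
  by (metis add.right_neutral add_left_imp_eq app_add)

instantiation rop :: (finite) ring_1
begin

lift_definition zero_rop :: "'a rop" is "\<lambda>x. 0" by simp
lift_definition one_rop :: "'a rop" is "\<lambda>x. x" by simp
lift_definition plus_rop :: "'a rop \<Rightarrow> 'a rop \<Rightarrow> 'a rop" is "\<lambda>X Y x. X x + Y x"
  by (simp add: algebra_simps)
lift_definition minus_rop :: "'a rop \<Rightarrow> 'a rop \<Rightarrow> 'a rop" is "\<lambda>X Y x. X x - Y x"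
  by (simp add: algebra_simps)
lift_definition uminus_rop :: "'a rop \<Rightarrow> 'a rop" is "\<lambda>X x. - X x"
  by (simp add: algebra_simps)
lift_definition times_rop :: "'a rop \<Rightarrow> 'a rop \<Rightarrow> 'a rop" is "\<lambda>X Y x. X (Y x)"
  by simp

lemma app_ops: "app 0 x = 0" "app 1 x = x" "app (X + Y) x = app X x + app Y x"
  "app (X - Y) x = app X x - app Y x" "app (- X) x = - app X x" "app (X * Y) x = app X (app Y x)"
  for x :: "'a rfun"
  by (simp_all add: zero_rop.rep_eq one_rop.rep_eq plus_rop.rep_eq minus_rop.rep_eq
      uminus_rop.rep_eq times_rop.rep_eq)

instance
proof
  fix a b c :: "'a rop"
  show "a * b * c = a * (b * c)" "1 * a = a" "a * 1 = a" "a + b + c = a + (b + c)"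
    "a + b = b + a" "0 + a = a" "- a + a = 0" "a - b = a + - b" "(a + b) * c = a * c + b * c"
    "a * (b + c) = a * b + a * c"
    by (rule rop_eqI, simp add: app_ops)+
  show "(0::'a rop) \<noteq> 1"
    using app_ops(1,2)[of "1 :: 'a rfun"] by force
qed

end

declare app_ops [simp]

lemma app_sum: "app (sum X I) x = (\<Sum>i\<in>I. app (X i) x)"
  by (induction I rule: infinite_finite_induct) auto

lemma app_sum_right: "app X (sum f I) = (\<Sum>i\<in>I. app X (f i))"
  by (induction I rule: infinite_finite_induct) auto

lemma app_of_nat [simp]: "app (of_nat m) x = of_nat m * x"
  by (induction m) (auto simp: algebra_simps)

lemma app_of_int [simp]: "app (of_int m) x = of_int m * x"
proof (cases m rule: int_cases2)
  case (nonpos n)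
  then have "of_int m = - (of_nat n :: 'a rop)" "of_int m = - (of_nat n :: 'a rfun)" by simp_all
  then show ?thesis by simp
qed simp

lemma app_numeral [simp]: "app (numeral m) x = numeral m * x"
  using app_of_nat[of "numeral m"] by simp

definition mul :: "'n::finite rfun \<Rightarrow> 'n rop" where "mul f = Rop (\<lambda>x. f * x)"

definition part :: "complex^'n \<Rightarrow> 'n::finite rop" where "part v = Rop (pdf v)"

lemma app_mul [simp]: "app (mul f) x = f * x"
  by (simp add: mul_def Rop_inverse algebra_simps)

lemma app_part [simp]: "app (part v) x = pdf v x"
  by (simp add: part_def Rop_inverse)

lemma mul_hom: "mul (f + g) = mul f + mul g" "mul (f - g) = mul f - mul g" "mul (f * g) = mul f * mul g"
  "mul (- f) = - mul f" "mul 0 = 0" "mul 1 = 1"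
  by (rule rop_eqI, simp add: algebra_simps)+

lemma mul_commute: "mul f * mul g = mul g * mul f"
  by (rule rop_eqI) (simp add: algebra_simps)

lemma mul_cst_central: "X * mul (cst c) = mul (cst c) * X"
  by (rule rop_eqI) (simp add: app_cst)

lemma mul_cst_central2: "X * (mul (cst c) * Y) = mul (cst c) * (X * Y)"
  by (simp add: mul_cst_central flip: mult.assoc)

lemma part_mul: "part v * mul f = mul f * part v + mul (pdf v f)"
  by (rule rop_eqI) simp

lemma part_commute: "part v * part w = part w * part v"
  by (rule rop_eqI) (simp add: pdf_commute)

lemma part_add: "part (v + w) = part v + part w"
  and part_scale: "part (c *s v) = mul (cst c) * part v"
  by (rule rop_eqI, simp add: pdf_add_dir pdf_scale_dir)+

lemma part_0 [simp]: "part 0 = 0"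
  using part_add[of 0 0] by simp

lemma part_sum: "part (sum v I) = (\<Sum>i\<in>I. part (v i))"
  by (induction I rule: infinite_finite_induct) (auto simp: part_add)

lemma part_minus: "part (- v) = - part v"
  using part_add[of v "- v"] by (simp add: add_eq_0_iff)

lemma part_coords: "part v = (\<Sum>i\<in>UNIV. mul (cst (v $ i)) * part (axis i 1))"
proof -
  have "v = (\<Sum>i\<in>UNIV. (v $ i) *s axis i 1)"
    by (simp add: vec_eq_iff axis_def if_distrib cong: if_cong)
  then have "part v = part (\<Sum>i\<in>UNIV. (v $ i) *s axis i 1)" by simp
  then show ?thesis by (simp only: part_sum part_scale)
qed

section \<open>Commutators with Schroedinger operators\<close>

definition cm :: "'n::finite rop \<Rightarrow> 'n rop \<Rightarrow> 'n rop" where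
  "cm X Y = X * Y - Y * X"

definition lapl :: "'n::finite rop" where
  "lapl = (\<Sum>i\<in>UNIV. part (axis i 1) * part (axis i 1))"

definition lop :: "'n::finite rfun \<Rightarrow> 'n rop" where
  "lop u = lapl - mul u"

lemma cm_part_mul: "cm (part v) (mul f) = mul (pdf v f)"
  by (simp add: cm_def part_mul)

lemma cm_mult_left: "cm (X * Y) Z = X * cm Y Z + cm X Z * Y"
  and cm_mult_right: "cm X (Y * Z) = cm X Y * Z + Y * cm X Z"
  and cm_add_left: "cm (X + Y) Z = cm X Z + cm Y Z"
  and cm_add_right: "cm X (Y + Z) = cm X Y + cm X Z"
  and cm_diff_left: "cm (X - Y) Z = cm X Z - cm Y Z"
  and cm_diff_right: "cm X (Y - Z) = cm X Y - cm X Z"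
  by (simp_all add: cm_def algebra_simps)

lemma cm_sum_left: "cm (sum X I) Z = (\<Sum>i\<in>I. cm (X i) Z)"
  by (simp add: cm_def sum_distrib_left sum_distrib_right sum_subtractf)

lemma cm_sum_right: "cm Z (sum X I) = (\<Sum>i\<in>I. cm Z (X i))"
  by (simp add: cm_def sum_distrib_left sum_distrib_right sum_subtractf)

lemma cm_lapl_mul:
  "cm lapl (mul f) = mul (app lapl f) + 2 * (\<Sum>i\<in>UNIV. mul (pdf (axis i 1) f) * part (axis i 1))"
proof (rule rop_eqI)
  fix x
  show "app (cm lapl (mul f)) x =
    app (mul (app lapl f) + 2 * (\<Sum>i\<in>UNIV. mul (pdf (axis i 1) f) * part (axis i 1))) x"
    by (simp add: cm_def lapl_def app_sum algebra_simps sum.distrib sum_distrib_left)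
qed

lemma cm_lop_mul:
  "cm (lop u) (mul f) = mul (app lapl f) + 2 * (\<Sum>i\<in>UNIV. mul (pdf (axis i 1) f) * part (axis i 1))"
  by (simp add: lop_def cm_diff_left cm_lapl_mul) (simp add: cm_def mul_commute)

lemma cm_lapl_part: "cm lapl (part v) = 0"
  by (simp add: lapl_def cm_sum_left cm_mult_left) (simp add: cm_def part_commute)

lemma cm_lop_part: "cm (lop u) (part v) = mul (pdf v u)"
  by (simp add: lop_def cm_diff_left cm_lapl_part) (simp add: cm_def part_mul)

section \<open>Leading symbols through commutators with linear functions\<close>

definition kk :: "complex^'n \<Rightarrow> 'n::finite rop \<Rightarrow> 'n rop" where
  "kk \<xi> X = cm X (mul (emb (lin \<xi>)))"

lemma kk_lop: "kk \<xi> (lop u) = 2 * part \<xi>"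
  unfolding kk_def cm_lop_mul
  by (subst part_coords[of \<xi>]) (simp add: lapl_def app_sum bil_axis_right emb_hom mul_hom)

lemma kk_add: "kk \<xi> (X + Y) = kk \<xi> X + kk \<xi> Y"
  and kk_diff: "kk \<xi> (X - Y) = kk \<xi> X - kk \<xi> Y"
  and kk_mult: "kk \<xi> (X * Y) = kk \<xi> X * Y + X * kk \<xi> Y"
  by (simp_all add: kk_def cm_add_left cm_diff_left cm_mult_left)

lemma kk_0 [simp]: "kk \<xi> 0 = 0"
  by (simp add: kk_def cm_def)

lemma kk_of_nat [simp]: "kk \<xi> (of_nat m * X) = of_nat m * kk \<xi> X"
  by (induction m) (auto simp: algebra_simps kk_add)

lemma kk_mul [simp]: "kk \<xi> (mul f) = 0"
  by (simp add: kk_def cm_def mul_commute)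

lemma kk_part: "kk \<xi> (part v) = mul (cst (bil \<xi> v))"
  by (simp add: kk_def cm_part_mul)

lemma kk_cm_part: "kk \<xi> (cm (part v) X) = cm (part v) (kk \<xi> X)"
  by (simp add: cm_def kk_diff kk_mult kk_part mul_cst_central)

lemma kk_commute: "kk \<xi> (kk \<eta> X) = kk \<eta> (kk \<xi> X)"
  by (simp add: kk_def cm_def algebra_simps mul_commute)
    (simp add: mul_commute[of "emb (lin \<xi>)"] flip: mult.assoc)

lemma kk_dir_add: "kk (\<xi> + \<eta>) X = kk \<xi> X + kk \<eta> X"
  by (simp add: kk_def lin_add emb_hom mul_hom cm_add_right)

lemma kk_dir_scale: "kk (c *s \<xi>) X = mul (cst c) * kk \<xi> X"
  by (simp add: kk_def lin_scale emb_hom mul_hom cm_def mul_cst_central mul_cst_central2 algebra_simps)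

text \<open>Applied to a differential operator of order at most \<open>length xs\<close>, this gives
  multiplication by the polarisation of the leading symbol at \<open>xs\<close>, up to the factorial
  of the length.\<close>

fun kl :: "(complex^'n) list \<Rightarrow> 'n::finite rop \<Rightarrow> 'n rop" where
  "kl [] X = X"
| "kl (\<xi> # xs) X = kl xs (kk \<xi> X)"

lemma kl_add: "kl xs (X + Y) = kl xs X + kl xs Y"
  by (induction xs arbitrary: X Y) (auto simp: kk_add)

lemma kl_of_nat: "kl xs (of_nat m * X) = of_nat m * kl xs X"
  by (induction xs arbitrary: X) auto

lemma kl_mul_cst: "kl xs (mul (cst c) * X) = mul (cst c) * kl xs X"
  by (induction xs arbitrary: X) (auto simp: kk_mult)

lemma kl_0 [simp]: "kl xs 0 = 0"
  by (induction xs) auto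

lemma kl_append: "kl (xs @ ys) X = kl ys (kl xs X)"
  by (induction xs arbitrary: X) auto

lemma kl_kk: "kl xs (kk \<xi> X) = kk \<xi> (kl xs X)"
proof (induction xs arbitrary: X)
  case (Cons \<eta> xs)
  then show ?case by (metis kk_commute kl.simps(2))
qed simp

lemma kl_cm_part: "kl xs (cm (part v) X) = cm (part v) (kl xs X)"
  by (induction xs arbitrary: X) (auto simp: kk_cm_part)

lemma kk_funpow_kl: "(kk \<alpha> ^^ a) X = kl (replicate a \<alpha>) X"
  by (induction a arbitrary: X) (auto simp: funpow_Suc_right simp del: funpow.simps)

text \<open>The action of \<open>ad\<close> on coefficients: the commutators of an operator with linear functions
  recover its leading symbol, on which the Laplacian acts through \<open>2(\<xi>,\<partial>)\<close>.\<close>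
definition adj :: "'n::finite rfun \<Rightarrow> 'n rfun \<Rightarrow> 'n rop \<Rightarrow> 'n rop" where
  "adj u1 u2 X = lop u1 * X - X * lop u2"

lemma adj_0 [simp]: "adj u1 u2 0 = 0"
  by (simp add: adj_def)

lemma kk_adj: "kk \<xi> (adj u1 u2 X) = adj u1 u2 (kk \<xi> X) + 2 * cm (part \<xi>) X"
  by (simp add: adj_def kk_diff kk_mult kk_lop cm_def algebra_simps)
    (simp add: mult_2 mult_2_right algebra_simps)

text \<open>Each of the \<open>a\<close> commutators may hit the Laplacian, whose commutator with
  (\<alpha>,x) is twice the derivative along \<alpha>; hence the factor 2a. For a = 0 this factor is
  0, so the truncated exponent \<open>a - 1\<close> does no harm.\<close>

lemma kk_pow_adj:
  "(kk \<alpha> ^^ a) (adj u1 u2 X) =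
    adj u1 u2 ((kk \<alpha> ^^ a) X) + of_nat (2 * a) * cm (part \<alpha>) ((kk \<alpha> ^^ (a - 1)) X)"
proof (induction a)
  case (Suc a)
  have "of_nat (2 * a) * kk \<alpha> (cm (part \<alpha>) ((kk \<alpha> ^^ (a - 1)) X)) =
      of_nat (2 * a) * cm (part \<alpha>) ((kk \<alpha> ^^ a) X)"
    by (cases a) (simp_all add: kk_cm_part)
  then have "(kk \<alpha> ^^ Suc a) (adj u1 u2 X) =
      adj u1 u2 ((kk \<alpha> ^^ Suc a) X) + (2 * cm (part \<alpha>) ((kk \<alpha> ^^ a) X) +
        of_nat (2 * a) * cm (part \<alpha>) ((kk \<alpha> ^^ a) X))"
    by (simp only: funpow.simps o_apply Suc.IH kk_add kk_adj kk_of_nat add.assoc)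
  also have "2 * cm (part \<alpha>) ((kk \<alpha> ^^ a) X) + of_nat (2 * a) * cm (part \<alpha>) ((kk \<alpha> ^^ a) X) =
      of_nat (2 * Suc a) * cm (part \<alpha>) ((kk \<alpha> ^^ a) X)"
    by (simp add: algebra_simps mult_2)
  finally show ?case by simp
qed simp

text \<open>The polarised form of \<open>kk_pow_adj\<close>: the term number \<open>m\<close> arises
  when the commutator with the entry number \<open>m\<close> hits the Laplacian, and so it lacks
  that entry.\<close>

lemma kl_adj:
  "kl xs (adj u1 u2 X) = adj u1 u2 (kl xs X) +
    2 * (\<Sum>m<length xs. cm (part (xs ! m)) (kl (take m xs @ drop (Suc m) xs) X))"
proof (induction xs arbitrary: X)
  case (Cons \<xi> xs)
  have "kl xs (2 * cm (part \<xi>) X) = 2 * cm (part \<xi>) (kl xs X)"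
    using kl_of_nat[of xs 2] by (simp add: kl_cm_part)
  then show ?case
    by (simp add: kk_adj kl_add Cons.IH sum.lessThan_Suc_shift algebra_simps del: sum.lessThan_Suc)
qed simp

text \<open>For a differential operator this says that the order is less than
  \<open>m\<close>.\<close>

definition van :: "nat \<Rightarrow> 'n::finite rop \<Rightarrow> bool" where
  "van m X \<longleftrightarrow> (\<forall>xs. length xs = m \<longrightarrow> kl xs X = 0)"

lemma van_Suc: "van (Suc m) X \<longleftrightarrow> (\<forall>\<xi>. van m (kk \<xi> X))"
  unfolding van_def by (metis kl.simps(2) length_Cons length_Suc_conv)

text \<open>The two operators have the same principal part, so the order rises by at most one
  although they have order two. In the induction \<open>kk_adj\<close> reduces the claim to a
  commutator with \<open>part \<xi>\<close>, which preserves the order.\<close>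

lemma van_adj: "van m X \<Longrightarrow> van (Suc m) (adj u1 u2 X)"
proof (induction m arbitrary: X)
  case 0
  then show ?case by (auto simp: van_def)
next
  case (Suc m)
  show ?case unfolding van_Suc[of "Suc m"]
  proof
    fix \<xi>
    have "van (Suc m) (adj u1 u2 (kk \<xi> X))" using Suc by (simp add: van_Suc)
    moreover have "kl xs (2 * cm (part \<xi>) X) = 0" if "length xs = Suc m" for xs
      using kl_of_nat[of xs 2] that Suc.prems by (simp add: kl_cm_part van_def) (simp add: cm_def)
    ultimately show "van (Suc m) (kk \<xi> (adj u1 u2 X))" by (simp add: kk_adj van_def kl_add)
  qed
qed

text \<open>Commuting with linear functions implies commuting with polynomials, and then with
  quotients: \<open>X\<close> is applied to b((a/b)\<psi>) = a\<psi> and \<open>b\<close> is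
  cancelled.\<close>

lemma kk_zero_imp_mul:
  assumes "\<And>\<xi>. kk \<xi> X = 0"
  shows "X = mul (app X 1)"
proof -
  define C where "C \<phi> \<longleftrightarrow> (\<forall>\<psi>. app X (\<phi> * \<psi>) = \<phi> * app X \<psi>)" for \<phi>
  have lin: "C (emb (lin \<xi>))" for \<xi>
    using arg_cong[OF assms[of \<xi>], of app] by (simp add: kk_def cm_def C_def fun_eq_iff)
  have pol: "C (emb p)" for p
  proof (induction p rule: pol_induct)
    case (const c) then show ?case by (simp add: C_def app_cst)
  next
    case (coord i)
    have "pcrd i = lin (axis i 1)" by (rule pol_eqI) (simp add: bil_axis_left)
    then show ?case using lin by simp
  next
    case (add p q) then show ?case by (simp add: C_def emb_hom distrib_right)
  next
    case (mult p q) then show ?case by (simp add: C_def emb_hom mult.assoc)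
  qed
  have "C \<phi>" for \<phi>
  proof (cases \<phi> rule: rfun_cases)
    case (1 a b)
    show ?thesis unfolding C_def
    proof
      fix \<psi>
      have "emb b * app X (\<phi> * \<psi>) = app X (emb b * (\<phi> * \<psi>))" using pol[of b] by (simp add: C_def)
      also have "emb b * (\<phi> * \<psi>) = emb a * \<psi>" using 1 by simp
      also have "app X (emb a * \<psi>) = emb a * app X \<psi>" using pol[of a] by (simp add: C_def)
      also have "emb a = emb b * \<phi>" using 1 by simp
      finally have "emb b * app X (\<phi> * \<psi>) = emb b * (\<phi> * app X \<psi>)" by (simp only: mult.assoc)
      then show "app X (\<phi> * \<psi>) = \<phi> * app X \<psi>" using 1(2) by (metis emb_eq_0_iff mult_left_cancel)
    qed
  qed
  then have "app X \<phi> = \<phi> * app X 1" for \<phi> by (metis C_def mult_1_right)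
  then show ?thesis by (intro rop_eqI) (metis app_mul mult.commute)
qed

subsection \<open>Euler degree\<close>

definition eu :: "'n::finite rop" where
  "eu = (\<Sum>i\<in>UNIV. mul (emb (pcrd i)) * part (axis i 1))"

lemma cm_eu_mul: "cm eu (mul f) = mul (app eu f)"
  by (rule rop_eqI) (simp add: cm_def eu_def app_sum sum_distrib_left sum_distrib_right sum.distrib algebra_simps)

lemma cm_eu_part: "cm eu (part v) = - part v"
proof -
  have *: "cm (mul (emb (pcrd i)) * part (axis i 1)) (part v) = - (mul (cst (v $ i)) * part (axis i 1))" for i
    by (rule rop_eqI) (simp add: cm_def pdf_commute)
  have "cm eu (part v) = - (\<Sum>i\<in>UNIV. mul (cst (v $ i)) * part (axis i 1))"
    by (simp add: eu_def cm_sum_left * sum_negf)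
  then show ?thesis by (simp flip: part_coords)
qed

lemma app_eu_lin: "app eu (emb (lin \<xi>)) = emb (lin \<xi>)"
  by (simp add: eu_def app_sum flip: emb_hom emb_sum)
    (rule pol_eqI, simp add: bil_axis_right, simp add: bil_def mult.commute)

lemma cm_eu_lapl: "cm eu lapl = - 2 * lapl"
  by (simp add: lapl_def cm_sum_right cm_mult_right cm_eu_part sum_distrib_left sum_negf mult_2)

definition deg :: "int \<Rightarrow> 'n::finite rop \<Rightarrow> bool" where
  "deg w X \<longleftrightarrow> cm eu X = of_int w * X"

lemma of_int_central: "X * (of_int m * Y) = of_int m * (X * Y)" for X :: "'n::finite rop"
  by (metis mult.assoc mult_of_int_commute)

lemma deg_mult: "deg v X \<Longrightarrow> deg w Y \<Longrightarrow> deg (v + w) (X * Y)"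
  by (simp add: deg_def cm_mult_right algebra_simps of_int_central)

lemma deg_diff: "deg w X \<Longrightarrow> deg w Y \<Longrightarrow> deg w (X - Y)"
  by (simp add: deg_def cm_diff_right algebra_simps)

lemma deg_mul: "app eu f = of_int w * f \<Longrightarrow> deg w (mul f)"
  unfolding deg_def cm_eu_mul by (rule rop_eqI) simp

lemma deg_lop: "app eu u = - 2 * u \<Longrightarrow> deg (- 2) (lop u)"
  using deg_mul[of u "- 2"] deg_diff[of "- 2" lapl "mul u"] by (simp add: lop_def) (simp add: deg_def cm_eu_lapl)

lemma deg_adj:
  "deg w X \<Longrightarrow> app eu u1 = - 2 * u1 \<Longrightarrow> app eu u2 = - 2 * u2 \<Longrightarrow> deg (w - 2) (adj u1 u2 X)"
  using deg_mult[of "-2" "lop u1" w X] deg_mult[of w X "-2" "lop u2"]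
  by (simp add: adj_def deg_diff deg_lop)

lemma deg_adj_pow:
  assumes "deg w X" "app eu u1 = - 2 * u1" "app eu u2 = - 2 * u2"
  shows "deg (w - 2 * int j) ((adj u1 u2 ^^ j) X)"
proof (induction j)
  case (Suc j)
  then show ?case using deg_adj[OF Suc assms(2,3)] by (simp add: algebra_simps)
qed (use assms in simp)

lemma deg_kk: "deg w X \<Longrightarrow> deg (w + 1) (kk \<xi> X)"
  using deg_mult[of w X 1 "mul (emb (lin \<xi>))"] deg_mult[of 1 "mul (emb (lin \<xi>))" w X]
    deg_mul[of "emb (lin \<xi>)" 1] by (simp add: kk_def cm_def[of X] deg_diff app_eu_lin add.commute)

lemma deg_kl: "deg w X \<Longrightarrow> deg (w + int (length xs)) (kl xs X)"
proof (induction xs arbitrary: X w)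
  case (Cons \<xi> xs)
  from Cons.IH[OF deg_kk[OF Cons.prems]] show ?case by (simp add: algebra_simps)
qed simp

text \<open>The Euler field kills constants, so the commutator of \<open>eu\<close> and
  \<open>X\<close>, applied to 1, is \<open>eu\<close> applied to the value of \<open>X\<close> at
  1.\<close>

lemma deg_coeff:
  fixes X :: "'n::finite rop"
  assumes "deg w X"
  shows "app eu (app X 1) = of_int w * app X 1"
proof -
  have "app eu 1 = (0 :: 'n rfun)" by (simp add: eu_def app_sum)
  then show ?thesis using arg_cong[OF assms[unfolded deg_def], of "\<lambda>X. app X 1"] by (simp add: cm_def)
qed

lemma euler_negative_emb:
  assumes "app eu (emb p) = of_int w * emb p" "w < 0"
  shows "p = 0"
proof (rule euler_negative_degree[of p "nat (- w)"])
  have "(of_int w :: 'a rfun) = - emb (of_nat (nat (- w)))"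
  proof -
    have "emb (of_nat m) = (of_nat m :: 'a rfun)" for m by (induction m) (auto simp: emb_hom)
    then have "emb (of_nat (nat (- w))) = (of_nat (nat (- w)) :: 'a rfun)" .
    also have "\<dots> = of_int (- w)" using assms(2) by simp
    finally show ?thesis by simp
  qed
  with assms(1) have "emb (\<Sum>i\<in>UNIV. pcrd i * pd (axis i 1) p) = emb (- (of_nat (nat (- w)) * p))"
    by (simp add: eu_def app_sum emb_sum emb_hom)
  then show "(\<Sum>i\<in>UNIV. pcrd i * pd (axis i 1) p) = - (of_nat (nat (- w)) * p)"
    by (simp only: emb_inj)
qed (use assms in simp)

subsection \<open>The local ring of a hyperplane\<close>

definition reg :: "complex^'n \<Rightarrow> 'n::finite rfun \<Rightarrow> bool" where
  "reg \<alpha> f \<longleftrightarrow> (\<exists>a b. f = emb a / emb b \<and> \<not> lin \<alpha> dvd b)"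

abbreviation tt :: "complex^'n \<Rightarrow> 'n::finite rfun" where "tt \<alpha> \<equiv> emb (lin \<alpha>)"

lemma pdf_tt: "pdf v (tt \<alpha>) = cst (bil \<alpha> v)"
  by simp

context
  fixes \<alpha> :: "complex^'n::finite"
  assumes ani: "bil \<alpha> \<alpha> \<noteq> 0"
begin

lemma tt_nonzero: "tt \<alpha> \<noteq> 0"
  using lin_nonzero[OF ani] by simp

lemma prime: "prime_elem (lin \<alpha>)"
  by (rule prime_lin[OF ani])

lemma reg_emb: "reg \<alpha> (emb p)"
  unfolding reg_def
  by (rule exI[of _ p], rule exI[of _ 1]) (use prime in \<open>auto simp: emb_hom prime_elem_def\<close>)

lemma reg_0: "reg \<alpha> 0" and reg_1: "reg \<alpha> 1"
  using reg_emb[of 0] reg_emb[of 1] by (simp_all add: emb_hom)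

lemma reg_add: "reg \<alpha> f \<Longrightarrow> reg \<alpha> g \<Longrightarrow> reg \<alpha> (f + g)"
proof -
  assume "reg \<alpha> f" "reg \<alpha> g"
  then obtain a b c d where *: "f = emb a / emb b" "g = emb c / emb d" "\<not> lin \<alpha> dvd b" "\<not> lin \<alpha> dvd d"
    by (auto simp: reg_def)
  then have "b \<noteq> 0" "d \<noteq> 0" by auto
  then have "f + g = emb (a * d + c * b) / emb (b * d)"
    unfolding * by (simp add: emb_hom add_frac_eq)
  moreover have "\<not> lin \<alpha> dvd b * d" using * prime by (simp add: prime_elem_dvd_mult_iff)
  ultimately show ?thesis by (auto simp: reg_def)
qed

lemma reg_mult: "reg \<alpha> f \<Longrightarrow> reg \<alpha> g \<Longrightarrow> reg \<alpha> (f * g)"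
proof -
  assume "reg \<alpha> f" "reg \<alpha> g"
  then obtain a b c d where *: "f = emb a / emb b" "g = emb c / emb d" "\<not> lin \<alpha> dvd b" "\<not> lin \<alpha> dvd d"
    by (auto simp: reg_def)
  then have "f * g = emb (a * c) / emb (b * d)" by (simp add: emb_hom)
  moreover have "\<not> lin \<alpha> dvd b * d" using * prime by (simp add: prime_elem_dvd_mult_iff)
  ultimately show ?thesis by (auto simp: reg_def)
qed

lemma reg_minus: "reg \<alpha> f \<Longrightarrow> reg \<alpha> (- f)"
  using reg_mult[OF reg_emb[of "- 1"]] by (simp add: emb_hom)

lemma reg_diff: "reg \<alpha> f \<Longrightarrow> reg \<alpha> g \<Longrightarrow> reg \<alpha> (f - g)"
  using reg_add[OF _ reg_minus] by force

lemma reg_sum: "(\<And>i. i \<in> I \<Longrightarrow> reg \<alpha> (f i)) \<Longrightarrow> reg \<alpha> (sum f I)"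
  by (induction I rule: infinite_finite_induct) (auto intro: reg_0 reg_add)

lemma reg_power: "reg \<alpha> f \<Longrightarrow> reg \<alpha> (f ^ m)"
  by (induction m) (auto intro: reg_1 reg_mult)

lemma reg_of_nat: "reg \<alpha> (of_nat m)"
  by (metis cst_of_nat reg_emb)

lemma reg_of_int: "reg \<alpha> (of_int m)"
  by (cases m rule: int_cases2) (auto intro: reg_of_nat reg_minus)

lemma reg_numeral: "reg \<alpha> (numeral m)"
  using reg_of_nat[of "numeral m"] by simp

lemma reg_divide: "reg \<alpha> f \<Longrightarrow> \<not> lin \<alpha> dvd b \<Longrightarrow> reg \<alpha> (f / emb b)"
proof -
  assume *: "reg \<alpha> f" "\<not> lin \<alpha> dvd b"
  have "reg \<alpha> (1 / emb b)" unfolding reg_def by (metis * (2) emb_hom(6))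
  from reg_mult[OF *(1) this] show ?thesis by simp
qed

lemma reg_pdf: "reg \<alpha> f \<Longrightarrow> reg \<alpha> (pdf v f)"
proof -
  assume "reg \<alpha> f"
  then obtain a b where *: "f = emb a / emb b" "\<not> lin \<alpha> dvd b" by (auto simp: reg_def)
  then have "b \<noteq> 0" by auto
  moreover have "\<not> lin \<alpha> dvd b * b" using * prime by (simp add: prime_elem_dvd_mult_iff)
  ultimately show ?thesis using * by (auto simp: reg_def pdf_quot)
qed

lemma lin_dvd_psub: "lin \<alpha> dvd psub \<alpha> b \<longleftrightarrow> lin \<alpha> dvd b"
  using lin_dvd_iff[OF ani] reflect_orth[of \<alpha>] by auto

lemma reg_subf: "reg \<alpha> f \<Longrightarrow> reg \<alpha> (subf \<alpha> f)"
  by (auto simp: reg_def subf_emb[OF ani]) (metis lin_dvd_psub)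

text \<open>An odd element vanishes on the hyperplane.\<close>
lemma reg_odd_div:
  assumes "reg \<alpha> f" "subf \<alpha> f = - f"
  shows "reg \<alpha> (f / tt \<alpha>)"
proof -
  obtain a b where *: "f = emb a / emb b" "\<not> lin \<alpha> dvd b" using assms(1) by (auto simp: reg_def)
  \<comment> \<open>Multiplying by the reflected denominator makes the denominator even, so the
    numerator inherits the oddness of \<open>f\<close>.\<close>
  define a' b' where "a' = a * psub \<alpha> b" and "b' = b * psub \<alpha> b"
  have b': "\<not> lin \<alpha> dvd b'" using *(2) prime by (simp add: b'_def prime_elem_dvd_mult_iff lin_dvd_psub)
  then have nz: "b' \<noteq> 0" by auto
  have f: "f = emb a' / emb b'" using nz unfolding *(1) a'_def b'_def by (simp add: emb_hom)
  have "subf \<alpha> f = emb (psub \<alpha> a') / emb b'"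
    by (simp add: f subf_emb[OF ani] b'_def psub_invol[OF ani] mult.commute)
  then have "emb (psub \<alpha> a') / emb b' = emb (- a') / emb b'"
    using assms(2) f by (metis emb_hom(4) minus_divide_left)
  then have "psub \<alpha> a' = - a'" using nz by (simp only: divide_cancel_right emb_eq_0_iff emb_inj simp_thms)
  then obtain c where "a' = lin \<alpha> * c" using lin_dvd_odd[OF ani] by (metis dvdE)
  then have "f / tt \<alpha> = emb c / emb b'" using tt_nonzero by (simp add: f emb_hom)
  then show ?thesis using b' by (auto simp: reg_def)
qed

text \<open>The reflection reverses the direction \<alpha>, so the transversal derivative of an even
  function is odd and hence divisible by (\<alpha>,x).\<close>

lemma even_pdf_root:
  assumes "reg \<alpha> f" "subf \<alpha> f = f"
  shows "reg \<alpha> (pdf \<alpha> f / tt \<alpha>)" "subf \<alpha> (pdf \<alpha> f) = - pdf \<alpha> f"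
proof -
  have "pdf \<alpha> (subf \<alpha> f) = subf \<alpha> (pdf (- \<alpha>) f)"
    by (simp add: pdf_subf[OF ani] reflect_self[OF ani])
  also have "pdf (- \<alpha>) f = - pdf \<alpha> f"
    using pdf_add_dir[of \<alpha> "- \<alpha>" f] pdf_scale_dir[of 0 0 f] by (simp add: pcst_hom emb_hom add_eq_0_iff)
  finally have "- subf \<alpha> (pdf \<alpha> f) = pdf \<alpha> f" by (simp only: assms(2) subf_minus)
  from this[THEN minus_equation_iff[THEN iffD1]] show "subf \<alpha> (pdf \<alpha> f) = - pdf \<alpha> f" by (rule sym)
  then show "reg \<alpha> (pdf \<alpha> f / tt \<alpha>)" by (intro reg_odd_div reg_pdf assms)
qed

lemma subf_pdf_orth: "bil \<alpha> \<eta> = 0 \<Longrightarrow> subf \<alpha> f = f \<Longrightarrow> subf \<alpha> (pdf \<eta> f) = pdf \<eta> f"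
  using pdf_subf[OF ani, of \<eta> f] by (simp add: reflect_orth)

text \<open>A sequence of functions with bounded poles, each arising from its predecessor by
  differentiation across the hyperplane up to regular terms, has no poles: otherwise each step
  increases the order of the pole.\<close>
lemma bounded_poles_regular:
  fixes g :: "nat \<Rightarrow> 'n rfun"
  assumes step: "\<And>l. \<exists>c h. c > 0 \<and> reg \<alpha> h \<and> g (Suc l) = of_nat c * pdf \<alpha> (g l) + h"
    and bound: "\<And>l. reg \<alpha> (tt \<alpha> ^ B * g l)"
  shows "reg \<alpha> (g 0)"
proof (rule ccontr)
  assume nreg: "\<not> reg \<alpha> (g 0)"
  define s where "s = (LEAST s. reg \<alpha> (tt \<alpha> ^ s * g 0))"
  have s: "reg \<alpha> (tt \<alpha> ^ s * g 0)" unfolding s_def by (rule LeastI) (rule bound)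
  have "s \<noteq> 0" using s nreg by (metis mult_1 power_0)
  then obtain s' where s': "s = Suc s'" by (cases s) auto
  then have ns: "\<not> reg \<alpha> (tt \<alpha> ^ s' * g 0)" unfolding s_def by (metis lessI not_less_Least)
  \<comment> \<open>The pole of \<open>g l\<close> has order exactly s + l, where s = s' + 1 is the
    order of the pole of \<open>g 0\<close>.\<close>
  have "reg \<alpha> (tt \<alpha> ^ Suc (s' + l) * g l) \<and> \<not> reg \<alpha> (tt \<alpha> ^ (s' + l) * g l)" for l
  proof (induction l)
    case 0
    then show ?case using s ns s' by simp
  next
    case (Suc l)
    define m where "m = s' + l"
    obtain c h where c: "c > 0" "reg \<alpha> h" "g (Suc l) = of_nat c * pdf \<alpha> (g l) + h" using step by blast
    define w where "w = tt \<alpha> ^ Suc m * g l"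
    have w: "reg \<alpha> w" "\<not> reg \<alpha> (w / tt \<alpha>)" using Suc tt_nonzero by (simp_all add: w_def m_def)
    have D: "pdf \<alpha> w = of_nat (Suc m) * tt \<alpha> ^ m * cst (bil \<alpha> \<alpha>) * g l + tt \<alpha> ^ Suc m * pdf \<alpha> (g l)"
      unfolding w_def pdf_mult pdf_power pdf_tt by simp
    \<comment> \<open>This isolates the leading Laurent coefficient: modulo (\<alpha>,x) it is
      multiplied by -c(m + 1)(\<alpha>,\<alpha>), which is nonzero because \<alpha> is not
      isotropic.\<close>
    have e: "tt \<alpha> ^ Suc (Suc m) * g (Suc l) = tt \<alpha> * (of_nat c * pdf \<alpha> w + tt \<alpha> ^ Suc m * h)
        - cst (of_nat (c * Suc m) * bil \<alpha> \<alpha>) * w"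
      unfolding c(3) D by (simp add: w_def algebra_simps pcst_hom emb_hom cst_of_nat)
    have r: "reg \<alpha> (of_nat c * pdf \<alpha> w + tt \<alpha> ^ Suc m * h)"
      by (intro reg_add reg_mult reg_of_nat reg_pdf reg_power reg_emb w c)
    have 1: "reg \<alpha> (tt \<alpha> ^ Suc (Suc m) * g (Suc l))"
      unfolding e by (intro reg_diff reg_mult reg_emb r w)
    have 2: "\<not> reg \<alpha> (tt \<alpha> ^ Suc m * g (Suc l))"
    proof
      assume *: "reg \<alpha> (tt \<alpha> ^ Suc m * g (Suc l))"
      define z where "z = of_nat (c * Suc m) * bil \<alpha> \<alpha>"
      have z: "z \<noteq> 0" using c(1) ani by (simp add: z_def del: of_nat_mult of_nat_Suc mult_Suc_right)
      have "tt \<alpha> * (tt \<alpha> ^ Suc m * g (Suc l)) = tt \<alpha> * (of_nat c * pdf \<alpha> w + tt \<alpha> ^ Suc m * h) - cst z * w"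
        using e by (simp add: z_def mult.assoc)
      then have "cst z * (w / tt \<alpha>) = (of_nat c * pdf \<alpha> w + tt \<alpha> ^ Suc m * h) - tt \<alpha> ^ Suc m * g (Suc l)"
        using tt_nonzero by (simp add: field_simps)
      then have "reg \<alpha> (cst z * (w / tt \<alpha>))" using reg_diff[OF r *] by simp
      then have "reg \<alpha> (cst (inverse z) * (cst z * (w / tt \<alpha>)))" by (rule reg_mult[OF reg_emb])
      then have "reg \<alpha> (cst (inverse z) * cst z * (w / tt \<alpha>))" by (simp only: mult.assoc)
      moreover have "cst (inverse z) * cst z = (1 :: 'n rfun)" using z by (metis emb_hom(3,6) left_inverse pcst_hom(2,4))
      ultimately show False using w(2) by (simp only: mult_1_left)
    qed
    show ?case using 1 2 by (simp add: m_def)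
  qed
  then have "\<not> reg \<alpha> (tt \<alpha> ^ (s' + B) * g B)" by blast
  moreover have "reg \<alpha> (tt \<alpha> ^ s' * (tt \<alpha> ^ B * g B))" by (intro reg_mult reg_power reg_emb bound)
  ultimately show False by (simp add: power_add mult.assoc)
qed

subsection \<open>Coefficients of iterated commutators\<close>

text \<open>Here \<open>d + i\<close> bounds the order of \<open>Y i\<close>, so words of that
  length extract leading coefficients. The induction is on the number \<open>b\<close> of directions
  along the hyperplane; for fixed \<open>b\<close> the bound \<open>B\<close> must serve all
  \<open>i\<close> and \<open>a\<close>, since \<open>bounded_poles_regular\<close> lets both grow
  together.\<close>

lemma coeffs_regular_orth:
  fixes Y :: "nat \<Rightarrow> 'n rop"
  assumes Y: "\<And>i. Y (Suc i) = adj u1 u2 (Y i)"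
    and van: "\<And>i. van (Suc (d + i)) (Y i)"
    and bound: "\<And>b. \<exists>B. \<forall>i a \<eta>s. length \<eta>s = b \<longrightarrow> a + b = d + i \<longrightarrow> (\<forall>\<eta>\<in>set \<eta>s. bil \<alpha> \<eta> = 0) \<longrightarrow>
        reg \<alpha> (tt \<alpha> ^ B * app (kl \<eta>s ((kk \<alpha> ^^ a) (Y i))) 1)"
  shows "length \<eta>s = b \<Longrightarrow> a + b = d + i \<Longrightarrow> (\<forall>\<eta>\<in>set \<eta>s. bil \<alpha> \<eta> = 0) \<Longrightarrow>
        reg \<alpha> (app (kl \<eta>s ((kk \<alpha> ^^ a) (Y i))) 1)"
proof (induction b arbitrary: \<eta>s a i)
  have main: "reg \<alpha> (app (kl \<eta>s ((kk \<alpha> ^^ a) (Y i))) 1)"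
    if len: "length \<eta>s = b" "a + b = d + i" "\<forall>\<eta>\<in>set \<eta>s. bil \<alpha> \<eta> = 0"
      and IH: "\<And>m a i. m < b \<Longrightarrow> Suc a + b = Suc (Suc (d + i)) \<Longrightarrow>
        reg \<alpha> (app (kl (take m \<eta>s @ drop (Suc m) \<eta>s) ((kk \<alpha> ^^ a) (Y i))) 1)" for \<eta>s a i b
  proof -
    define g where "g l = app (kl \<eta>s ((kk \<alpha> ^^ (a + l)) (Y (i + l)))) 1" for l
    obtain B where B: "\<forall>i a \<eta>s. length \<eta>s = b \<longrightarrow> a + b = d + i \<longrightarrow> (\<forall>\<eta>\<in>set \<eta>s. bil \<alpha> \<eta> = 0) \<longrightarrow>
        reg \<alpha> (tt \<alpha> ^ B * app (kl \<eta>s ((kk \<alpha> ^^ a) (Y i))) 1)" using bound by blast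
    have "reg \<alpha> (g 0)"
    proof (rule bounded_poles_regular[of g B])
      show "reg \<alpha> (tt \<alpha> ^ B * g l)" for l using B len by (simp add: g_def)
      fix l
      define X where "X = Y (i + l)"
      define Z where "Z = (kk \<alpha> ^^ Suc (a + l)) X"
      define h where "h = (\<Sum>m<b. 2 * pdf (\<eta>s ! m) (app (kl (take m \<eta>s @ drop (Suc m) \<eta>s) Z) 1))"
      \<comment> \<open>One commutator more than the order of \<open>X\<close> allows, so the term
        in which the Laplacian is never hit disappears and only derivatives of coefficients
        remain.\<close>
      have "kl \<eta>s Z = kl (replicate (Suc (a + l)) \<alpha> @ \<eta>s) X"
        unfolding Z_def kk_funpow_kl kl_append ..
      also have "length (replicate (Suc (a + l)) \<alpha> @ \<eta>s) = Suc (d + (i + l))" using len by simp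
      then have "kl (replicate (Suc (a + l)) \<alpha> @ \<eta>s) X = 0"
        using van[of "i + l"] unfolding van_def X_def by blast
      finally have 0: "kl \<eta>s Z = 0" .
      have "kl \<eta>s ((kk \<alpha> ^^ Suc (a + l)) (adj u1 u2 X)) =
          kl \<eta>s (adj u1 u2 Z) + of_nat (2 * Suc (a + l)) * cm (part \<alpha>) (kl \<eta>s ((kk \<alpha> ^^ (a + l)) X))"
        unfolding kk_pow_adj Z_def kl_add kl_of_nat kl_cm_part by simp
      also have "kl \<eta>s (adj u1 u2 Z) =
          2 * (\<Sum>m<b. cm (part (\<eta>s ! m)) (kl (take m \<eta>s @ drop (Suc m) \<eta>s) Z))"
        unfolding kl_adj 0 len(1) by simp
      finally have "g (Suc l) = of_nat (2 * Suc (a + l)) * pdf \<alpha> (g l) + h"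
        by (simp add: g_def Y X_def h_def app_sum sum_distrib_left cm_def distrib_right del: funpow.simps)
      moreover have "reg \<alpha> h" unfolding h_def
      proof (intro reg_sum reg_mult reg_numeral reg_pdf)
        fix m assume "m \<in> {..<b}"
        then show "reg \<alpha> (app (kl (take m \<eta>s @ drop (Suc m) \<eta>s) Z) 1)"
          \<comment> \<open>Removing one direction along the hyperplane decreases \<open>b\<close>
            by one, and the additional commutator with (\<alpha>,x) keeps the length equal to the
            order.\<close>
          using IH[of m "Suc (a + l)" "i + l"] len unfolding Z_def X_def by (simp del: funpow.simps)
      qed
      moreover have "0 < 2 * Suc (a + l)" by simp
      ultimately show "\<exists>c h. c > 0 \<and> reg \<alpha> h \<and> g (Suc l) = of_nat c * pdf \<alpha> (g l) + h"
        by blast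
    qed
    then show ?thesis unfolding g_def by (simp only: add_0_right)
  qed
  {
    case 0
    show ?case by (rule main[OF 0]) simp
  next
    case (Suc b)
    show ?case
    proof (rule main[OF Suc.prems])
      fix m a' i' assume m: "m < Suc b" "Suc a' + Suc b = Suc (Suc (d + i'))"
      have "set (take m \<eta>s @ drop (Suc m) \<eta>s) \<subseteq> set \<eta>s" by (auto dest: in_set_takeD in_set_dropD)
      then show "reg \<alpha> (app (kl (take m \<eta>s @ drop (Suc m) \<eta>s) ((kk \<alpha> ^^ a') (Y i'))) 1)"
        using m Suc.prems by (intro Suc.IH) auto
    qed
  }
qed

text \<open>Each direction is split into a multiple of \<alpha> and a vector along the hyperplane.
  Coefficients are multilinear and symmetric in the directions, so the previous lemma covers all of
  them.\<close>

lemma coeffs_regular: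
  fixes Y :: "nat \<Rightarrow> 'n rop"
  assumes "\<And>i. Y (Suc i) = adj u1 u2 (Y i)" "\<And>i. van (Suc (d + i)) (Y i)"
    and "\<And>b. \<exists>B. \<forall>i a \<eta>s. length \<eta>s = b \<longrightarrow> a + b = d + i \<longrightarrow> (\<forall>\<eta>\<in>set \<eta>s. bil \<alpha> \<eta> = 0) \<longrightarrow>
        reg \<alpha> (tt \<alpha> ^ B * app (kl \<eta>s ((kk \<alpha> ^^ a) (Y i))) 1)"
    and "length xs = d"
  shows "reg \<alpha> (app (kl xs (Y 0)) 1)"
proof -
  note orth = coeffs_regular_orth[OF assms(1,2,3)]
  have "length \<eta>s + a + length xs = d \<Longrightarrow> (\<forall>\<eta>\<in>set \<eta>s. bil \<alpha> \<eta> = 0) \<Longrightarrow>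
      reg \<alpha> (app (kl xs (kl \<eta>s ((kk \<alpha> ^^ a) (Y 0)))) 1)" for \<eta>s a xs
  proof (induction xs arbitrary: \<eta>s a)
    case Nil
    then show ?case using orth[of \<eta>s "length \<eta>s" a 0] by simp
  next
    case (Cons x xs)
    define c where "c = bil \<alpha> x / bil \<alpha> \<alpha>"
    define \<eta> where "\<eta> = x - c *s \<alpha>"
    have x: "x = c *s \<alpha> + \<eta>" and o: "bil \<alpha> \<eta> = 0" using ani by (simp_all add: \<eta>_def c_def bil_simps)
    have 1: "kk \<alpha> (kl \<eta>s ((kk \<alpha> ^^ a) (Y 0))) = kl \<eta>s ((kk \<alpha> ^^ Suc a) (Y 0))" by (simp add: kl_kk)
    have 2: "kk \<eta> (kl \<eta>s ((kk \<alpha> ^^ a) (Y 0))) = kl (\<eta>s @ [\<eta>]) ((kk \<alpha> ^^ a) (Y 0))" by (simp add: kl_append)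
    show ?case unfolding x kl.simps kk_dir_add kk_dir_scale 1 2 kl_add kl_mul_cst app_ops app_mul
      using Cons.prems o by (intro reg_add reg_mult reg_emb Cons.IH) auto
  qed
  from this[of "[]" 0 xs] show ?thesis using assms(4) by simp
qed

end

subsection \<open>Even singularities\<close>

text \<open>The valuation of \<open>f\<close> along the hyperplane is at least \<open>a\<close>;
  negative \<open>a\<close> allows a pole.\<close>

definition vge :: "complex^'n \<Rightarrow> int \<Rightarrow> 'n::finite rfun \<Rightarrow> bool" where
  "vge \<alpha> a f \<longleftrightarrow> reg \<alpha> (tt \<alpha> powi (- a) * f)"

text \<open>The operators generated by even regular functions, derivatives along the hyperplane, the
  Euler field across it and the Schroedinger operator itself, filtered by order.\<close>
inductive evalg :: "complex^'n \<Rightarrow> 'n::finite rfun \<Rightarrow> nat \<Rightarrow> 'n rop \<Rightarrow> bool" for \<alpha> u where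
  fn: "reg \<alpha> f \<Longrightarrow> subf \<alpha> f = f \<Longrightarrow> evalg \<alpha> u 0 (mul f)"
| tang: "bil \<alpha> \<eta> = 0 \<Longrightarrow> evalg \<alpha> u 1 (part \<eta>)"
| theta: "evalg \<alpha> u 1 (mul (tt \<alpha>) * part \<alpha>)"
| lop: "evalg \<alpha> u 2 (lop u)"
| add: "evalg \<alpha> u m X \<Longrightarrow> evalg \<alpha> u m Y \<Longrightarrow> evalg \<alpha> u m (X + Y)"
| mult: "evalg \<alpha> u m X \<Longrightarrow> evalg \<alpha> u n Y \<Longrightarrow> evalg \<alpha> u (m + n) (X * Y)"
| mono: "evalg \<alpha> u m X \<Longrightarrow> evalg \<alpha> u (Suc m) X"

lemma mul_1 [simp]: "mul 1 = 1" by (rule mul_hom)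

context
  fixes \<alpha> :: "complex^'n::finite"
  assumes ani: "bil \<alpha> \<alpha> \<noteq> 0"
begin

lemmas regs = reg_emb[OF ani] reg_0[OF ani] reg_1[OF ani] reg_add[OF ani] reg_mult[OF ani]
  reg_minus[OF ani] reg_diff[OF ani] reg_sum[OF ani] reg_power[OF ani] reg_of_nat[OF ani]
  reg_of_int[OF ani] reg_numeral[OF ani] reg_pdf[OF ani]

lemma evalg_0: "evalg \<alpha> u m 0"
proof (induction m)
  case 0
  show ?case using evalg.fn[OF regs(2) subf_0, of u] by (simp add: mul_hom)
qed (rule evalg.mono)

lemma tnz: "tt \<alpha> \<noteq> 0"
  by (rule tt_nonzero[OF ani])

lemma vge_mono:
  assumes "vge \<alpha> a f" "b \<le> a"
  shows "vge \<alpha> b f"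
proof -
  obtain m where m: "a = b + int m" using assms(2) zle_iff_zadd by blast
  have "tt \<alpha> powi (int m + - a) = tt \<alpha> powi int m * tt \<alpha> powi (- a)"
    by (rule power_int_add) (use tnz in simp)
  moreover have "int m + - a = - b" using m by simp
  ultimately have e: "tt \<alpha> powi (- b) * f = tt \<alpha> ^ m * (tt \<alpha> powi (- a) * f)"
    by (simp only: power_int_of_nat mult.assoc)
  show ?thesis unfolding vge_def e
    by (rule reg_mult[OF ani reg_power[OF ani reg_emb[OF ani]] assms(1)[unfolded vge_def]])
qed

lemma vge_add: "vge \<alpha> a f \<Longrightarrow> vge \<alpha> a g \<Longrightarrow> vge \<alpha> a (f + g)"
  and vge_diff: "vge \<alpha> a f \<Longrightarrow> vge \<alpha> a g \<Longrightarrow> vge \<alpha> a (f - g)"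
  by (simp_all add: vge_def distrib_left right_diff_distrib regs)

lemma vge_sum: "(\<And>i. i \<in> I \<Longrightarrow> vge \<alpha> a (f i)) \<Longrightarrow> vge \<alpha> a (sum f I)"
  by (simp add: vge_def sum_distrib_left regs)

lemma vge_mult:
  assumes "vge \<alpha> a f" "vge \<alpha> b g"
  shows "vge \<alpha> (a + b) (f * g)"
proof -
  have "tt \<alpha> powi (- a + - b) = tt \<alpha> powi (- a) * tt \<alpha> powi (- b)"
    by (rule power_int_add) (use tnz in simp)
  then have e: "tt \<alpha> powi (- (a + b)) * (f * g) = (tt \<alpha> powi (- a) * f) * (tt \<alpha> powi (- b) * g)"
    by (simp only: minus_add_distrib mult.assoc mult.left_commute)
  show ?thesis unfolding vge_def e
    by (rule reg_mult[OF ani assms(1)[unfolded vge_def] assms(2)[unfolded vge_def]])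
qed

lemma vge_0_iff: "vge \<alpha> 0 f \<longleftrightarrow> reg \<alpha> f"
  by (simp add: vge_def)

lemma vge_powi: "vge \<alpha> a (tt \<alpha> powi a)"
  using tnz by (simp add: vge_def power_int_minus regs)

lemma vge_pdf:
  assumes "vge \<alpha> a f"
  shows "vge \<alpha> (a - 1) (pdf v f)"
proof -
  define g where "g = tt \<alpha> powi (- a) * f"
  have g: "reg \<alpha> g" using assms by (simp add: g_def vge_def)
  have f: "f = tt \<alpha> powi a * g" using tnz by (simp add: g_def power_int_minus)
  have "pdf v f = of_int a * cst (bil \<alpha> v) * (tt \<alpha> powi (a - 1) * g) + tt \<alpha> powi a * pdf v g"
    by (simp add: f pdf_powi[OF tnz])
  moreover have "vge \<alpha> (0 + 0 + (a - 1 + 0)) (of_int a * cst (bil \<alpha> v) * (tt \<alpha> powi (a - 1) * g))"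
    by (intro vge_mult vge_powi) (simp_all add: vge_0_iff regs g)
  moreover have "vge \<alpha> (a + 0) (tt \<alpha> powi a * pdf v g)"
    by (intro vge_mult vge_powi) (simp_all add: vge_0_iff regs g)
  ultimately show ?thesis by (auto intro!: vge_add elim: vge_mono)
qed

definition \<eta> :: "'n \<Rightarrow> complex^'n" where
  "\<eta> i = axis i 1 - (\<alpha> $ i / bil \<alpha> \<alpha>) *s \<alpha>"

lemma bil_eta: "bil \<alpha> (\<eta> i) = 0"
  using ani by (simp add: \<eta>_def bil_simps bil_axis_right)

lemma part_eta: "part (\<eta> i) = part (axis i 1) - mul (cst (\<alpha> $ i / bil \<alpha> \<alpha>)) * part \<alpha>"
  using part_add[of "\<eta> i" "(\<alpha> $ i / bil \<alpha> \<alpha>) *s \<alpha>"] by (simp add: \<eta>_def part_scale)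

text \<open>Parseval's identity for the projected basis vectors \<open>\<eta> i\<close>: they are
  linearly dependent, but they replace an orthonormal basis of the hyperplane and no such basis has
  to be chosen. \<open>P\<close> and \<open>Q\<close> need not commute; only the scalars move
  freely.\<close>

lemma orth_decomposition:
  fixes P Q :: "'n \<Rightarrow> 'n rop"
  defines "A \<equiv> \<Sum>i\<in>UNIV. mul (cst (\<alpha> $ i)) * P i" and "B \<equiv> \<Sum>i\<in>UNIV. mul (cst (\<alpha> $ i)) * Q i"
    and "c \<equiv> \<lambda>i. \<alpha> $ i / bil \<alpha> \<alpha>"
  shows "(\<Sum>i\<in>UNIV. P i * Q i) = mul (cst (1 / bil \<alpha> \<alpha>)) * (A * B) +
      (\<Sum>i\<in>UNIV. (P i - mul (cst (c i)) * A) * (Q i - mul (cst (c i)) * B))"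
proof -
  have sc: "(\<Sum>i\<in>UNIV. mul (cst (c i)) * R i) = mul (cst (1 / bil \<alpha> \<alpha>)) * (\<Sum>i\<in>UNIV. mul (cst (\<alpha> $ i)) * R i)"
    for R :: "'n \<Rightarrow> 'n rop"
    unfolding sum_distrib_left by (rule sum.cong) (simp_all add: c_def flip: mult.assoc mul_hom emb_hom pcst_hom)
  have cc: "(\<Sum>i\<in>UNIV. mul (cst (c i * c i))) = (mul (cst (1 / bil \<alpha> \<alpha>)) :: 'n rop)"
  proof -
    have "(\<Sum>i\<in>UNIV. c i * c i) = (\<Sum>i\<in>UNIV. \<alpha> $ i * \<alpha> $ i) / (bil \<alpha> \<alpha> * bil \<alpha> \<alpha>)"
      by (simp add: c_def sum_divide_distrib)
    also have "\<dots> = 1 / bil \<alpha> \<alpha>" using ani by (simp add: bil_def)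
    finally have *: "(\<Sum>i\<in>UNIV. c i * c i) = 1 / bil \<alpha> \<alpha>" .
    have "(\<Sum>i\<in>I. mul (cst (f i))) = mul (cst (\<Sum>i\<in>I. f i) :: 'n rfun)" for f and I :: "'n set"
      by (induction I rule: infinite_finite_induct) (auto simp: mul_hom emb_hom pcst_hom)
    from this[of "\<lambda>i. c i * c i" UNIV] show ?thesis by (simp only: *)
  qed
  have "(P i - mul (cst (c i)) * A) * (Q i - mul (cst (c i)) * B) =
      P i * Q i - (mul (cst (c i)) * P i) * B - A * (mul (cst (c i)) * Q i)
        + mul (cst (c i * c i)) * (A * B)" for i
  proof -
    define k :: "'n rop" where "k = mul (cst (c i))"
    have k: "X * (k * Y) = k * (X * Y)" for X Y unfolding k_def by (rule mul_cst_central2)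
    have kk: "mul (cst (c i * c i)) = k * k" by (simp add: k_def pcst_hom emb_hom mul_hom)
    have "(P i - k * A) * (Q i - k * B) = P i * Q i - P i * (k * B) - (k * A) * Q i + (k * A) * (k * B)"
      by (simp add: algebra_simps)
    also have "\<dots> = P i * Q i - (k * P i) * B - A * (k * Q i) + (k * k) * (A * B)"
      by (simp only: k[of "P i" B] k[of A "Q i"] mult.assoc k[of A B])
    finally show ?thesis unfolding kk k_def[symmetric] .
  qed
  then have "(\<Sum>i\<in>UNIV. (P i - mul (cst (c i)) * A) * (Q i - mul (cst (c i)) * B)) =
      (\<Sum>i\<in>UNIV. P i * Q i) - (\<Sum>i\<in>UNIV. mul (cst (c i)) * P i) * B
        - A * (\<Sum>i\<in>UNIV. mul (cst (c i)) * Q i) + (\<Sum>i\<in>UNIV. mul (cst (c i * c i))) * (A * B)"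
    by (simp add: sum.distrib sum_subtractf sum_distrib_left sum_distrib_right)
  also have "\<dots> = (\<Sum>i\<in>UNIV. P i * Q i) - mul (cst (1 / bil \<alpha> \<alpha>)) * (A * B)"
    unfolding sc cc A_def[symmetric] B_def[symmetric] by (simp only: mul_cst_central2[of A] mult.assoc) simp
  finally show ?thesis by simp
qed

lemma lapl_decomposition:
  "lapl = mul (cst (1 / bil \<alpha> \<alpha>)) * (part \<alpha> * part \<alpha>) + (\<Sum>i\<in>UNIV. part (\<eta> i) * part (\<eta> i))"
  unfolding lapl_def part_eta
  using orth_decomposition[of "\<lambda>i. part (axis i 1)" "\<lambda>i. part (axis i 1)"]
  by (simp flip: part_coords)

lemma gradient_decomposition:
  "(\<Sum>i\<in>UNIV. mul (pdf (axis i 1) f) * part (axis i 1)) =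
    mul (cst (1 / bil \<alpha> \<alpha>)) * (mul (pdf \<alpha> f) * part \<alpha>) + (\<Sum>i\<in>UNIV. mul (pdf (\<eta> i) f) * part (\<eta> i))"
proof -
  have "pdf \<alpha> f = (\<Sum>i\<in>UNIV. cst (\<alpha> $ i) * pdf (axis i 1) f)"
    using arg_cong[OF part_coords[of \<alpha>], of "\<lambda>X. app X f"] by (simp add: app_sum)
  then have "(\<Sum>i\<in>UNIV. mul (cst (\<alpha> $ i)) * mul (pdf (axis i 1) f)) = mul (pdf \<alpha> f)"
    by (intro rop_eqI) (simp add: app_sum sum_distrib_right mult.assoc)
  moreover have "mul (pdf (\<eta> i) f) = mul (pdf (axis i 1) f) - mul (cst (\<alpha> $ i / bil \<alpha> \<alpha>)) * mul (pdf \<alpha> f)" for i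
    using arg_cong[OF part_eta[of i], of "\<lambda>X. app X f"] by (simp flip: mul_hom)
  ultimately show ?thesis unfolding part_eta
    using orth_decomposition[of "\<lambda>i. mul (pdf (axis i 1) f)" "\<lambda>i. part (axis i 1)"]
    by (simp flip: part_coords)
qed

lemma reg_lapl: "reg \<alpha> f \<Longrightarrow> reg \<alpha> (app lapl f)"
  by (simp add: lapl_def app_sum regs)

lemma subf_lapl:
  assumes "subf \<alpha> f = f"
  shows "subf \<alpha> (app lapl f) = app lapl f"
proof -
  have m: "pdf (- \<alpha>) g = - pdf \<alpha> g" for g :: "'n rfun"
    using arg_cong[OF part_minus[of \<alpha>], of "\<lambda>X. app X g"] by simp
  have r: "reflect \<alpha> (- \<alpha>) = \<alpha>" by (simp add: reflect_minus reflect_self[OF ani])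
  have o: "subf \<alpha> (pdf \<alpha> f) = - pdf \<alpha> f"
    using pdf_subf[OF ani, of "- \<alpha>" f] by (simp only: m r assms)
  have "subf \<alpha> (pdf \<alpha> (pdf \<alpha> f)) = pdf \<alpha> (pdf \<alpha> f)"
    using pdf_subf[OF ani, of "- \<alpha>" "pdf \<alpha> f"] by (simp only: m r o pdf_minus minus_minus)
  then show ?thesis using assms
    by (simp add: lapl_decomposition app_sum subf_sum subf_pdf_orth[OF ani] bil_eta)
qed

lemma evalg_scale: "evalg \<alpha> u m X \<Longrightarrow> evalg \<alpha> u m (mul (cst c) * X)"
  using evalg.mult[OF evalg.fn[of \<alpha> "cst c" u]] by (simp add: regs)

lemma evalg_numeral: "evalg \<alpha> u m X \<Longrightarrow> evalg \<alpha> u m (2 * X)"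
  by (simp add: mult_2 evalg.add)

lemma evalg_minus: "evalg \<alpha> u m X \<Longrightarrow> evalg \<alpha> u m (- X)"
  using evalg_scale[of u m X "- 1"] by (simp add: pcst_hom emb_hom mul_hom)

lemma evalg_diff: "evalg \<alpha> u m X \<Longrightarrow> evalg \<alpha> u m Y \<Longrightarrow> evalg \<alpha> u m (X - Y)"
  using evalg.add[OF _ evalg_minus] by force

lemma evalg_sum: "(\<And>i. i \<in> I \<Longrightarrow> evalg \<alpha> u m (X i)) \<Longrightarrow> evalg \<alpha> u m (sum X I)"
  by (induction I rule: infinite_finite_induct) (auto intro: evalg_0 evalg.add)

text \<open>The transversal part of the commutator contains the derivative of \<open>f\<close> along
  \<alpha> times \<open>part \<alpha>\<close>. By evenness that derivative is divisible by
  (\<alpha>,x), which turns \<open>part \<alpha>\<close> into the Euler field of rule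
  \<open>theta\<close>.\<close>

lemma cm_fn:
  assumes "reg \<alpha> f" "subf \<alpha> f = f"
  shows "evalg \<alpha> u 1 (cm (lop u) (mul f))"
proof -
  have e: "mul (pdf \<alpha> f) * part \<alpha> = mul (pdf \<alpha> f / tt \<alpha>) * (mul (tt \<alpha>) * part \<alpha>)"
    using tnz by (simp flip: mult.assoc mul_hom)
  have "evalg \<alpha> u (0 + 1) (mul (pdf \<alpha> f / tt \<alpha>) * (mul (tt \<alpha>) * part \<alpha>))"
    by (intro evalg.mult evalg.fn evalg.theta even_pdf_root[OF ani] assms)
      (simp add: even_pdf_root[OF ani] assms subf_lin_self[OF ani])
  moreover have "evalg \<alpha> u (0 + 1) (mul (pdf (\<eta> i) f) * part (\<eta> i))" for i
    by (intro evalg.mult evalg.fn evalg.tang bil_eta regs assms subf_pdf_orth[OF ani])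
  moreover have "evalg \<alpha> u (Suc 0) (mul (app lapl f))"
    by (intro evalg.mono evalg.fn reg_lapl subf_lapl assms)
  ultimately show ?thesis unfolding cm_lop_mul gradient_decomposition e
    by (intro evalg.add evalg_numeral evalg_sum evalg_scale) simp_all
qed

context
  fixes u v :: "'n rfun" and c :: complex
  assumes u: "u = cst c / tt \<alpha> ^ 2 + v" and v: "reg \<alpha> v" "subf \<alpha> v = v"
begin

lemma pdf_u: "pdf w u = pdf w v - 2 * cst (c * bil \<alpha> w) / tt \<alpha> ^ 3"
proof -
  have "pdf w u = pdf w (cst c * inverse (tt \<alpha> ^ 2) + v)" unfolding u divide_inverse ..
  also have "\<dots> = cst c * (- (2 * tt \<alpha> * cst (bil \<alpha> w)) * inverse (tt \<alpha> ^ 2) ^ 2) + pdf w v"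
    using tnz by (simp add: pdf_inverse pdf_power)
  also have "\<dots> = pdf w v - 2 * cst (c * bil \<alpha> w) / tt \<alpha> ^ 3"
    using tnz by (simp add: field_simps pcst_hom emb_hom power2_eq_square power3_eq_cube)
  finally show ?thesis .
qed

text \<open>The commutator is 2 \<open>part \<alpha> * part \<alpha>\<close> plus (\<alpha>,x) times
  the transversal derivative of \<open>u\<close>. The second derivative is expressed by
  \<open>lop u\<close>, \<open>u\<close> and tangential derivatives. Then the inverse squares
  cancel, because c/(\<alpha>,x)^2 is homogeneous of degree -2, and an even regular function
  remains.\<close>

lemma cm_theta: "evalg \<alpha> u 2 (cm (lop u) (mul (tt \<alpha>) * part \<alpha>))"
proof -
  define Z where "Z = (\<Sum>i\<in>UNIV. part (\<eta> i) * part (\<eta> i))"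
  define f where "f = cst (2 * bil \<alpha> \<alpha>) * v + tt \<alpha> * pdf \<alpha> v"
  have one: "mul (cst (bil \<alpha> \<alpha>)) * (mul (cst (1 / bil \<alpha> \<alpha>)) * X) = X" for X :: "'n rop"
    using ani by (simp flip: mult.assoc mul_hom emb_hom pcst_hom) (simp add: pcst_hom emb_hom)
  have pp: "part \<alpha> * part \<alpha> = mul (cst (bil \<alpha> \<alpha>)) * (lop u + mul u - Z)"
    by (simp add: lop_def lapl_decomposition Z_def one)
  have gen: "2 * (b * (L + M - Z)) + w = 2 * (b * (L - Z)) + (2 * (b * M) + w)" for b L M w :: "'n rop"
    by (simp add: distrib_left right_diff_distrib)
  have "cm (lop u) (mul (tt \<alpha>)) = 2 * part \<alpha>" using kk_lop[of \<alpha> u] by (simp add: kk_def)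
  then have "cm (lop u) (mul (tt \<alpha>) * part \<alpha>) = 2 * (part \<alpha> * part \<alpha>) + mul (tt \<alpha>) * mul (pdf \<alpha> u)"
    by (simp only: cm_mult_right cm_lop_part mult.assoc)
  then have "cm (lop u) (mul (tt \<alpha>) * part \<alpha>) =
      2 * (mul (cst (bil \<alpha> \<alpha>)) * (lop u - Z)) + (2 * (mul (cst (bil \<alpha> \<alpha>)) * mul u) + mul (tt \<alpha>) * mul (pdf \<alpha> u))"
    unfolding pp gen .
  also have "2 * (mul (cst (bil \<alpha> \<alpha>)) * mul u) + mul (tt \<alpha>) * mul (pdf \<alpha> u) =
      mul (2 * (cst (bil \<alpha> \<alpha>) * u) + tt \<alpha> * pdf \<alpha> u)"
    by (simp only: mul_hom mult_2)
  also have "2 * (cst (bil \<alpha> \<alpha>) * u) + tt \<alpha> * pdf \<alpha> u = f"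
  proof -
    define b t :: "'n rfun" where "b = cst (bil \<alpha> \<alpha>)" and "t = tt \<alpha>"
    have b: "cst (c * bil \<alpha> \<alpha>) = cst c * b" "cst (2 * bil \<alpha> \<alpha>) = 2 * b"
      using cst_of_nat[of 2, where ?'a = 'n] by (simp_all add: b_def pcst_hom emb_hom)
    have "t \<noteq> 0" using tnz by (simp add: t_def)
    then have "t * (2 * (cst c * b) / t ^ 3) = 2 * (b * (cst c / t ^ 2))"
      by (simp add: field_simps power2_eq_square power3_eq_cube)
    then show ?thesis
      unfolding pdf_u f_def b t_def[symmetric] b_def[symmetric] right_diff_distrib
      by (subst u) (simp add: t_def[symmetric] distrib_left)
  qed
  finally have e: "cm (lop u) (mul (tt \<alpha>) * part \<alpha>) = 2 * (mul (cst (bil \<alpha> \<alpha>)) * (lop u - Z)) + mul f" .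
  have "evalg \<alpha> u (1 + 1) (part (\<eta> i) * part (\<eta> i))" for i
    by (intro evalg.mult evalg.tang bil_eta)
  then have Z: "evalg \<alpha> u 2 Z" unfolding Z_def by (intro evalg_sum) (simp add: numeral_2_eq_2)
  have "reg \<alpha> f" unfolding f_def by (intro regs v)
  moreover have "subf \<alpha> f = f"
    by (simp add: f_def v subf_lin_self[OF ani] even_pdf_root[OF ani])
  ultimately have "evalg \<alpha> u (Suc (Suc 0)) (mul f)" by (intro evalg.mono evalg.fn)
  then show ?thesis unfolding e using Z
    by (intro evalg.add evalg_numeral evalg_scale evalg_diff evalg.lop) (simp_all add: numeral_2_eq_2)
qed

text \<open>Differentiation along the hyperplane does not see the singular term
  c/(\<alpha>,x)^2.\<close>

lemma cm_tang:
  assumes "bil \<alpha> w = 0"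
  shows "evalg \<alpha> u 2 (cm (lop u) (part w))"
proof -
  have "pdf w u = pdf w v" using assms by (simp add: pdf_u pcst_hom emb_hom)
  moreover have "evalg \<alpha> u (Suc (Suc 0)) (mul (pdf w v))"
    by (intro evalg.mono evalg.fn regs v subf_pdf_orth[OF ani] assms)
  ultimately show ?thesis by (simp add: cm_lop_part numeral_2_eq_2)
qed

lemma evalg_cm: "evalg \<alpha> u m X \<Longrightarrow> evalg \<alpha> u (Suc m) (cm (lop u) X)"
proof (induction rule: evalg.induct)
  case (fn f)
  then show ?case using cm_fn by simp
next
  case (tang w)
  then show ?case using cm_tang by (simp add: numeral_2_eq_2)
next
  case theta
  then show ?case using cm_theta by (simp add: numeral_2_eq_2)
next
  case lop
  then show ?case by (simp add: cm_def evalg_0)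
next
  case (add m X Y)
  then show ?case by (simp add: cm_add_right evalg.add)
next
  case (mult m X n Y)
  then have "evalg \<alpha> u (Suc m + n) (cm (lop u) X * Y)" "evalg \<alpha> u (m + Suc n) (X * cm (lop u) Y)"
    by (blast intro: evalg.mult)+
  then show ?case by (simp add: cm_mult_right evalg.add)
qed (rule evalg.mono)

text \<open>\<open>adj u u2 X\<close> differs from the commutator with \<open>lop u\<close> by
  \<open>X\<close> times the even regular function \<open>u2 - u\<close>, which does not raise the
  filtration degree.\<close>

lemma evalg_adj:
  assumes "evalg \<alpha> u m X" "reg \<alpha> (u2 - u)" "subf \<alpha> (u2 - u) = u2 - u"
  shows "evalg \<alpha> u (Suc m) (adj u u2 X)"
proof -
  have "adj u u2 X = cm (lop u) X + X * mul (u2 - u)"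
    by (simp add: adj_def cm_def lop_def algebra_simps mul_hom)
  moreover have "evalg \<alpha> u (Suc (m + 0)) (X * mul (u2 - u))"
    by (intro evalg.mono evalg.mult evalg.fn assms)
  ultimately show ?thesis using evalg_cm[OF assms(1)] by (simp add: evalg.add)
qed

text \<open>Each generator lowers the valuation by at most its filtration degree; for
  \<open>lop u\<close> the potential, with its double pole, costs no more than the two derivatives
  do.\<close>

lemma evalg_vge:
  assumes "evalg \<alpha> u m X"
  shows "vge \<alpha> a f \<Longrightarrow> vge \<alpha> (a - int m) (app X f)"
  using assms
proof (induction arbitrary: a f rule: evalg.induct)
  case (fn g)
  then show ?case using vge_mult[of 0 g a f] by (simp add: vge_0_iff)
next
  case (tang w)
  then show ?case by (simp add: vge_pdf)
next
  case theta
  then have "vge \<alpha> (1 + (a - 1)) (tt \<alpha> powi 1 * pdf \<alpha> f)" by (intro vge_mult vge_powi vge_pdf)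
  then show ?case by (auto elim: vge_mono)
next
  case lop
  have "vge \<alpha> (- 2) u"
    unfolding vge_def u using tnz v(1) by (simp add: distrib_left regs)
  from vge_mult[OF this lop] vge_pdf[OF vge_pdf[OF lop]] show ?case
    by (auto simp: lop_def lapl_def app_sum intro!: vge_diff vge_sum)
next
  case (add m X Y)
  then show ?case by (auto intro: vge_add)
next
  case (mult m X n Y)
  from mult.IH(1)[OF mult.IH(2)[OF mult.prems]] show ?case by (simp add: algebra_simps)
next
  case (mono m X)
  from mono.IH[OF mono.prems] show ?case by (auto elim: vge_mono)
qed

end

text \<open>Each commutator with (\<alpha>,x) contributes a factor vanishing on the hyperplane and
  so gives back one unit of valuation.\<close>

lemma vge_kk_pow:
  assumes "\<And>a f. vge \<alpha> a f \<Longrightarrow> vge \<alpha> (a - m) (app X f)"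
  shows "vge \<alpha> a f \<Longrightarrow> vge \<alpha> (a - (m - int j)) (app ((kk \<alpha> ^^ j) X) f)"
proof (induction j arbitrary: a f)
  case (Suc j)
  have t: "vge \<alpha> (b + 1) (tt \<alpha> * g)" if "vge \<alpha> b g" for b g
    using vge_mult[OF vge_powi[of 1] that] by (simp add: add.commute)
  from Suc.IH[OF t[OF Suc.prems]] t[OF Suc.IH[OF Suc.prems]] show ?case
    by (auto simp: kk_def cm_def algebra_simps intro!: vge_diff)
qed (use assms in simp)

lemma vge_kl:
  assumes "\<And>a f. vge \<alpha> a f \<Longrightarrow> vge \<alpha> (a - m) (app X f)"
  shows "vge \<alpha> a f \<Longrightarrow> vge \<alpha> (a - m) (app (kl xs X) f)"
  using assms
proof (induction xs arbitrary: a f X)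
  case (Cons x xs)
  show ?case unfolding kl.simps
  proof (rule Cons.IH[OF Cons.prems(1)])
    fix a f assume f: "vge \<alpha> a f"
    have x: "vge \<alpha> b (tt x * g)" if "vge \<alpha> b g" for b g
      using vge_mult[of 0 "tt x" b g] that by (simp add: vge_0_iff regs)
    show "vge \<alpha> (a - m) (app (kk x X) f)"
      using Cons.prems(2)[OF x[OF f]] x[OF Cons.prems(2)[OF f]] by (simp add: kk_def cm_def vge_diff)
  qed
qed simp

text \<open>The m + i commutators cost at most m + i units of valuation and the \<open>a\<close>
  commutators with (\<alpha>,x) give \<open>a\<close> units back. Since a + b = d + i, at most m + b
  units are lost, whatever \<open>i\<close> and \<open>a\<close> are.\<close>

lemma even_bound:
  assumes u: "u1 = cst c / tt \<alpha> ^ 2 + v1" "reg \<alpha> v1" "subf \<alpha> v1 = v1"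
      "u2 = cst c / tt \<alpha> ^ 2 + v2" "reg \<alpha> v2" "subf \<alpha> v2 = v2"
    and q: "reg \<alpha> q" "subf \<alpha> q = q"
    and len: "length \<eta>s = b" "a + b = d + i"
  shows "reg \<alpha> (tt \<alpha> ^ (m + b) * app (kl \<eta>s ((kk \<alpha> ^^ a) ((adj u1 u2 ^^ (m + i)) (mul q)))) 1)"
proof -
  have "evalg \<alpha> u1 j ((adj u1 u2 ^^ j) (mul q))" for j
  proof (induction j)
    case 0
    then show ?case using q by (simp add: evalg.fn)
  next
    case (Suc j)
    have "u2 - u1 = v2 - v1" using u by simp
    then show ?case using evalg_adj[OF u(1-3) Suc, of u2] u by (simp add: regs)
  qed
  then have "vge \<alpha> (a' - int (m + i)) (app ((adj u1 u2 ^^ (m + i)) (mul q)) f)" if "vge \<alpha> a' f" for a' f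
    using evalg_vge[OF u(1-3)] that by blast
  from vge_kl[OF vge_kk_pow[OF this], of 0 1 a \<eta>s]
  have "vge \<alpha> (- (int (m + i) - int a)) (app (kl \<eta>s ((kk \<alpha> ^^ a) ((adj u1 u2 ^^ (m + i)) (mul q)))) 1)"
    by (simp add: vge_0_iff regs)
  then have "vge \<alpha> (- int (m + b)) (app (kl \<eta>s ((kk \<alpha> ^^ a) ((adj u1 u2 ^^ (m + i)) (mul q)))) 1)"
    by (rule vge_mono) (use len in simp)
  then show ?thesis by (simp only: vge_def minus_minus power_int_of_nat)
qed

end

subsection \<open>Locus singularities\<close>

context
  fixes \<alpha> :: "complex^'n::finite"
  assumes ani: "bil \<alpha> \<alpha> \<noteq> 0"
begin

lemmas regs' = reg_emb[OF ani] reg_0[OF ani] reg_1[OF ani] reg_add[OF ani] reg_mult[OF ani]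
  reg_minus[OF ani] reg_diff[OF ani] reg_sum[OF ani] reg_power[OF ani] reg_of_nat[OF ani]
  reg_of_int[OF ani] reg_numeral[OF ani] reg_pdf[OF ani] reg_lapl[OF ani]

lemma tnz': "tt \<alpha> \<noteq> 0"
  by (rule tt_nonzero[OF ani])

definition evenreg :: "'n rfun \<Rightarrow> bool" where
  "evenreg f \<longleftrightarrow> reg \<alpha> f \<and> subf \<alpha> f = f"

lemma evenreg_intros:
  "evenreg f \<Longrightarrow> evenreg g \<Longrightarrow> evenreg (f + g)" "evenreg f \<Longrightarrow> evenreg g \<Longrightarrow> evenreg (f - g)"
  "evenreg f \<Longrightarrow> evenreg g \<Longrightarrow> evenreg (f * g)" "evenreg (cst c)" "evenreg f \<Longrightarrow> evenreg (app lapl f)"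
  "evenreg f \<Longrightarrow> evenreg (- f)"
  by (simp_all add: evenreg_def regs' subf_lapl[OF ani])

lemma evenreg_pdf_div: "evenreg f \<Longrightarrow> evenreg (pdf \<alpha> f / tt \<alpha>)"
  by (simp add: evenreg_def even_pdf_root[OF ani] subf_lin_self[OF ani])

lemma evenreg_tt_even: "evenreg (tt \<alpha> ^ (2 * m))"
  by (simp add: evenreg_def regs' subf_lin_self[OF ani])

lemma evenreg_div_odd: "reg \<alpha> f \<Longrightarrow> subf \<alpha> f = - f \<Longrightarrow> evenreg (f / tt \<alpha>)"
  by (simp add: evenreg_def reg_odd_div[OF ani] subf_lin_self[OF ani])

text \<open>Functions whose Laurent expansion across the hyperplane involves only the exponents
  \<open>-K, -K+2, \<dots>, K, K+1, K+2, \<dots>\<close>, and the functions preserving this condition under multiplication.\<close>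
definition locmod :: "nat \<Rightarrow> 'n rfun \<Rightarrow> bool" where
  "locmod K f \<longleftrightarrow> (\<exists>g h. evenreg g \<and> evenreg h \<and> f = g / tt \<alpha> ^ K + tt \<alpha> ^ Suc K * h)"

definition locmult :: "nat \<Rightarrow> 'n rfun \<Rightarrow> bool" where
  "locmult K v \<longleftrightarrow> (\<exists>e w. evenreg e \<and> evenreg w \<and> v = e + tt \<alpha> ^ Suc (2 * K) * w)"

lemma half: "f = cst (1 / 2) * (f + g) + cst (1 / 2) * (f - g)" for f g :: "'n rfun"
proof -
  have "cst (1 / 2) * (f + g) + cst (1 / 2) * (f - g) = (cst (1 / 2) + cst (1 / 2)) * f"
    by (simp add: algebra_simps)
  also have "cst (1 / 2) + cst (1 / 2) = (1 :: 'n rfun)" by (simp flip: emb_hom pcst_hom)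
  finally show ?thesis by simp
qed

text \<open>The odd part of \<open>v\<close> divided by the even power 2K is still odd, so it is
  divisible once more by (\<alpha>,x); this gives the exponent 2K + 1.\<close>

lemma locmultI:
  assumes "reg \<alpha> v" "reg \<alpha> ((v - subf \<alpha> v) / tt \<alpha> ^ (2 * K))"
  shows "locmult K v"
proof -
  define e where "e = cst (1 / 2) * (v + subf \<alpha> v)"
  define d where "d = cst (1 / 2) * ((v - subf \<alpha> v) / tt \<alpha> ^ (2 * K))"
  have e: "evenreg e" using assms(1)
    by (simp add: evenreg_def e_def regs' reg_subf[OF ani] add.commute)
  have "reg \<alpha> d" unfolding d_def by (intro reg_mult[OF ani] assms regs')
  moreover have "subf \<alpha> d = - d"
  proof -
    have e: "subf \<alpha> v - v = - (v - subf \<alpha> v)" by simp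
    have t: "subf \<alpha> (tt \<alpha> ^ (2 * K)) = tt \<alpha> ^ (2 * K)" by (simp add: subf_lin_self[OF ani])
    show ?thesis
      by (simp only: d_def subf_mult subf_cst subf_divide subf_diff subf_invol t e minus_divide_left[symmetric] mult_minus_right)
  qed
  ultimately have "evenreg (d / tt \<alpha>)" by (rule evenreg_div_odd)
  moreover have "v = e + tt \<alpha> ^ Suc (2 * K) * (d / tt \<alpha>)"
    using half[of v "subf \<alpha> v"] tnz' by (simp add: e_def d_def)
  ultimately show ?thesis using e unfolding locmult_def by blast
qed

lemma locmod_regular_multiple:
  assumes "reg \<alpha> f"
  shows "locmod K (tt \<alpha> ^ K * f)"
proof -
  define e where "e = cst (1 / 2) * (f + subf \<alpha> f)"
  define d where "d = cst (1 / 2) * (f - subf \<alpha> f)"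
  have e: "evenreg e" using assms
    by (simp add: evenreg_def e_def regs' reg_subf[OF ani] add.commute)
  have "reg \<alpha> d" "subf \<alpha> d = - d" using assms
    by (simp_all add: d_def regs' reg_subf[OF ani] flip: mult_minus_right)
  then have d: "evenreg (d / tt \<alpha>)" by (rule evenreg_div_odd)
  have "tt \<alpha> ^ K * f = tt \<alpha> ^ K * (e + d)" using half[of f "subf \<alpha> f"] by (simp add: e_def d_def)
  also have "\<dots> = tt \<alpha> ^ (2 * K) * e / tt \<alpha> ^ K + tt \<alpha> ^ Suc K * (d / tt \<alpha>)"
    using tnz' by (simp add: algebra_simps mult_2_right power_add)
  finally show ?thesis using e d evenreg_tt_even unfolding locmod_def by (blast intro: evenreg_intros)
qed

lemma locmod_pole: "locmod K f \<Longrightarrow> reg \<alpha> (tt \<alpha> ^ K * f)"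
  using tnz' by (auto simp: locmod_def evenreg_def distrib_left regs')

lemma locmod_add: "locmod K f \<Longrightarrow> locmod K g \<Longrightarrow> locmod K (f + g)"
proof -
  assume "locmod K f" "locmod K g"
  then obtain a b c d where "evenreg a" "evenreg b" "evenreg c" "evenreg d"
    "f = a / tt \<alpha> ^ K + tt \<alpha> ^ Suc K * b" "g = c / tt \<alpha> ^ K + tt \<alpha> ^ Suc K * d"
    by (auto simp: locmod_def)
  then show ?thesis unfolding locmod_def
    by (intro exI[of _ "a + c"] exI[of _ "b + d"])
      (simp add: evenreg_intros add_divide_distrib algebra_simps)
qed

lemma locmod_minus: "locmod K f \<Longrightarrow> locmod K (- f)"
proof -
  assume "locmod K f"
  then obtain a b where "evenreg a" "evenreg b" "f = a / tt \<alpha> ^ K + tt \<alpha> ^ Suc K * b"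
    by (auto simp: locmod_def)
  then show ?thesis unfolding locmod_def
    by (intro exI[of _ "- a"] exI[of _ "- b"]) (simp add: evenreg_intros)
qed

lemma locmod_diff: "locmod K f \<Longrightarrow> locmod K g \<Longrightarrow> locmod K (f - g)"
  using locmod_add[OF _ locmod_minus] by force

text \<open>The only product of a new shape has exponent (2K + 1) + (K + 1) = -K + 2(2K + 1), so it
  joins the even series starting at -K.\<close>

lemma locmod_mult:
  assumes "locmult K v" "locmod K f"
  shows "locmod K (v * f)"
proof -
  define t where "t = tt \<alpha>"
  obtain e w where v: "evenreg e" "evenreg w" "v = e + t ^ Suc (2 * K) * w"
    using assms(1) by (auto simp: locmult_def t_def)
  obtain g h where f: "evenreg g" "evenreg h" "f = g / t ^ K + t ^ Suc K * h"
    using assms(2) by (auto simp: locmod_def t_def)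
  have t: "t \<noteq> 0" using tnz' by (simp add: t_def)
  define s where "s = t ^ K"
  have s: "s \<noteq> 0" "t ^ Suc K = t * s" "t ^ Suc (2 * K) = t * s * s"
      "t ^ (2 * Suc (2 * K)) = (t * s * s) * (t * s * s)"
    using t by (simp_all add: s_def mult_2 power_add)
  have "v * f = (e * g + t ^ (2 * Suc (2 * K)) * (w * h)) / t ^ K + t ^ Suc K * (e * h + w * g)"
    unfolding v(3) f(3) s s_def[symmetric] using s(1) by (simp add: field_simps)
  moreover have "evenreg (t ^ (2 * Suc (2 * K)))" unfolding t_def by (rule evenreg_tt_even)
  then have "evenreg (e * g + t ^ (2 * Suc (2 * K)) * (w * h))" "evenreg (e * h + w * g)"
    by (intro evenreg_intros v f; assumption)+
  ultimately show ?thesis unfolding locmod_def t_def[symmetric] by blast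
qed

lemma lapl_mult: "app lapl (f * g) = app lapl f * g + f * app lapl g
    + 2 * (\<Sum>i\<in>UNIV. pdf (axis i 1) f * pdf (axis i 1) g)"
  using arg_cong[OF cm_lapl_mul[of f], of "\<lambda>X. app X g"]
  by (simp add: cm_def app_sum algebra_simps)

lemma pdf_dir: "(\<Sum>i\<in>UNIV. cst (v $ i) * pdf (axis i 1) g) = pdf v g"
  using arg_cong[OF part_coords[of v], of "\<lambda>X. app X g"] by (simp add: app_sum)

lemma lapl_powi_mult:
  "app lapl (tt \<alpha> powi m * g) =
    tt \<alpha> powi m * (app lapl g + of_int (2 * m) * (pdf \<alpha> g / tt \<alpha>)
      + of_int (m * (m - 1)) * cst (bil \<alpha> \<alpha>) * g / tt \<alpha> ^ 2)"
proof -
  define t where "t = tt \<alpha>"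
  have t: "t \<noteq> 0" using tnz' by (simp add: t_def)
  have d: "pdf v (t powi l) = of_int l * t powi (l - 1) * cst (bil \<alpha> v)" for v l
    unfolding t_def pdf_powi[OF tnz'] pdf_tt ..
  have grad: "(\<Sum>i\<in>UNIV. pdf (axis i 1) (t powi l) * f i) =
      of_int l * t powi (l - 1) * (\<Sum>i\<in>UNIV. cst (\<alpha> $ i) * f i)" for l f
    by (simp add: d bil_axis_right sum_distrib_left mult.assoc)
  have "app lapl (t powi m) = of_int m * pdf \<alpha> (t powi (m - 1))"
    unfolding pdf_dir[symmetric, of \<alpha>]
    by (simp add: lapl_def app_sum d bil_axis_right sum_distrib_left algebra_simps emb_hom)
  also have "\<dots> = of_int (m * (m - 1)) * cst (bil \<alpha> \<alpha>) * t powi (m - 1 - 1)"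
    by (simp add: d algebra_simps)
  finally have l: "app lapl (t powi m) = of_int (m * (m - 1)) * cst (bil \<alpha> \<alpha>) * t powi (m - 1 - 1)" .
  have p: "t powi (m - 1) = t powi m / t" "t powi (m - 1 - 1) = t powi m / t ^ 2"
    using t by (simp_all add: power_int_diff power2_eq_square)
  show ?thesis unfolding t_def[symmetric] lapl_mult l grad pdf_dir p
    using t by (simp add: algebra_simps diff_divide_distrib)
qed

text \<open>Both -K and K + 1 solve the indicial equation m(m - 1) = K(K + 1), so on both series the
  double pole of the potential cancels the term in which the Laplacian differentiates the power
  twice. The mixed term is even because the transversal derivative of an even function is divisible
  by (\<alpha>,x).\<close>

lemma locmod_lop:
  assumes u: "u = of_nat (K * Suc K) * cst (bil \<alpha> \<alpha>) / tt \<alpha> ^ 2 + v" and v: "locmult K v"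
    and f: "locmod K f"
  shows "locmod K (app (lop u) f)"
proof -
  define t where "t = tt \<alpha>"
  have t: "t \<noteq> 0" using tnz' by (simp add: t_def)
  obtain g h where gh: "evenreg g" "evenreg h" and f': "f = g / t ^ K + t ^ Suc K * h"
    using f by (auto simp: locmod_def t_def)
  define k where "k = (of_nat (K * Suc K) * cst (bil \<alpha> \<alpha>) :: 'n rfun)"
  have k1: "of_int (- int K * (- int K - 1)) * cst (bil \<alpha> \<alpha>) = k"
    and k2: "of_int (int (Suc K) * (int (Suc K) - 1)) * cst (bil \<alpha> \<alpha>) = k"
    by (simp_all add: k_def algebra_simps)
  have "app lapl (g / t ^ K) = t powi (- int K) * (app lapl g + of_int (2 * - int K) * (pdf \<alpha> g / t) + k * g / t ^ 2)"
    using lapl_powi_mult[of "- int K" g] unfolding t_def[symmetric] k1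
    by (simp only: power_int_minus power_int_of_nat) (simp add: divide_inverse mult.commute)
  then have 1: "app lapl (g / t ^ K) - k / t ^ 2 * (g / t ^ K) =
      (app lapl g + of_int (2 * - int K) * (pdf \<alpha> g / t)) / t ^ K"
    by (simp only: power_int_minus power_int_of_nat) (simp add: divide_inverse algebra_simps)
  have "app lapl (t ^ Suc K * h) = t ^ Suc K * (app lapl h + of_int (2 * int (Suc K)) * (pdf \<alpha> h / t) + k * h / t ^ 2)"
    using lapl_powi_mult[of "int (Suc K)" h] unfolding t_def[symmetric] k2 by (simp only: power_int_of_nat)
  then have 2: "app lapl (t ^ Suc K * h) - k / t ^ 2 * (t ^ Suc K * h) =
      t ^ Suc K * (app lapl h + of_int (2 * int (Suc K)) * (pdf \<alpha> h / t))"
    by (simp add: divide_inverse algebra_simps)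
  have "app (lop u) f = (app lapl (g / t ^ K) - k / t ^ 2 * (g / t ^ K)) +
      (app lapl (t ^ Suc K * h) - k / t ^ 2 * (t ^ Suc K * h)) - v * f"
    unfolding lop_def u f' t_def[symmetric] k_def by (simp add: algebra_simps)
  also have "\<dots> = (app lapl g + of_int (2 * - int K) * (pdf \<alpha> g / t)) / t ^ K +
      t ^ Suc K * (app lapl h + of_int (2 * int (Suc K)) * (pdf \<alpha> h / t)) - v * f"
    unfolding 1 2 ..
  finally have e: "app (lop u) f = \<dots>" .
  have oi: "evenreg (of_int m)" for m
    using evenreg_intros(4)[of "of_int m"]
    by (cases m rule: int_cases2) (simp_all add: cst_of_nat pcst_hom emb_hom)
  have "evenreg (app lapl g + of_int (2 * - int K) * (pdf \<alpha> g / t))"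
    "evenreg (app lapl h + of_int (2 * int (Suc K)) * (pdf \<alpha> h / t))"
    unfolding t_def by (intro evenreg_intros oi evenreg_pdf_div gh)+
  then have "locmod K ((app lapl g + of_int (2 * - int K) * (pdf \<alpha> g / t)) / t ^ K +
      t ^ Suc K * (app lapl h + of_int (2 * int (Suc K)) * (pdf \<alpha> h / t)))"
    unfolding locmod_def t_def by blast
  then show ?thesis unfolding e by (rule locmod_diff) (rule locmod_mult[OF v f])
qed

text \<open>Test functions vanish to order \<open>K\<close> and the results may have poles of order
  \<open>K\<close>. Both conditions survive multiplication by linear functions, hence the notion
  survives commutators with them.\<close>

definition bounded :: "nat \<Rightarrow> 'n rop \<Rightarrow> bool" where
  "bounded K X \<longleftrightarrow> (\<forall>f. reg \<alpha> f \<longrightarrow> reg \<alpha> (tt \<alpha> ^ K * app X (tt \<alpha> ^ K * f)))"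

lemma bounded_kk: "bounded K X \<Longrightarrow> bounded K (kk \<xi> X)"
  unfolding bounded_def
proof (intro allI impI)
  fix f assume *: "\<forall>f. reg \<alpha> f \<longrightarrow> reg \<alpha> (tt \<alpha> ^ K * app X (tt \<alpha> ^ K * f))" "reg \<alpha> f"
  have "reg \<alpha> (tt \<alpha> ^ K * app X (tt \<alpha> ^ K * (tt \<xi> * f)))" "reg \<alpha> (tt \<xi> * (tt \<alpha> ^ K * app X (tt \<alpha> ^ K * f)))"
    using * by (simp_all add: regs')
  from reg_diff[OF ani this] show "reg \<alpha> (tt \<alpha> ^ K * app (kk \<xi> X) (tt \<alpha> ^ K * f))"
    by (simp add: kk_def cm_def algebra_simps)
qed

lemma bounded_kl: "bounded K X \<Longrightarrow> bounded K (kl xs X)"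
  by (induction xs arbitrary: X) (auto intro: bounded_kk)

lemma bounded_coeff:
  assumes "bounded K X" "\<And>\<xi>. kk \<xi> X = 0"
  shows "reg \<alpha> (tt \<alpha> ^ (K + K) * app X 1)"
proof -
  have "app X (tt \<alpha> ^ K * 1) = app X 1 * (tt \<alpha> ^ K * 1)"
    by (subst kk_zero_imp_mul[OF assms(2)]) (rule app_mul)
  moreover have "reg \<alpha> (tt \<alpha> ^ K * app X (tt \<alpha> ^ K * 1))"
    using assms(1) regs'(3) unfolding bounded_def by blast
  ultimately show ?thesis by (simp add: power_add algebra_simps)
qed

text \<open>\<open>M\<close> is the space on which the right-hand operator acts: regular functions
  when its potential has no pole on the hyperplane, and \<open>locmod K\<close> itself when both
  operators coincide.\<close>

lemma bounded_adj_locmod: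
  assumes src: "\<And>f. reg \<alpha> f \<Longrightarrow> M (tt \<alpha> ^ K * f)" "\<And>f. M f \<Longrightarrow> M (app (lop u2) f)"
    and q: "\<And>f. M f \<Longrightarrow> locmod K (q * f)"
    and u: "u1 = of_nat (K * Suc K) * cst (bil \<alpha> \<alpha>) / tt \<alpha> ^ 2 + v" "locmult K v"
  shows "bounded K ((adj u1 u2 ^^ j) (mul q))"
proof -
  have "\<forall>f. M f \<longrightarrow> locmod K (app ((adj u1 u2 ^^ j) (mul q)) f)"
  proof (induction j)
    case (Suc j)
    then show ?case using src(2) locmod_lop[OF u] by (auto simp: adj_def intro!: locmod_diff)
  qed (simp add: q)
  then show ?thesis using src(1) locmod_pole by (auto simp: bounded_def)
qed

lemma regular_lop: "reg \<alpha> u \<Longrightarrow> reg \<alpha> f \<Longrightarrow> reg \<alpha> (app (lop u) f)"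
  by (simp add: lop_def regs')

end

subsection \<open>Nilpotency\<close>

text \<open>Membership in the ring of polynomials localised at \<open>D\<close>.\<close>

definition den :: "'n::finite pol \<Rightarrow> 'n rfun \<Rightarrow> bool" where
  "den D f \<longleftrightarrow> (\<exists>m p. f * emb D ^ m = emb p)"

lemma den_emb: "den D (emb p)"
  unfolding den_def by (metis mult_1_right power_0)

lemma den_mult: "den D f \<Longrightarrow> den D g \<Longrightarrow> den D (f * g)"
proof -
  assume "den D f" "den D g"
  then obtain a p b q where "f * emb D ^ a = emb p" "g * emb D ^ b = emb q" by (auto simp: den_def)
  then have "(f * g) * emb D ^ (a + b) = emb (p * q)"
    by (simp add: power_add emb_hom) (metis mult.assoc mult.left_commute)
  then show ?thesis by (auto simp: den_def)
qed

lemma den_add: "den D f \<Longrightarrow> den D g \<Longrightarrow> den D (f + g)"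
proof -
  assume "den D f" "den D g"
  then obtain a p b q where *: "f * emb D ^ a = emb p" "g * emb D ^ b = emb q" by (auto simp: den_def)
  have "(f + g) * emb D ^ (a + b) = (f * emb D ^ a) * emb D ^ b + (g * emb D ^ b) * emb D ^ a"
    by (simp add: power_add algebra_simps)
  also have "\<dots> = emb (p * D ^ b + q * D ^ a)" unfolding * by (simp add: emb_hom emb_power)
  finally show ?thesis unfolding den_def by blast
qed

lemma den_diff: "den D f \<Longrightarrow> den D g \<Longrightarrow> den D (f - g)"
  using den_add[of D f "emb (- 1) * g"] den_mult[OF den_emb[of D "- 1"]] by (simp add: emb_hom)

lemma den_sum: "(\<And>i. i \<in> I \<Longrightarrow> den D (f i)) \<Longrightarrow> den D (sum f I)"
  using den_emb[of D 0] by (induction I rule: infinite_finite_induct) (auto simp: emb_hom intro: den_add)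

lemma den_pdf: "den D f \<Longrightarrow> den D (pdf v f)"
proof -
  assume "den D f"
  then obtain m p where *: "f * emb D ^ m = emb p" by (auto simp: den_def)
  have "pdf v f * emb D ^ m + f * (of_nat m * emb D ^ (m - 1) * emb (pd v D)) = emb (pd v p)"
    using arg_cong[OF *, of "pdf v"] by (simp add: pdf_power)
  then have "pdf v f * emb D ^ m = emb (pd v p) - f * (of_nat m * emb D ^ (m - 1) * emb (pd v D))"
    by (simp add: eq_diff_eq)
  then have "pdf v f * emb D ^ Suc m =
      (emb (pd v p) - f * (of_nat m * emb D ^ (m - 1) * emb (pd v D))) * emb D"
    by (metis mult.assoc power_Suc2)
  then have "pdf v f * emb D ^ Suc m = emb (pd v p) * emb D - of_nat m * (f * (emb D ^ (m - 1) * emb D)) * emb (pd v D)"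
    by (simp add: algebra_simps)
  also have "of_nat m * (f * (emb D ^ (m - 1) * emb D)) = emb (of_nat m * p)"
  proof (cases m)
    case (Suc k)
    have "emb (of_nat k) = (of_nat k :: 'a rfun)" for k by (induction k) (auto simp: emb_hom)
    then have "emb (of_nat m * p) = of_nat m * (f * emb D ^ m)" by (simp only: * emb_hom)
    then show ?thesis by (simp only: Suc diff_Suc_1 power_Suc2)
  qed (simp add: emb_hom)
  finally have "pdf v f * emb D ^ Suc m = emb (pd v p * D - of_nat m * p * pd v D)"
    by (simp add: emb_hom)
  then show ?thesis unfolding den_def by blast
qed

lemma den_lop: "den D u \<Longrightarrow> den D f \<Longrightarrow> den D (app (lop u) f)"
  by (simp add: lop_def lapl_def app_sum den_diff den_sum den_pdf den_mult)

lemma den_adj_pow: "den D u1 \<Longrightarrow> den D u2 \<Longrightarrow> den D f \<Longrightarrow> den D (app ((adj u1 u2 ^^ j) (mul (emb q))) f)"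
  by (induction j arbitrary: f) (auto simp: adj_def intro: den_diff den_lop den_mult den_emb)

lemma den_kl: "(\<And>f. den D f \<Longrightarrow> den D (app X f)) \<Longrightarrow> den D f \<Longrightarrow> den D (app (kl xs X) f)"
proof (induction xs arbitrary: X f)
  case (Cons x xs)
  show ?case unfolding kl.simps
    by (rule Cons.IH[OF _ Cons.prems(2)])
      (simp add: kk_def cm_def den_diff den_mult den_emb Cons.prems(1))
qed simp

lemma regular_everywhere:
  assumes fin: "finite T" and ani: "\<And>\<alpha>. \<alpha> \<in> T \<Longrightarrow> bil \<alpha> \<alpha> \<noteq> 0"
    and den: "den (\<Prod>\<alpha>\<in>T. lin \<alpha>) f" and reg: "\<And>\<alpha>. \<alpha> \<in> T \<Longrightarrow> reg \<alpha> f"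
  shows "\<exists>p. f = emb p"
proof -
  \<comment> \<open>A good \<open>e\<close> can be cancelled from the denominator of any function
    regular at all hyperplanes of \<open>T\<close>; the good polynomials are closed under
    products.\<close>
  define good where "good e \<longleftrightarrow> (\<forall>f p. (\<forall>\<alpha>\<in>T. reg \<alpha> f) \<longrightarrow> f * emb e = emb p \<longrightarrow> (\<exists>p. f = emb p))" for e
  have good1: "good 1" by (simp add: good_def emb_hom)
  have good_mult: "good (d * e)" if de: "good d" "good e" for d e
    unfolding good_def
  proof (intro allI impI)
    fix f p assume *: "\<forall>\<alpha>\<in>T. reg \<alpha> f" "f * emb (d * e) = emb p"
    have "\<forall>\<alpha>\<in>T. reg \<alpha> (f * emb d)" using * ani by (auto intro: reg_mult reg_emb)
    moreover have "(f * emb d) * emb e = emb p" using * by (simp add: emb_hom mult.assoc)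
    ultimately obtain p' where "f * emb d = emb p'" using de(2) unfolding good_def by blast
    then show "\<exists>p. f = emb p" using de(1) * unfolding good_def by blast
  qed
  have good_lin: "good (lin \<alpha>)" if \<alpha>: "\<alpha> \<in> T" for \<alpha>
    unfolding good_def
  proof (intro allI impI)
    fix f p assume *: "\<forall>\<alpha>\<in>T. reg \<alpha> f" "f * tt \<alpha> = emb p"
    then obtain a b where ab: "f = emb a / emb b" "\<not> lin \<alpha> dvd b" using \<alpha> by (auto simp: reg_def)
    then have b: "b \<noteq> 0" by auto
    have "emb (a * lin \<alpha>) = emb (p * b)" using *(2) ab b by (simp add: emb_hom field_simps)
    then have eq: "a * lin \<alpha> = p * b" by simp
    then have "lin \<alpha> dvd p * b" by (metis dvd_triv_right)
    then have "lin \<alpha> dvd p" using ab(2) prime[OF ani[OF \<alpha>]] by (simp add: prime_elem_dvd_mult_iff)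
    then obtain p' where "p = lin \<alpha> * p'" by auto
    then have "f * tt \<alpha> = emb p' * tt \<alpha>" using *(2) by (simp add: emb_hom)
    then have "f = emb p'" using tt_nonzero[OF ani[OF \<alpha>]] by (metis mult_right_cancel)
    then show "\<exists>p. f = emb p" by blast
  qed
  have "good (\<Prod>\<alpha>\<in>S. lin \<alpha>)" if "S \<subseteq> T" for S
    using finite_subset[OF that fin] that
    by (induction S rule: finite_induct) (auto intro: good1 good_mult good_lin)
  then have D: "good (\<Prod>\<alpha>\<in>T. lin \<alpha>)" by blast
  have "good ((\<Prod>\<alpha>\<in>T. lin \<alpha>) ^ m)" for m
    by (induction m) (auto intro: good1 good_mult D)
  then show ?thesis using den reg unfolding den_def good_def by (metis emb_power)
qed

text \<open>The alternatives in \<open>loc\<close> correspond to the mirrors of \<open>W\<close> and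
  to the remaining hyperplanes. The proof descends on the order of the operator number r + 1 until
  the order is negative, that is, the operator is zero.\<close>

theorem adj_nilpotent:
  fixes T :: "(complex^'n::finite) set"
  assumes fin: "finite T" and ani: "\<And>\<alpha>. \<alpha> \<in> T \<Longrightarrow> bil \<alpha> \<alpha> \<noteq> 0"
    and den: "den (\<Prod>\<alpha>\<in>T. lin \<alpha>) u1" "den (\<Prod>\<alpha>\<in>T. lin \<alpha>) u2"
    and hom: "app eu u1 = - 2 * u1" "app eu u2 = - 2 * u2" "app eu (emb q) = of_nat r * emb q"
    and loc: "\<And>\<alpha>. \<alpha> \<in> T \<Longrightarrow>
      (\<exists>c v1 v2. u1 = cst c / tt \<alpha> ^ 2 + v1 \<and> reg \<alpha> v1 \<and> subf \<alpha> v1 = v1 \<and>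
        u2 = cst c / tt \<alpha> ^ 2 + v2 \<and> reg \<alpha> v2 \<and> subf \<alpha> v2 = v2 \<and> psub \<alpha> q = q) \<or>
      (\<exists>K. \<forall>j. bounded \<alpha> K ((adj u1 u2 ^^ j) (mul (emb q))))"
  shows "(adj u1 u2 ^^ Suc r) (mul (emb q)) = 0"
proof -
  define P where "P j = (adj u1 u2 ^^ j) (mul (emb q))" for j
  have P_Suc: "P (Suc j) = adj u1 u2 (P j)" for j by (simp add: P_def)
  have van_pow: "van m X \<Longrightarrow> van (m + i) ((adj u1 u2 ^^ i) X)" for m i X
    by (induction i) (auto intro: van_adj)
  have van_P: "van (Suc (d + i)) (P (Suc r + i))" if "van (Suc d) (P (Suc r))" for d i
  proof -
    have "P (Suc r + i) = (adj u1 u2 ^^ i) (P (Suc r))"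
      by (simp add: P_def funpow_add add.commute del: funpow.simps flip: add_Suc_right)
    then show ?thesis using van_pow[OF that, of i] by simp
  qed
  \<comment> \<open>If the order is at most \<open>d\<close>, then the symbol of order
    \<open>d\<close> vanishes.\<close>
  have step: "van d (P (Suc r))" if d: "d \<le> Suc r" and van: "van (Suc d) (P (Suc r))" for d
    unfolding van_def
  proof (intro allI impI)
    fix xs :: "(complex^'n) list" assume xs: "length xs = d"
    define X where "X = kl xs (P (Suc r))"
    have kkX: "kk \<xi> X = 0" for \<xi>
      using van xs unfolding X_def van_def
      by (metis kl.simps kl_append length_append_singleton)
    have "\<exists>B. \<forall>i a \<eta>s. length \<eta>s = b \<longrightarrow> a + b = d + i \<longrightarrow> (\<forall>\<eta>\<in>set \<eta>s. bil \<alpha> \<eta> = 0) \<longrightarrow>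
        reg \<alpha> (tt \<alpha> ^ B * app (kl \<eta>s ((kk \<alpha> ^^ a) (P (Suc r + i)))) 1)" if \<alpha>: "\<alpha> \<in> T" for \<alpha> b
      using loc[OF \<alpha>]
    proof
      assume "\<exists>K. \<forall>j. bounded \<alpha> K ((adj u1 u2 ^^ j) (mul (emb q)))"
      then obtain K where K: "\<And>j. bounded \<alpha> K (P j)" by (auto simp: P_def)
      have "reg \<alpha> (tt \<alpha> ^ (K + K) * app (kl \<eta>s ((kk \<alpha> ^^ a) (P (Suc r + i)))) 1)"
        if "length \<eta>s = b" "a + b = d + i" for \<eta>s a i
      proof -
        have *: "kl \<eta>s ((kk \<alpha> ^^ a) (P (Suc r + i))) = kl (replicate a \<alpha> @ \<eta>s) (P (Suc r + i))"
          by (simp add: kk_funpow_kl kl_append)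
        have "kk \<xi> (kl (replicate a \<alpha> @ \<eta>s) (P (Suc r + i))) = 0" for \<xi>
        proof -
          have "length ((replicate a \<alpha> @ \<eta>s) @ [\<xi>]) = Suc (d + i)" using that by simp
          then have "kl ((replicate a \<alpha> @ \<eta>s) @ [\<xi>]) (P (Suc r + i)) = 0"
            using van_P[OF van, of i] unfolding van_def by blast
          then show ?thesis by (simp only: kl_append kl.simps)
        qed
        then show ?thesis unfolding * by (intro bounded_coeff[OF ani[OF \<alpha>]] bounded_kl[OF ani[OF \<alpha>]] K)
      qed
      then show ?thesis by blast
    next
      assume "\<exists>c v1 v2. u1 = cst c / tt \<alpha> ^ 2 + v1 \<and> reg \<alpha> v1 \<and> subf \<alpha> v1 = v1 \<and>
        u2 = cst c / tt \<alpha> ^ 2 + v2 \<and> reg \<alpha> v2 \<and> subf \<alpha> v2 = v2 \<and> psub \<alpha> q = q"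
      then obtain c v1 v2 where *: "u1 = cst c / tt \<alpha> ^ 2 + v1" "reg \<alpha> v1" "subf \<alpha> v1 = v1"
        "u2 = cst c / tt \<alpha> ^ 2 + v2" "reg \<alpha> v2" "subf \<alpha> v2 = v2" "psub \<alpha> q = q" by blast
      note a = ani[OF \<alpha>]
      have "subf \<alpha> (emb q) = emb q" using *(7) by (simp add: subf_emb[OF a])
      from even_bound[OF a *(1-6) reg_emb[OF a] this, of _ b _ d _ "Suc r"] show ?thesis
        unfolding P_def by blast
    qed
    from coeffs_regular[OF ani, of _ "\<lambda>i. P (Suc r + i)" u1 u2 d xs, OF _ _ van_P[OF van] this xs]
    have "reg \<alpha> (app X 1)" if "\<alpha> \<in> T" for \<alpha> using that by (simp add: X_def P_Suc)
    moreover have "den (\<Prod>\<alpha>\<in>T. lin \<alpha>) (app X 1)" unfolding X_def P_def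
      using den_emb[of _ 1] by (intro den_kl den_adj_pow den) (auto simp: emb_hom)
    ultimately obtain p where p: "app X 1 = emb p" using regular_everywhere[OF fin ani] by blast
    have "deg (int r) (mul (emb q))" by (rule deg_mul) (simp add: hom)
    from deg_kl[OF deg_adj_pow[OF this hom(1,2)], of "Suc r" xs]
    \<comment> \<open>The polynomial has degree \<open>r\<close>, each of the r + 1 applications of
      \<open>adj\<close> lowers the degree by two, and each of the \<open>d\<close> commutators with
      a linear function raises it by one.\<close>
    have "deg (int r - 2 * int (Suc r) + int d) X" by (simp only: X_def P_def xs)
    from deg_coeff[OF this] have "app eu (emb p) = of_int (int r - 2 * int (Suc r) + int d) * emb p"
      unfolding p .
    then have "p = 0" by (rule euler_negative_emb) (use d in simp)
    then show "kl xs (P (Suc r)) = 0"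
      using kk_zero_imp_mul[OF kkX] p by (simp add: X_def emb_hom mul_hom)
  qed
  have P0: "P 0 = mul (emb q)" unfolding P_def by (rule funpow_0)
  have start: "van (Suc j) (P j)" for j
  proof (induction j)
    case 0
    show ?case unfolding P0 van_Suc by (simp add: van_def)
  next
    case (Suc j)
    then show ?case unfolding P_Suc by (rule van_adj)
  qed
  have "van 0 (P (Suc r))"
  \<comment> \<open>The descent starts at r + 2, because \<open>P (Suc r)\<close> has order at most
    r + 1.\<close>
  proof (rule inc_induct[where P = "\<lambda>d. van d (P (Suc r))" and i = 0 and j = "Suc (Suc r)"])
    fix n assume "n < Suc (Suc r)" "van (Suc n) (P (Suc r))"
    then show "van n (P (Suc r))" using step[of n] by simp
  qed (rule start le0)+
  then have "P (Suc r) = 0" unfolding van_def by (metis kl.simps(1) list.size(3))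
  then show ?thesis unfolding P_def .
qed

subsection \<open>Holomorphic functions of several variables\<close>

lemma axis_scale: "axis i (c * z :: complex) = c *s axis i z"
  by (simp add: vec_eq_iff axis_def)

lemma bounded_linear_axis: "bounded_linear (\<lambda>z::complex. axis i z :: complex^'n::finite)"
  by (rule linear_conv_bounded_linear[THEN iffD1]) (auto simp: linear_iff vec_eq_iff axis_def)

lemma norm_axis_complex: "norm (axis i (z::complex) :: complex^'n::finite) = norm z"
proof -
  have "(norm (axis i z $ j)) ^ 2 = (if j = i then norm z ^ 2 else 0)" for j by (simp add: axis_def)
  then show ?thesis by (simp add: norm_vec_def L2_set_def)
qed

lemma vec_axis_sum: "(v::complex^'n::finite) = (\<Sum>j\<in>UNIV. (v $ j) *s axis j 1)"
  by (simp add: vec_eq_iff axis_def if_distrib cong: if_cong)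

lemma partial_d_has_derivative:
  assumes "(f has_derivative D) (at x)" "\<And>c v. D (c *s v) = c * D v"
  shows "((\<lambda>z. f (x + axis i z)) has_field_derivative D (axis i 1)) (at 0)"
    "partial_d i f x = D (axis i 1)"
proof -
  have a: "((\<lambda>z. x + axis i z) has_derivative axis i) (at 0)"
    by (auto intro!: derivative_eq_intros bounded_linear.has_derivative[OF bounded_linear_axis])
  have 0: "x + axis i 0 = x" by (simp add: vec_eq_iff axis_def)
  have "((f \<circ> (\<lambda>z. x + axis i z)) has_derivative (D \<circ> axis i)) (at 0)"
    by (rule diff_chain_at[OF a]) (simp add: 0 assms)
  moreover have "D (axis i h) = h * D (axis i 1)" for h
    using assms(2)[of h "axis i 1"] axis_scale[of i h 1] by simp
  then have "D \<circ> axis i = (\<lambda>h. D (axis i 1) * h)" by (metis comp_apply ext mult.commute)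
  ultimately show *: "((\<lambda>z. f (x + axis i z)) has_field_derivative D (axis i 1)) (at 0)"
    by (simp add: has_field_derivative_def o_def)
  then show "partial_d i f x = D (axis i 1)"
    by (simp add: partial_d_def DERIV_imp_deriv)
qed

lemma holo_on_derivative:
  assumes "holo_on U f" "x \<in> U"
  shows "(f has_derivative (\<lambda>v. \<Sum>j\<in>UNIV. v $ j * partial_d j f x)) (at x)"
proof -
  obtain D where D: "(f has_derivative D) (at x)" "\<And>c v. D (c *s v) = c * D v"
    using assms by (auto simp: holo_on_def)
  then have lin: "linear D" by (intro bounded_linear.linear has_derivative_bounded_linear)
  have "D v = (\<Sum>j\<in>UNIV. v $ j * partial_d j f x)" for v
  proof -
    have "D v = D (\<Sum>j\<in>UNIV. (v $ j) *s axis j 1)" by (rule arg_cong[OF vec_axis_sum])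
    also have "\<dots> = (\<Sum>j\<in>UNIV. D ((v $ j) *s axis j 1))" by (rule linear_sum[OF lin])
    finally show ?thesis by (simp only: D(2) partial_d_has_derivative(2)[OF D])
  qed
  then have "D = (\<lambda>v. \<Sum>j\<in>UNIV. v $ j * partial_d j f x)" by (rule ext)
  from D(1)[unfolded this] show ?thesis .
qed

lemma holo_on_partial:
  assumes "holo_on U f" "x \<in> U"
  shows "((\<lambda>z. f (x + axis i z)) has_field_derivative partial_d i f x) (at 0)"
  using assms partial_d_has_derivative unfolding holo_on_def by metis

lemma holo_onI:
  assumes "\<And>x. x \<in> U \<Longrightarrow> (f has_derivative D x) (at x)" "\<And>x c v. x \<in> U \<Longrightarrow> D x (c *s v) = c * D x v"
  shows "holo_on U f"
  using assms unfolding holo_on_def by blast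

lemma holo_on_cong:
  assumes "open U" "\<And>x. x \<in> U \<Longrightarrow> f x = g x" "holo_on U f"
  shows "holo_on U g"
  using assms unfolding holo_on_def by (metis has_derivative_transform_within_open)

lemma holo_on_const [intro]: "holo_on U (\<lambda>x. c)"
  by (rule holo_onI[where D = "\<lambda>x v. 0"]) auto

lemma holo_on_coord [intro]: "holo_on U (\<lambda>x. x $ i)"
  by (rule holo_onI[where D = "\<lambda>x v. v $ i"])
    (auto intro!: derivative_eq_intros bounded_linear_imp_has_derivative bounded_linear_vec_nth)

lemma holo_on_add [intro]: "holo_on U f \<Longrightarrow> holo_on U g \<Longrightarrow> holo_on U (\<lambda>x. f x + g x)"
  unfolding holo_on_def
proof
  fix x assume *: "\<forall>x\<in>U. \<exists>D. (f has_derivative D) (at x) \<and> (\<forall>c v. D (c *s v) = c * D v)"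
    "\<forall>x\<in>U. \<exists>D. (g has_derivative D) (at x) \<and> (\<forall>c v. D (c *s v) = c * D v)" "x \<in> U"
  then obtain D E where "(f has_derivative D) (at x)" "\<forall>c v. D (c *s v) = c * D v"
    "(g has_derivative E) (at x)" "\<forall>c v. E (c *s v) = c * E v" by blast
  then show "\<exists>D. ((\<lambda>x. f x + g x) has_derivative D) (at x) \<and> (\<forall>c v. D (c *s v) = c * D v)"
    by (intro exI[of _ "\<lambda>v. D v + E v"]) (auto intro!: has_derivative_add simp: distrib_left)
qed

lemma holo_on_mult [intro]: "holo_on U f \<Longrightarrow> holo_on U g \<Longrightarrow> holo_on U (\<lambda>x. f x * g x)"
  unfolding holo_on_def
proof
  fix x assume *: "\<forall>x\<in>U. \<exists>D. (f has_derivative D) (at x) \<and> (\<forall>c v. D (c *s v) = c * D v)"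
    "\<forall>x\<in>U. \<exists>D. (g has_derivative D) (at x) \<and> (\<forall>c v. D (c *s v) = c * D v)" "x \<in> U"
  then obtain D E where "(f has_derivative D) (at x)" "\<forall>c v. D (c *s v) = c * D v"
    "(g has_derivative E) (at x)" "\<forall>c v. E (c *s v) = c * E v" by blast
  then show "\<exists>D. ((\<lambda>x. f x * g x) has_derivative D) (at x) \<and> (\<forall>c v. D (c *s v) = c * D v)"
    using has_derivative_mult[of f D x UNIV g E]
    by (intro exI[of _ "\<lambda>v. f x * E v + D v * g x"]) (simp add: distrib_left mult.assoc mult.left_commute)
qed

lemma holo_on_compose:
  assumes "holo_on U f" "\<And>x. x \<in> U \<Longrightarrow> (g has_field_derivative g' x) (at (f x))"
  shows "holo_on U (\<lambda>x. g (f x))"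
  unfolding holo_on_def
proof
  fix x assume x: "x \<in> U"
  obtain D where D: "(f has_derivative D) (at x)" "\<forall>c v. D (c *s v) = c * D v"
    using assms(1) x by (auto simp: holo_on_def)
  have "(g has_derivative (\<lambda>h. g' x * h)) (at (f x))" using assms(2)[OF x] by (simp add: has_field_derivative_def)
  from diff_chain_at[OF D(1) this] D(2)
  show "\<exists>D. ((\<lambda>x. g (f x)) has_derivative D) (at x) \<and> (\<forall>c v. D (c *s v) = c * D v)"
    by (intro exI[of _ "\<lambda>v. g' x * D v"]) (auto simp: o_def)
qed

lemma holo_on_exp: "holo_on U f \<Longrightarrow> holo_on U (\<lambda>x. exp (f x))"
  by (rule holo_on_compose) (auto intro: DERIV_exp)

lemma holo_on_inverse: "holo_on U f \<Longrightarrow> (\<And>x. x \<in> U \<Longrightarrow> f x \<noteq> 0) \<Longrightarrow> holo_on U (\<lambda>x. inverse (f x))"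
  by (rule holo_on_compose) (auto intro: DERIV_inverse)

lemma holo_on_cmult: "holo_on U f \<Longrightarrow> holo_on U (\<lambda>x. c * f x)"
  by (rule holo_on_mult[OF holo_on_const])

lemma holo_on_minus: "holo_on U f \<Longrightarrow> holo_on U (\<lambda>x. - f x)"
  using holo_on_cmult[of U f "- 1"] by simp

lemma holo_on_diff: "holo_on U f \<Longrightarrow> holo_on U g \<Longrightarrow> holo_on U (\<lambda>x. f x - g x)"
  using holo_on_add[OF _ holo_on_minus] by force

lemma holo_on_sum: "(\<And>i. i \<in> I \<Longrightarrow> holo_on U (f i)) \<Longrightarrow> holo_on U (\<lambda>x. \<Sum>i\<in>I. f i x)"
  by (induction I rule: infinite_finite_induct) auto

lemma holo_on_imp_continuous_on: "holo_on U f \<Longrightarrow> continuous_on U f"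
  unfolding holo_on_def
  by (metis continuous_at_imp_continuous_on has_derivative_continuous)

lemma poly_fun_holo: "poly_fun p \<Longrightarrow> holo_on U p"
  by (induction rule: poly_fun.induct) auto

section \<open>Cauchy's formula and Osgood's lemma\<close>

definition circ :: "real \<Rightarrow> real \<Rightarrow> complex" where
  "circ r t = r * exp (2 * pi * \<i> * t)"

text \<open>Cauchy's formula for the first derivative along one axis. On the unit interval the
  derivative of \<open>circ r\<close> is 2\<pi>\<i> times \<open>circ r\<close>, which cancels the
  constant in front and one of the two powers in the denominator.\<close>

lemma partial_d_integral:
  assumes f: "holo_on U f" and r: "r > 0" and U: "\<And>z. norm z \<le> r \<Longrightarrow> x + axis i z \<in> U"
  shows "partial_d i f x = integral {0..1}
    (\<lambda>t. f (x + axis i (circ r t)) / (circ r t))"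
proof -
  define g where "g z = f (x + axis i z)" for z
  have dg: "(g has_field_derivative partial_d i f (x + axis i z)) (at z)" if "norm z \<le> r" for z
  proof -
    have "((\<lambda>y. f (x + axis i z + axis i y)) has_field_derivative partial_d i f (x + axis i z)) (at 0)"
      using that by (intro holo_on_partial[OF f] U)
    moreover have "x + axis i z + axis i y = x + axis i (y + z)" for y
      by (simp add: vec_eq_iff axis_def)
    ultimately show ?thesis using DERIV_shift[of g _ 0 z] by (simp add: g_def)
  qed
  have hol: "g holomorphic_on cball 0 r"
    unfolding holomorphic_on_def field_differentiable_def
    by (metis dg dist_0_norm has_field_derivative_at_within mem_cball)
  have "(g has_field_derivative (1 / (2 * of_real pi * \<i>) *
      contour_integral (circlepath 0 r) (\<lambda>u. g u / (u - 0)^2))) (at 0)"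
    by (rule Cauchy_derivative_integral_circlepath)
      (use r hol in \<open>auto intro: holomorphic_on_imp_continuous_on holomorphic_on_subset\<close>)
  moreover have "(g has_field_derivative partial_d i f x) (at 0)"
    using dg[of 0] r by (simp add: axis_def zero_vec_def[symmetric])
  ultimately have step1: "partial_d i f x = 1 / (2 * of_real pi * \<i>) *
      contour_integral (circlepath 0 r) (\<lambda>u. g u / u^2)"
    using DERIV_unique by fastforce
  have c: "circlepath 0 r t = circ r t"
    "vector_derivative (circlepath 0 r) (at t) = 2 * of_real pi * \<i> * circ r t" "circ r t \<noteq> 0" for t
    using r by (simp_all add: vector_derivative_circlepath circlepath[THEN fun_cong] circ_def)
  note step1
  also have "contour_integral (circlepath 0 r) (\<lambda>u. g u / u^2) =
      integral {0..1} (\<lambda>t. (2 * of_real pi * \<i>) * (g (circ r t) / (circ r t)))"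
    unfolding contour_integral_integral
    by (intro integral_cong) (simp add: c power2_eq_square)
  also have "\<dots> = (2 * of_real pi * \<i>) * integral {0..1} (\<lambda>t. g (circ r t) / (circ r t))"
    by (rule integral_mult_right)
  finally show ?thesis by (simp add: g_def)
qed

lemma open_polydisc:
  assumes "open U" "x0 \<in> (U :: (complex^'n::finite) set)"
  obtains e r where "e > 0" "r > 0" "\<And>x z. x \<in> ball x0 e \<Longrightarrow> norm z \<le> r \<Longrightarrow> x + axis i z \<in> U"
    "ball x0 e \<subseteq> U"
proof -
  obtain d where d: "d > 0" "ball x0 d \<subseteq> U" using assms openE by blast
  have "x + axis i z \<in> U" if "x \<in> ball x0 (d/2)" "norm z \<le> d/3" for x z
  proof -
    have "dist x0 (x + axis i z) \<le> dist x0 x + norm (axis i z :: complex^'n)"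
      by (metis dist_triangle dist_norm add_diff_cancel_left' norm_minus_commute)
    also have "\<dots> < d" using that d(1) by (simp add: norm_axis_complex)
    finally show ?thesis using d by auto
  qed
  moreover have "ball x0 (d/2) \<subseteq> U" using d by auto
  ultimately show ?thesis using that[of "d/2" "d/3"] d(1) by auto
qed

text \<open>Continuity of the partial derivatives is not part of \<open>holo_on\<close>; it comes
  from the integral formula and is what allows differentiating that formula under the integral sign
  below.\<close>

lemma continuous_on_partial_d:
  assumes "open U" "holo_on U (f :: complex^'n::finite \<Rightarrow> complex)"
  shows "continuous_on U (partial_d i f)"
proof (rule continuous_at_imp_continuous_on, rule ballI)
  fix x0 assume "x0 \<in> U"
  then obtain e r where e: "e > 0" "r > 0" "\<And>x z. x \<in> ball x0 e \<Longrightarrow> norm z \<le> r \<Longrightarrow> x + axis i z \<in> U"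
    using open_polydisc[OF assms(1), of x0 i] by metis
  define w where "w t = circ r t" for t
  have w: "norm (w t) = r" "w t \<noteq> 0" "continuous_on S w" for t S
    using e(2) by (auto simp: w_def circ_def norm_mult intro!: continuous_intros)
  have "continuous_on (ball x0 e \<times> cbox 0 1) (\<lambda>(x, t). f (x + axis i (w t)) / w t)"
    unfolding case_prod_beta
    by (intro continuous_intros continuous_on_compose2[OF holo_on_imp_continuous_on[OF assms(2)]]
        continuous_on_compose2[OF linear_continuous_on[OF bounded_linear_axis]]
        continuous_on_compose2[OF w(3)[of UNIV]])
      (auto simp: w intro!: e(3))
  then have cont: "continuous_on (ball x0 e) (\<lambda>x. integral (cbox 0 1) (\<lambda>t. f (x + axis i (w t)) / w t))"
    by (rule integral_continuous_on_param)
  have eq: "partial_d i f x = integral (cbox 0 1) (\<lambda>t. f (x + axis i (w t)) / w t)" if "x \<in> ball x0 e" for x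
    unfolding w_def using partial_d_integral[OF assms(2) e(2,3), of x] that by simp
  have "continuous_on (ball x0 e) (partial_d i f)"
    by (rule continuous_on_eq[OF cont]) (simp add: eq)
  then show "isCont (partial_d i f) x0"
    using e(1) by (simp add: continuous_on_eq_continuous_at)
qed

text \<open>Osgood's lemma: differentiate Cauchy's formula in one variable with respect to the others.\<close>
lemma partial_d_partial_d_integral:
  assumes U: "open U" and f: "holo_on U (f :: complex^'n::finite \<Rightarrow> complex)" and x0: "x0 \<in> U"
  shows "\<exists>D. (partial_d i f has_derivative D) (at x0) \<and> (\<forall>c v. D (c *s v) = c * D v) \<and>
    (\<exists>r. r > 0 \<and> (\<forall>z. norm z \<le> r \<longrightarrow> x0 + axis i z \<in> U) \<and>
      (\<forall>j. D (axis j 1) = integral {0..1}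
        (\<lambda>t. partial_d j f (x0 + axis i (circ r t)) / (circ r t))))"
proof -
  obtain e r where e: "e > 0" "r > 0" "\<And>x z. x \<in> ball x0 e \<Longrightarrow> norm z \<le> r \<Longrightarrow> x + axis i z \<in> U"
    using open_polydisc[OF U x0, of i] by metis
  define w where "w t = circ r t" for t
  have w: "norm (w t) = r" "w t \<noteq> 0" "continuous_on S w" for t S
    using e(2) by (auto simp: w_def circ_def norm_mult intro!: continuous_intros)
  define G where "G y v = (\<Sum>j\<in>UNIV. v $ j * partial_d j f y)" for y v
  have blG: "bounded_linear (\<lambda>v. G y v / c)" for y c
    by (rule linear_conv_bounded_linear[THEN iffD1])
      (auto simp: linear_iff G_def sum.distrib distrib_right add_divide_distrib sum_divide_distrib
        scaleR_conv_of_real[where 'a = complex] sum_distrib_left mult.assoc)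
  \<comment> \<open>The Leibniz rule asks for the derivatives of the integrand as a continuous
    family of bounded linear maps.\<close>
  define F where "F x t = Blinfun (\<lambda>v. G (x + axis i (w t)) v / w t)" for x t
  have F: "blinfun_apply (F x t) v = G (x + axis i (w t)) v / w t" for x t v
    by (simp add: F_def bounded_linear_Blinfun_apply blG)
  have contp: "continuous_on (ball x0 e \<times> cbox 0 1) (\<lambda>(x, t). h (x + axis i (w t)))"
    if "continuous_on U h" for h :: "complex^'n \<Rightarrow> complex"
    unfolding case_prod_beta
    by (intro continuous_intros continuous_on_compose2[OF that]
        continuous_on_compose2[OF linear_continuous_on[OF bounded_linear_axis]]
        continuous_on_compose2[OF w(3)[of UNIV]])
      (auto simp: w intro!: e(3))
  have contw: "continuous_on (ball x0 e \<times> cbox 0 1) (\<lambda>(x, t). w t)"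
    unfolding case_prod_beta
    by (intro continuous_intros continuous_on_compose2[OF w(3)[of UNIV]]) auto
  have contF: "continuous_on (ball x0 e \<times> cbox 0 1) (\<lambda>(x, t). F x t)"
  proof (rule continuous_on_blinfun_componentwise)
    fix v :: "complex^'n"
    show "continuous_on (ball x0 e \<times> cbox 0 1) (\<lambda>p. blinfun_apply (case p of (x, t) \<Rightarrow> F x t) v)"
      using contw contp[OF continuous_on_partial_d[OF U f]]
      by (auto simp: case_prod_beta F G_def w intro!: continuous_intros)
  qed
  have contf: "continuous_on (ball x0 e \<times> cbox 0 1) (\<lambda>(x, t). f (x + axis i (w t)) / w t)"
    using contw contp[OF holo_on_imp_continuous_on[OF f]]
    by (auto simp: case_prod_beta w intro!: continuous_intros)
  have sect: "continuous_on (cbox 0 1) (\<lambda>t. h x t)"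
    if "continuous_on (ball x0 e \<times> cbox 0 1) (\<lambda>(x, t). h x t)" "x \<in> ball x0 e"
    for h :: "_ \<Rightarrow> real \<Rightarrow> 'z::topological_space" and x
  proof -
    have "(\<lambda>t. (x, t)) ` cbox 0 1 \<subseteq> ball x0 e \<times> cbox (0::real) 1" using that(2) by auto
    from continuous_on_compose2[OF that(1) continuous_on_Pair[OF continuous_on_const continuous_on_id] this]
    show ?thesis by simp
  qed
  have fx: "((\<lambda>x. f (x + axis i (w t)) / w t) has_derivative blinfun_apply (F x t)) (at x within ball x0 e)"
    if xt: "x \<in> ball x0 e" "t \<in> cbox 0 1" for x and t :: real
  proof -
    have "(f has_derivative G (x + axis i (w t))) (at (x + axis i (w t)))"
      unfolding G_def by (rule holo_on_derivative[OF f]) (use e(3) xt w in auto)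
    moreover have "((\<lambda>x. x + axis i (w t)) has_derivative (\<lambda>v. v)) (at x)"
      by (auto intro!: derivative_eq_intros)
    ultimately have "((\<lambda>x. f (x + axis i (w t))) has_derivative G (x + axis i (w t))) (at x)"
      using has_derivative_compose[of "\<lambda>x. x + axis i (w t)" "\<lambda>v. v" x UNIV f] by blast
    then have "((\<lambda>x. f (x + axis i (w t)) / w t) has_derivative (\<lambda>v. G (x + axis i (w t)) v / w t)) (at x)"
      by (rule bounded_linear.has_derivative[OF bounded_linear_divide])
    then show ?thesis
      by (simp add: F[abs_def] has_derivative_at_withinI)
  qed
  have int: "(\<lambda>t. f (x + axis i (w t)) / w t) integrable_on cbox 0 1" if "x \<in> ball x0 e" for x
    using that by (rule integrable_continuous[OF sect[OF contf]])
  have "x0 \<in> ball x0 e" using e(1) by simp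
  have "((\<lambda>x. integral (cbox 0 1) (\<lambda>t. f (x + axis i (w t)) / w t)) has_derivative
      blinfun_apply (integral (cbox 0 1) (F x0))) (at x0 within ball x0 e)"
    by (rule leibniz_rule[of "ball x0 e" 0 1 "\<lambda>x t. f (x + axis i (w t)) / w t" F])
      (fact fx int contF \<open>x0 \<in> ball x0 e\<close> convex_ball)+
  then have "((\<lambda>x. integral (cbox 0 1) (\<lambda>t. f (x + axis i (w t)) / w t)) has_derivative
      blinfun_apply (integral (cbox 0 1) (F x0))) (at x0)"
    by (simp only: at_within_open[OF \<open>x0 \<in> ball x0 e\<close> open_ball])
  then have d: "(partial_d i f has_derivative blinfun_apply (integral (cbox 0 1) (F x0))) (at x0)"
  proof (rule has_derivative_transform_within_open[of _ _ _ _ "ball x0 e"])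
    fix x assume "x \<in> ball x0 e"
    then show "integral (cbox 0 1) (\<lambda>t. f (x + axis i (w t)) / w t) = partial_d i f x"
      using partial_d_integral[OF f e(2) e(3), of x] by (simp add: w_def)
  qed (simp_all add: e(1))
  have val: "blinfun_apply (integral (cbox 0 1) (F x0)) v = integral {0..1} (\<lambda>t. G (x0 + axis i (w t)) v / w t)" for v
  proof -
    have "F x0 integrable_on cbox 0 1"
      by (rule integrable_continuous[OF sect[OF contF]]) (use e(1) in simp)
    then show ?thesis by (simp add: blinfun_apply_integral F)
  qed
  have "G y (c *s v) = c * G y v" for y c v by (simp add: G_def sum_distrib_left mult.assoc)
  then have lin: "blinfun_apply (integral (cbox 0 1) (F x0)) (c *s v) = c * blinfun_apply (integral (cbox 0 1) (F x0)) v" for c v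
    unfolding val by (simp flip: integral_mult_right)
  have "G y (axis j 1) = partial_d j f y" for y j
    by (simp add: G_def axis_def if_distrib if_distribR cong: if_cong)
  then have "\<forall>j. blinfun_apply (integral (cbox 0 1) (F x0)) (axis j 1) = integral {0..1}
        (\<lambda>t. partial_d j f (x0 + axis i (circ r t)) / (circ r t))"
    unfolding val by (simp add: w_def)
  with d lin e show ?thesis
    by (intro exI[of _ "blinfun_apply (integral (cbox 0 1) (F x0))"]) (auto intro!: exI[of _ r])
qed

lemma holo_on_partial_d:
  assumes "open U" "holo_on U (f :: complex^'n::finite \<Rightarrow> complex)"
  shows "holo_on U (partial_d i f)"
  using partial_d_partial_d_integral[OF assms] unfolding holo_on_def by blast

text \<open>Differentiating Cauchy's formula for the derivative along axis \<open>i\<close> in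
  direction \<open>j\<close> gives Cauchy's formula for the derivative along \<open>i\<close> of
  \<open>partial_d j f\<close>.\<close>

lemma partial_d_commute:
  assumes "open U" "holo_on U (f :: complex^'n::finite \<Rightarrow> complex)" "x \<in> U"
  shows "partial_d j (partial_d i f) x = partial_d i (partial_d j f) x"
proof -
  obtain D r where D: "(partial_d i f has_derivative D) (at x)" "\<And>c v. D (c *s v) = c * D v"
    "r > 0" "\<And>z. norm z \<le> r \<Longrightarrow> x + axis i z \<in> U"
    "D (axis j 1) = integral {0..1}
        (\<lambda>t. partial_d j f (x + axis i (circ r t)) / (circ r t))"
    using partial_d_partial_d_integral[OF assms, of i] by blast
  have "partial_d j (partial_d i f) x = D (axis j 1)" by (rule partial_d_has_derivative(2)[OF D(1,2)])
  also have "\<dots> = partial_d i (partial_d j f) x"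
    unfolding D(5) by (rule partial_d_integral[OF holo_on_partial_d[OF assms(1,2)] D(3,4), symmetric])
  finally show ?thesis .
qed

lemma partial_d_cong:
  assumes "open U" "\<And>x. x \<in> U \<Longrightarrow> f x = g x" "x \<in> U"
  shows "partial_d i f x = partial_d i g x"
proof -
  have "(\<lambda>z. x + axis i z) \<midarrow>0\<rightarrow> x + axis i 0"
    by (intro tendsto_intros bounded_linear.tendsto[OF bounded_linear_axis])
  moreover have "x + axis i 0 = x" by (simp add: vec_eq_iff axis_def)
  ultimately have "(\<lambda>z. x + axis i z) \<midarrow>0\<rightarrow> x" by simp
  then have "\<forall>\<^sub>F z in at 0. x + axis i z \<in> U" using assms topological_tendstoD by blast
  then have "\<forall>\<^sub>F z in nhds 0. x + axis i z \<in> U"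
    using assms(3) by (simp add: eventually_nhds_conv_at \<open>x + axis i 0 = x\<close>)
  then show ?thesis unfolding partial_d_def
    by (intro deriv_cong_ev) (auto elim!: eventually_mono simp: assms(2))
qed

context
  fixes U :: "(complex^'n::finite) set" and f g :: "complex^'n \<Rightarrow> complex"
  assumes f: "holo_on U f" and g: "holo_on U g"
begin

lemma partial_d_add: "x \<in> U \<Longrightarrow> partial_d i (\<lambda>x. f x + g x) x = partial_d i f x + partial_d i g x"
  unfolding partial_d_def[of _ "\<lambda>x. f x + g x"]
  by (intro DERIV_imp_deriv DERIV_add holo_on_partial[OF f] holo_on_partial[OF g])

lemma partial_d_mult:
  "x \<in> U \<Longrightarrow> partial_d i (\<lambda>x. f x * g x) x = partial_d i f x * g x + f x * partial_d i g x"
proof -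
  assume x: "x \<in> U"
  have 0: "x + axis i 0 = x" by (simp add: vec_eq_iff axis_def)
  from DERIV_mult[OF holo_on_partial[OF f x] holo_on_partial[OF g x], of i i]
  show ?thesis unfolding partial_d_def[of _ "\<lambda>x. f x * g x"]
    by (intro DERIV_imp_deriv) (simp add: 0 algebra_simps)
qed

end

lemma partial_d_const [simp]: "partial_d i (\<lambda>x. c) x = 0"
  by (simp add: partial_d_def)

lemma partial_d_coord: "partial_d i (\<lambda>x. x $ j) x = (if i = j then 1 else 0)"
  using partial_d_has_derivative(2)[OF bounded_linear_imp_has_derivative[OF bounded_linear_vec_nth], of j i x]
  by (auto simp: axis_def)

lemma partial_d_cmult: "holo_on U f \<Longrightarrow> x \<in> U \<Longrightarrow> partial_d i (\<lambda>x. c * f x) x = c * partial_d i f x"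
  using partial_d_mult[OF holo_on_const[of U c], of f x i] by simp

lemma partial_d_minus: "holo_on U f \<Longrightarrow> x \<in> U \<Longrightarrow> partial_d i (\<lambda>x. - f x) x = - partial_d i f x"
  using partial_d_cmult[of U f x i "- 1"] by simp

lemma partial_d_diff: "holo_on U f \<Longrightarrow> holo_on U g \<Longrightarrow> x \<in> U \<Longrightarrow>
    partial_d i (\<lambda>x. f x - g x) x = partial_d i f x - partial_d i g x"
  using partial_d_add[OF _ holo_on_minus, of U f g x i] partial_d_minus[of U g x i] by simp

lemma partial_d_sum: "(\<And>j. j \<in> I \<Longrightarrow> holo_on U (f j)) \<Longrightarrow> x \<in> U \<Longrightarrow>
    partial_d i (\<lambda>x. \<Sum>j\<in>I. f j x) x = (\<Sum>j\<in>I. partial_d i (f j) x)"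
proof (induction I rule: infinite_finite_induct)
  case (insert j I)
  then have "holo_on U (f j)" "holo_on U (\<lambda>x. \<Sum>j\<in>I. f j x)" by (auto intro: holo_on_sum)
  from partial_d_add[OF this] insert show ?case by simp
qed simp_all

subsection \<open>Normal forms of differential operators and their adjoints\<close>

fun pw :: "'n list \<Rightarrow> 'n::finite diffop" where
  "pw [] f = f"
| "pw (i # l) f = partial_d i (pw l f)"

text \<open>Multisets serve as multi-indices. The order of differentiation picked by
  \<open>SOME\<close> is immaterial on holomorphic functions, by \<open>dm_pw\<close>.\<close>

definition dm :: "'n multiset \<Rightarrow> 'n::finite diffop" where
  "dm M = pw (SOME l. mset l = M)"

text \<open>Functions are total, so their values outside \<open>U\<close> are arbitrary; the second
  clause says that the operator does not see them.\<close>

definition good :: "(complex^'n) set \<Rightarrow> 'n::finite diffop \<Rightarrow> bool" where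
  "good U P \<longleftrightarrow> (\<forall>f. holo_on U f \<longrightarrow> holo_on U (P f)) \<and>
    (\<forall>f g. holo_on U f \<longrightarrow> (\<forall>x\<in>U. f x = g x) \<longrightarrow> (\<forall>x\<in>U. P f x = P g x)) \<and>
    (\<forall>f g. holo_on U f \<longrightarrow> holo_on U g \<longrightarrow> (\<forall>x\<in>U. P (\<lambda>x. f x + g x) x = P f x + P g x)) \<and>
    (\<forall>f c. holo_on U f \<longrightarrow> (\<forall>x\<in>U. P (\<lambda>x. c * f x) x = c * P f x))"

lemma goodD:
  assumes "good U P"
  shows good_holo: "holo_on U f \<Longrightarrow> holo_on U (P f)"
    and good_cong: "holo_on U f \<Longrightarrow> (\<And>x. x \<in> U \<Longrightarrow> f x = g x) \<Longrightarrow> x \<in> U \<Longrightarrow> P f x = P g x"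
    and good_add: "holo_on U f \<Longrightarrow> holo_on U g \<Longrightarrow> x \<in> U \<Longrightarrow> P (\<lambda>x. f x + g x) x = P f x + P g x"
    and good_cmult: "holo_on U f \<Longrightarrow> x \<in> U \<Longrightarrow> P (\<lambda>x. c * f x) x = c * P f x"
proof -
  note a = assms[unfolded good_def]
  show "holo_on U f \<Longrightarrow> holo_on U (P f)" by (rule a[THEN conjunct1, rule_format])
  show "holo_on U f \<Longrightarrow> (\<And>x. x \<in> U \<Longrightarrow> f x = g x) \<Longrightarrow> x \<in> U \<Longrightarrow> P f x = P g x"
    by (rule a[THEN conjunct2, THEN conjunct1, rule_format])
  show "holo_on U f \<Longrightarrow> holo_on U g \<Longrightarrow> x \<in> U \<Longrightarrow> P (\<lambda>x. f x + g x) x = P f x + P g x"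
    by (rule a[THEN conjunct2, THEN conjunct2, THEN conjunct1, rule_format])
  show "holo_on U f \<Longrightarrow> x \<in> U \<Longrightarrow> P (\<lambda>x. c * f x) x = c * P f x"
    by (rule a[THEN conjunct2, THEN conjunct2, THEN conjunct2, rule_format])
qed

context
  fixes U :: "(complex^'n::finite) set"
  assumes U: "open U"
begin

lemma pw_holo: "holo_on U f \<Longrightarrow> holo_on U (pw l f)"
  by (induction l) (auto intro: holo_on_partial_d[OF U])

lemma pw_cong: "(\<And>x. x \<in> U \<Longrightarrow> f x = g x) \<Longrightarrow> x \<in> U \<Longrightarrow> pw l f x = pw l g x"
proof (induction l arbitrary: x)
  case (Cons i l)
  show ?case unfolding pw.simps
    by (rule partial_d_cong[OF U _ Cons.prems(2)]) (use Cons in blast)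
qed simp

lemma pw_shift:
  assumes "holo_on U f"
  shows "x \<in> U \<Longrightarrow> pw l (partial_d i f) x = partial_d i (pw l f) x"
proof (induction l arbitrary: x)
  case (Cons j l)
  have "pw (j # l) (partial_d i f) x = partial_d j (partial_d i (pw l f)) x"
    unfolding pw.simps by (rule partial_d_cong[OF U _ Cons.prems]) (rule Cons.IH)
  also have "\<dots> = partial_d i (partial_d j (pw l f)) x"
    by (rule partial_d_commute[OF U pw_holo[OF assms] Cons.prems])
  finally show ?case by simp
qed simp

lemma pw_append: "pw (k @ l) f = pw k (pw l f)"
  by (induction k) auto

lemma pw_perm:
  assumes f: "holo_on U f"
  shows "mset k = mset l \<Longrightarrow> x \<in> U \<Longrightarrow> pw k f x = pw l f x"
proof (induction k arbitrary: l x)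
  case (Cons i k)
  have "i \<in> set l" using Cons.prems(1) by (metis list.set_intros(1) set_mset_mset)
  then obtain a b where l: "l = a @ i # b" by (meson split_list)
  then have m: "mset k = mset (a @ b)" using Cons.prems(1) by simp
  have "pw (i # k) f x = partial_d i (pw (a @ b) f) x"
    unfolding pw.simps by (rule partial_d_cong[OF U _ Cons.prems(2)]) (rule Cons.IH[OF m])
  also have "\<dots> = pw l f x"
    unfolding l pw_append pw.simps by (rule pw_shift[OF pw_holo[OF f] Cons.prems(2), symmetric])
  finally show ?case .
qed simp

lemma dm_pw: "holo_on U f \<Longrightarrow> x \<in> U \<Longrightarrow> dm (mset l) f x = pw l f x"
  unfolding dm_def by (rule pw_perm) (auto intro: someI[of "\<lambda>k. mset k = mset l"])

lemma dm_holo: "holo_on U f \<Longrightarrow> holo_on U (dm M f)"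
  unfolding dm_def by (rule pw_holo)

lemma dm_empty [simp]: "dm {#} f = f"
  by (simp add: dm_def)

lemma dm_cong: "(\<And>x. x \<in> U \<Longrightarrow> f x = g x) \<Longrightarrow> x \<in> U \<Longrightarrow> dm M f x = dm M g x"
  unfolding dm_def by (rule pw_cong)

lemma dm_add_mset: "holo_on U f \<Longrightarrow> x \<in> U \<Longrightarrow> dm (add_mset i M) f x = partial_d i (dm M f) x"
proof -
  assume *: "holo_on U f" "x \<in> U"
  define l where "l = (SOME l. mset l = M)"
  have l: "mset l = M" unfolding l_def by (rule someI_ex[OF ex_mset])
  have "dm (mset (i # l)) f x = partial_d i (pw l f) x" by (simp only: dm_pw[OF *] pw.simps)
  moreover have "mset (i # l) = add_mset i M" by (simp add: l)
  moreover have "dm M = pw l" by (simp only: dm_def l_def)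
  ultimately show ?thesis by (simp only:)
qed

lemma dm_shift: "holo_on U f \<Longrightarrow> x \<in> U \<Longrightarrow> dm M (partial_d i f) x = partial_d i (dm M f) x"
  unfolding dm_def by (rule pw_shift)

lemma good_compose:
  assumes P: "good U P" and Q: "good U Q"
  shows "good U (P \<circ> Q)"
  unfolding good_def
proof (intro conjI allI impI ballI)
  fix f g x c
  assume f: "holo_on U f"
  show "holo_on U ((P \<circ> Q) f)" using f good_holo[OF P] good_holo[OF Q] by simp
  note Qf = good_holo[OF Q f]
  show "(P \<circ> Q) f x = (P \<circ> Q) g x" if "\<forall>x\<in>U. f x = g x" "x \<in> U"
    unfolding o_apply by (rule good_cong[OF P Qf good_cong[OF Q f]]) (use that in auto)
  show "(P \<circ> Q) (\<lambda>x. f x + g x) x = (P \<circ> Q) f x + (P \<circ> Q) g x" if g: "holo_on U g" and x: "x \<in> U"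
  proof -
    have "P (\<lambda>x. Q f x + Q g x) x = P (Q (\<lambda>x. f x + g x)) x"
      by (rule good_cong[OF P holo_on_add[OF Qf good_holo[OF Q g]] good_add[OF Q f g, symmetric] x])
    then show ?thesis using good_add[OF P Qf good_holo[OF Q g] x] by simp
  qed
  show "(P \<circ> Q) (\<lambda>x. c * f x) x = c * (P \<circ> Q) f x" if x: "x \<in> U"
  proof -
    have "P (\<lambda>x. c * Q f x) x = P (Q (\<lambda>x. c * f x)) x"
      by (rule good_cong[OF P holo_on_cmult[OF Qf] good_cmult[OF Q f, symmetric] x])
    then show ?thesis using good_cmult[OF P Qf x] by simp
  qed
qed

lemma good_plus:
  assumes P: "good U P" and Q: "good U Q"
  shows "good U (\<lambda>f x. P f x + Q f x)"
  unfolding good_def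
proof (intro conjI allI impI ballI)
  fix f g x c
  assume f: "holo_on U f"
  show "holo_on U (\<lambda>x. P f x + Q f x)" by (intro holo_on_add good_holo[OF P] good_holo[OF Q] f)
  show "P f x + Q f x = P g x + Q g x" if "\<forall>x\<in>U. f x = g x" "x \<in> U"
    using good_cong[OF P f, of g x] good_cong[OF Q f, of g x] that by simp
  show "P (\<lambda>x. f x + g x) x + Q (\<lambda>x. f x + g x) x = P f x + Q f x + (P g x + Q g x)"
    if "holo_on U g" "x \<in> U"
    using good_add[OF P f that] good_add[OF Q f that] by simp
  show "P (\<lambda>x. c * f x) x + Q (\<lambda>x. c * f x) x = c * (P f x + Q f x)" if "x \<in> U"
    using good_cmult[OF P f that] good_cmult[OF Q f that] by (simp add: distrib_left)
qed

lemma good_mult_op: "holo_on U a \<Longrightarrow> good U (mult_op a)"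
  unfolding good_def mult_op_def by (auto intro: holo_on_mult simp: algebra_simps)

lemma good_partial_d: "good U (partial_d i)"
  unfolding good_def
  by (auto intro: holo_on_partial_d[OF U] partial_d_cong[OF U] partial_d_add partial_d_cmult)

lemma good_op_scale: "good U P \<Longrightarrow> good U (op_scale c P)"
proof -
  assume "good U P"
  from good_compose[OF good_mult_op[OF holo_on_const] this, of c]
  show ?thesis by (simp add: op_scale_def[abs_def] mult_op_def[abs_def] comp_def)
qed

lemma good_op_eq: "good U P \<Longrightarrow> op_eq U P Q \<Longrightarrow> good U Q"
proof -
  assume P: "good U P" and PQ: "op_eq U P Q"
  have e: "P f x = Q f x" if "holo_on U f" "x \<in> U" for f x using PQ that by (auto simp: op_eq_def)
  show "good U Q" unfolding good_def
  proof (intro conjI allI impI ballI)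
    fix f g x c
    assume f: "holo_on U f"
    show "holo_on U (Q f)" by (rule holo_on_cong[OF U e[OF f] good_holo[OF P f]])
    show "Q f x = Q g x" if "\<forall>x\<in>U. f x = g x" "x \<in> U"
    proof -
      have "holo_on U g" by (rule holo_on_cong[OF U _ f]) (use that in auto)
      then show ?thesis using good_cong[OF P f, of g x] e[OF f] e[of g] that by auto
    qed
    show "Q (\<lambda>x. f x + g x) x = Q f x + Q g x" if "holo_on U g" "x \<in> U"
      using good_add[OF P f that] e[OF f that(2)] e[OF that] e[OF holo_on_add[OF f that(1)] that(2)] by simp
    show "Q (\<lambda>x. c * f x) x = c * Q f x" if "x \<in> U"
      using good_cmult[OF P f that] e[OF f that] e[OF holo_on_cmult[OF f] that] by simp
  qed
qed

lemma formal_adjoint_good: "formal_adjoint U P T \<Longrightarrow> good U P \<and> good U T"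
proof (induction rule: formal_adjoint.induct)
  case (mult a)
  then show ?case by (simp add: good_mult_op)
next
  case (partial i)
  show ?case by (simp add: good_partial_d good_op_scale)
next
  case (add P P' Q Q')
  then show ?case by (simp add: good_plus)
next
  case (comp P P' Q Q')
  then show ?case using good_compose by blast
next
  case (cong P P' Q Q')
  then show ?case using good_op_eq by blast
qed

lemma good_pw: "good U (pw l)"
proof (induction l)
  case Nil
  have "(\<lambda>f. f) = pw []" by (simp add: fun_eq_iff)
  then show ?case by (auto simp: good_def)
next
  case (Cons i l)
  have "pw (i # l) = partial_d i \<circ> pw l" by (simp add: fun_eq_iff)
  then show ?case using good_compose[OF good_partial_d[of i] Cons] by (simp only:)
qed

lemma good_dm: "good U (dm M)"
  unfolding dm_def by (rule good_pw)

lemma dm_zero: "x \<in> U \<Longrightarrow> (\<And>x. x \<in> U \<Longrightarrow> f x = 0) \<Longrightarrow> dm M f x = 0"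
proof -
  assume "x \<in> U" "\<And>x. x \<in> U \<Longrightarrow> f x = 0"
  then have "dm M f x = dm M (\<lambda>x. 0 * 0) x" by (intro dm_cong) auto
  also have "\<dots> = 0 * dm M (\<lambda>x. 0) x"
    by (rule good_cmult[OF good_dm holo_on_const \<open>x \<in> U\<close>])
  finally show ?thesis by simp
qed

text \<open>Pairs of an operator in normal form and the adjoint computed term by term from its
  coefficients. The relation \<open>formal_adjoint\<close> follows how an operator was built, and
  this could depend on the construction; here the second component depends only on the
  coefficients.\<close>

inductive nfp :: "'n diffop \<Rightarrow> 'n diffop \<Rightarrow> bool" where
  single: "holo_on U a \<Longrightarrow> nfp (\<lambda>f x. a x * dm M f x) (\<lambda>f x. (- 1) ^ size M * dm M (\<lambda>y. a y * f y) x)"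
| add: "nfp P T \<Longrightarrow> nfp Q S \<Longrightarrow> nfp (\<lambda>f x. P f x + Q f x) (\<lambda>f x. T f x + S f x)"
| cong: "nfp P T \<Longrightarrow> op_eq U P Q \<Longrightarrow> op_eq U T S \<Longrightarrow> nfp Q S"

lemma nfp_good: "nfp P T \<Longrightarrow> good U P \<and> good U T"
proof (induction rule: nfp.induct)
  case (single a M)
  have "(\<lambda>f x. a x * dm M f x) = mult_op a \<circ> dm M"
    "(\<lambda>f x. (- 1) ^ size M * dm M (\<lambda>y. a y * f y) x) = op_scale ((- 1) ^ size M) (dm M \<circ> mult_op a)"
    by (simp_all add: fun_eq_iff mult_op_def[abs_def] op_scale_def)
  then show ?case
    using good_compose[OF good_mult_op[OF single] good_dm]
      good_op_scale[OF good_compose[OF good_dm good_mult_op[OF single]]] by simp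
next
  case (add P T Q S)
  then show ?case by (simp add: good_plus)
next
  case (cong P T Q S)
  then show ?case using good_op_eq by blast
qed

lemma op_eqI: "(\<And>f x. holo_on U f \<Longrightarrow> x \<in> U \<Longrightarrow> P f x = Q f x) \<Longrightarrow> op_eq U P Q"
  by (auto simp: op_eq_def)

lemma op_eqD: "op_eq U P Q \<Longrightarrow> holo_on U f \<Longrightarrow> x \<in> U \<Longrightarrow> P f x = Q f x"
  by (auto simp: op_eq_def)

lemma nfp_mult:
  assumes "holo_on U b" "nfp P T"
  shows "nfp (mult_op b \<circ> P) (T \<circ> mult_op b)"
  using assms(2)
proof (induction rule: nfp.induct)
  case (single a M)
  show ?case
    by (rule nfp.cong[OF nfp.single[OF holo_on_mult[OF assms(1) single], of M]])
      (auto intro!: op_eqI simp: mult_op_def mult.assoc mult.left_commute)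
next
  case (add P T Q S)
  show ?case
    by (rule nfp.cong[OF nfp.add[OF add.IH]]) (auto intro!: op_eqI simp: mult_op_def distrib_left)
next
  case (cong P T Q S)
  show ?case
  proof (rule nfp.cong[OF cong.IH]; rule op_eqI)
    fix f x assume f: "holo_on U f" "x \<in> U"
    show "(mult_op b \<circ> P) f x = (mult_op b \<circ> Q) f x"
      using op_eqD[OF cong.hyps(2) f] by (simp add: mult_op_def)
    show "(T \<circ> mult_op b) f x = (S \<circ> mult_op b) f x"
      using op_eqD[OF cong.hyps(3) _ f(2), of "mult_op b f"] good_holo[OF good_mult_op[OF assms(1)] f(1)] by simp
  qed
qed

text \<open>The product rule splits the derivative of a single term into two normal forms; the same
  rule, applied to the product of coefficient and function, recombines the two adjoints.\<close>

lemma nfp_partial: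
  assumes "nfp P T"
  shows "nfp (partial_d i \<circ> P) (\<lambda>f x. - T (partial_d i f) x)"
  using assms
proof (induction rule: nfp.induct)
  case (single a M)
  show ?case
  proof (rule nfp.cong[OF nfp.add[OF nfp.single[OF holo_on_partial_d[OF U single, of i], of M]
            nfp.single[OF single, of "add_mset i M"]]]; rule op_eqI)
    fix f x assume f: "holo_on U f" and x: "x \<in> U"
    have af: "holo_on U (\<lambda>y. a y * f y)" by (rule holo_on_mult[OF single f])
    have h1: "holo_on U (\<lambda>y. partial_d i a y * f y)" "holo_on U (\<lambda>y. a y * partial_d i f y)"
      by (intro holo_on_mult holo_on_partial_d[OF U] single f)+
    show "partial_d i a x * dm M f x + a x * dm (add_mset i M) f x = (partial_d i \<circ> (\<lambda>f x. a x * dm M f x)) f x"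
      unfolding o_apply dm_add_mset[OF f x]
      by (rule partial_d_mult[OF single dm_holo[OF f] x, symmetric])
    have "dm (add_mset i M) (\<lambda>y. a y * f y) x = dm M (partial_d i (\<lambda>y. a y * f y)) x"
      using dm_add_mset[OF af x] dm_shift[OF af x] by simp
    also have "\<dots> = dm M (\<lambda>y. partial_d i a y * f y + a y * partial_d i f y) x"
      by (rule dm_cong[OF partial_d_mult[OF single f] x])
    also have "\<dots> = dm M (\<lambda>y. partial_d i a y * f y) x + dm M (\<lambda>y. a y * partial_d i f y) x"
      by (rule good_add[OF good_dm h1 x])
    finally show "(- 1) ^ size M * dm M (\<lambda>y. partial_d i a y * f y) x +
        (- 1) ^ size (add_mset i M) * dm (add_mset i M) (\<lambda>y. a y * f y) x =
        - ((- 1) ^ size M * dm M (\<lambda>y. a y * partial_d i f y) x)"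
      by (simp add: algebra_simps)
  qed
next
  case (add P T Q S)
  have "good U P" "good U Q" using nfp_good add.hyps by auto
  then show ?case
    by (intro nfp.cong[OF nfp.add[OF add.IH]] op_eqI) (auto intro!: partial_d_add[symmetric] simp: good_holo)
next
  case (cong P T Q S)
  show ?case
  proof (rule nfp.cong[OF cong.IH]; rule op_eqI)
    fix f x assume f: "holo_on U f" "x \<in> U"
    show "(partial_d i \<circ> P) f x = (partial_d i \<circ> Q) f x"
      unfolding o_apply by (rule partial_d_cong[OF U op_eqD[OF cong.hyps(2) f(1)] f(2)])
    show "- T (partial_d i f) x = - S (partial_d i f) x"
      using op_eqD[OF cong.hyps(3) holo_on_partial_d[OF U f(1)] f(2)] by simp
  qed
qed

lemma nfp_pw:
  assumes "nfp P T"
  shows "nfp (pw l \<circ> P) (\<lambda>f x. (- 1) ^ length l * T (pw l f) x)"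
proof (induction l)
  case Nil
  show ?case by (rule nfp.cong[OF assms]) (auto intro: op_eqI)
next
  case (Cons i l)
  have T: "good U T" using nfp_good[OF assms] by blast
  show ?case
  proof (rule nfp.cong[OF nfp_partial[OF Cons, of i]]; rule op_eqI)
    fix f x assume f: "holo_on U f" and x: "x \<in> U"
    show "(partial_d i \<circ> (pw l \<circ> P)) f x = (pw (i # l) \<circ> P) f x" by simp
    have "T (pw l (partial_d i f)) x = T (pw (i # l) f) x"
      by (rule good_cong[OF T pw_holo[OF holo_on_partial_d[OF U f]] _ x])
        (simp add: pw_shift[OF f])
    then show "- ((- 1) ^ length l * T (pw l (partial_d i f)) x) =
        (- 1) ^ length (i # l) * T (pw (i # l) f) x" by simp
  qed
qed

text \<open>By induction on the left factor, since products with a function and with partial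
  derivatives on the left are already normalised.\<close>

lemma nfp_compose:
  assumes "nfp P T" and Q: "nfp Q S"
  shows "nfp (P \<circ> Q) (S \<circ> T)"
  using assms(1)
proof (induction rule: nfp.induct)
  case (single a M)
  obtain l where l: "dm M = pw l" "size M = length l"
    unfolding dm_def by (metis (mono_tags) ex_mset size_mset someI_ex)
  have S: "good U S" using nfp_good[OF Q] by blast
  show ?case
  proof (rule nfp.cong[OF nfp_mult[OF single nfp_pw[OF Q, of l]]]; rule op_eqI)
    fix f x assume f: "holo_on U f" and x: "x \<in> U"
    show "(mult_op a \<circ> (pw l \<circ> Q)) f x = ((\<lambda>f x. a x * dm M f x) \<circ> Q) f x"
      by (simp add: mult_op_def l)
    have "holo_on U (pw l (\<lambda>y. a y * f y))" by (intro pw_holo holo_on_mult single f)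
    from good_cmult[OF S this x]
    show "((\<lambda>f x. (- 1) ^ length l * S (pw l f) x) \<circ> mult_op a) f x =
        (S \<circ> (\<lambda>f x. (- 1) ^ size M * dm M (\<lambda>y. a y * f y) x)) f x"
      by (simp add: mult_op_def[abs_def] l)
  qed
next
  case (add P T Q' S')
  have S: "good U S" using nfp_good[OF Q] by blast
  show ?case
  proof (rule nfp.cong[OF nfp.add[OF add.IH]]; rule op_eqI)
    fix f x assume f: "holo_on U f" and x: "x \<in> U"
    have "holo_on U (T f)" "holo_on U (S' f)" using nfp_good add.hyps good_holo f by blast+
    from good_add[OF S this x]
    show "(S \<circ> T) f x + (S \<circ> S') f x = (S \<circ> (\<lambda>f x. T f x + S' f x)) f x" by simp
  qed simp
next
  case (cong P T P' T')
  have S: "good U S" and "good U Q" and T: "good U T" using nfp_good Q cong.hyps by blast+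
  show ?case
  proof (rule nfp.cong[OF cong.IH]; rule op_eqI)
    fix f x assume f: "holo_on U f" and x: "x \<in> U"
    show "(P \<circ> Q) f x = (P' \<circ> Q) f x"
      using op_eqD[OF cong.hyps(2) good_holo[OF \<open>good U Q\<close> f] x] by simp
    show "(S \<circ> T) f x = (S \<circ> T') f x"
      unfolding o_apply by (rule good_cong[OF S good_holo[OF T f] op_eqD[OF cong.hyps(3) f] x])
  qed
qed

lemma formal_adjoint_nfp: "formal_adjoint U P T \<Longrightarrow> nfp P T"
proof (induction rule: formal_adjoint.induct)
  case (mult a)
  show ?case
    by (rule nfp.cong[OF nfp.single[OF mult, of "{#}"]]) (auto intro!: op_eqI simp: mult_op_def)
next
  case (partial i)
  have "nfp (\<lambda>f x. f x) (\<lambda>f x. f x)"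
    by (rule nfp.cong[OF nfp.single[OF holo_on_const[of U 1], of "{#}"]]) (auto intro!: op_eqI)
  from nfp_partial[OF this, of i] show ?case
    by (rule nfp.cong) (auto intro!: op_eqI simp: op_scale_def)
next
  case (add P P' Q Q')
  show ?case by (rule nfp.add[OF add.IH])
next
  case (comp P P' Q Q')
  show ?case by (rule nfp_compose[OF comp.IH])
next
  case (cong P P' Q Q')
  show ?case by (rule nfp.cong[OF cong.IH cong.hyps(2,3)])
qed

section \<open>Uniqueness of coefficients and of adjoints\<close>

definition nfc :: "'n diffop \<Rightarrow> 'n diffop \<Rightarrow> 'n multiset set \<Rightarrow> ('n multiset \<Rightarrow> complex^'n \<Rightarrow> complex) \<Rightarrow> bool" where
  "nfc P T B a \<longleftrightarrow> finite B \<and> (\<forall>M. holo_on U (a M)) \<and> (\<forall>M x. M \<notin> B \<longrightarrow> a M x = 0) \<and>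
    (\<forall>f x. holo_on U f \<longrightarrow> x \<in> U \<longrightarrow> P f x = (\<Sum>M\<in>B. a M x * dm M f x)) \<and>
    (\<forall>f x. holo_on U f \<longrightarrow> x \<in> U \<longrightarrow>
      T f x = (\<Sum>M\<in>B. (- 1) ^ size M * dm M (\<lambda>y. a M y * f y) x))"

lemma nfcD:
  assumes "nfc P T B a"
  shows "finite B" "holo_on U (a M)" "M \<notin> B \<Longrightarrow> a M x = 0"
    "holo_on U f \<Longrightarrow> x \<in> U \<Longrightarrow> P f x = (\<Sum>M\<in>B. a M x * dm M f x)"
    "holo_on U f \<Longrightarrow> x \<in> U \<Longrightarrow> T f x = (\<Sum>M\<in>B. (- 1) ^ size M * dm M (\<lambda>y. a M y * f y) x)"
  using assms unfolding nfc_def by simp_all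

lemma nfp_coefficients: "nfp P T \<Longrightarrow> \<exists>B a. nfc P T B a"
proof (induction rule: nfp.induct)
  case (single a M)
  have h: "holo_on U (\<lambda>x. if N = M then a x else 0)" for N
    by (cases "N = M") (use single in auto)
  have "nfc (\<lambda>f x. a x * dm M f x) (\<lambda>f x. (- 1) ^ size M * dm M (\<lambda>y. a y * f y) x)
      {M} (\<lambda>N x. if N = M then a x else 0)"
    unfolding nfc_def by (simp add: h)
  then show ?case by blast
next
  case (add P T Q S)
  obtain B a where "nfc P T B a" using add.IH(1) by blast
  note B = nfcD[OF this]
  obtain C b where "nfc Q S C b" using add.IH(2) by blast
  note C = nfcD[OF this]
  have ext: "(\<Sum>M\<in>D. c M x * dm M f x) = (\<Sum>M\<in>B \<union> C. c M x * dm M f x)"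
    "(\<Sum>M\<in>D. (- 1) ^ size M * dm M (\<lambda>y. c M y * f y) x) =
      (\<Sum>M\<in>B \<union> C. (- 1) ^ size M * dm M (\<lambda>y. c M y * f y) x)"
    if "D \<subseteq> B \<union> C" "\<And>M x. M \<notin> D \<Longrightarrow> c M x = 0" "x \<in> U" for c D f x
    using that B(1) C(1) by (intro sum.mono_neutral_left; auto intro!: dm_zero)+
  have "nfc (\<lambda>f x. P f x + Q f x) (\<lambda>f x. T f x + S f x) (B \<union> C) (\<lambda>M x. a M x + b M x)"
    unfolding nfc_def
  proof (intro conjI allI impI)
    fix f x assume f: "holo_on U f" and x: "x \<in> U"
    have e1: "(\<Sum>M\<in>B. a M x * dm M f x) = (\<Sum>M\<in>B \<union> C. a M x * dm M f x)"
      "(\<Sum>M\<in>B. (- 1) ^ size M * dm M (\<lambda>y. a M y * f y) x) =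
        (\<Sum>M\<in>B \<union> C. (- 1) ^ size M * dm M (\<lambda>y. a M y * f y) x)"
      by (rule ext; use B(3) x in simp)+
    have e2: "(\<Sum>M\<in>C. b M x * dm M f x) = (\<Sum>M\<in>B \<union> C. b M x * dm M f x)"
      "(\<Sum>M\<in>C. (- 1) ^ size M * dm M (\<lambda>y. b M y * f y) x) =
        (\<Sum>M\<in>B \<union> C. (- 1) ^ size M * dm M (\<lambda>y. b M y * f y) x)"
      by (rule ext; use C(3) x in simp)+
    show "P f x + Q f x = (\<Sum>M\<in>B \<union> C. (a M x + b M x) * dm M f x)"
      unfolding B(4)[OF f x] C(4)[OF f x] e1 e2
      by (simp add: distrib_right sum.distrib)
    have "dm M (\<lambda>y. (a M y + b M y) * f y) x = dm M (\<lambda>y. a M y * f y) x + dm M (\<lambda>y. b M y * f y) x" for M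
      unfolding distrib_right by (rule good_add[OF good_dm holo_on_mult[OF B(2) f] holo_on_mult[OF C(2) f] x])
    then show "T f x + S f x = (\<Sum>M\<in>B \<union> C. (- 1) ^ size M * dm M (\<lambda>y. (a M y + b M y) * f y) x)"
      unfolding B(5)[OF f x] C(5)[OF f x] e1 e2
      by (simp add: distrib_left sum.distrib)
  qed (simp_all add: B(1-3) C(1-3) holo_on_add)
  then show ?case by blast
next
  case (cong P T Q S)
  then obtain B a where "nfc P T B a" by blast
  then have "nfc Q S B a" unfolding nfc_def
    using op_eqD[OF cong.hyps(2), symmetric] op_eqD[OF cong.hyps(3), symmetric] by simp
  then show ?case by blast
qed

definition shifted_mono :: "complex^'n \<Rightarrow> 'n multiset \<Rightarrow> complex^'n \<Rightarrow> complex" where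
  "shifted_mono x0 M y = (\<Prod>i\<in>#M. y $ i - x0 $ i)"

lemma mono_poly: "poly_fun (shifted_mono x0 M)"
proof (induction M)
  case empty
  show ?case by (simp add: shifted_mono_def[abs_def] poly_fun.const)
next
  case (add i M)
  have "poly_fun (\<lambda>y. (y $ i + (- x0 $ i)) * shifted_mono x0 M y)"
    by (intro poly_fun.mult poly_fun.add poly_fun.coord poly_fun.const add)
  then show ?case by (simp add: shifted_mono_def[abs_def])
qed

lemma mono_holo: "holo_on U (shifted_mono x0 M)"
  by (rule poly_fun_holo[OF mono_poly])

lemma mono_add: "shifted_mono x0 (add_mset i M) = (\<lambda>y. (y $ i - x0 $ i) * shifted_mono x0 M y)"
  by (simp add: shifted_mono_def fun_eq_iff)

lemma partial_mono:
  assumes "y \<in> U"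
  shows "partial_d j (shifted_mono x0 M) y = of_nat (count M j) * shifted_mono x0 (M - {#j#}) y"
proof (induction M)
  case empty
  show ?case by (simp add: shifted_mono_def[abs_def])
next
  case (add i M)
  have lin: "holo_on U (\<lambda>y. y $ i - x0 $ i)" by (rule holo_on_diff[OF holo_on_coord holo_on_const])
  have dlin: "partial_d j (\<lambda>y. y $ i - x0 $ i) y = (if j = i then 1 else 0)"
    using partial_d_diff[OF holo_on_coord holo_on_const assms, of j i "x0 $ i"] by (simp add: partial_d_coord)
  have d: "partial_d j (shifted_mono x0 (add_mset i M)) y =
      (if j = i then 1 else 0) * shifted_mono x0 M y + (y $ i - x0 $ i) * (of_nat (count M j) * shifted_mono x0 (M - {#j#}) y)"
    unfolding mono_add partial_d_mult[OF lin mono_holo assms] dlin add.IH ..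
  show ?case
  proof (cases "j = i")
    case True
    show ?thesis
    proof (cases "j \<in># M")
      case in_M: True
      then have m: "shifted_mono x0 M y = (y $ j - x0 $ j) * shifted_mono x0 (M - {#j#}) y"
        using mono_add[of x0 j "M - {#j#}"] by simp
      have "(y $ i - x0 $ i) * (of_nat (count M j) * shifted_mono x0 (M - {#j#}) y) = of_nat (count M j) * shifted_mono x0 M y"
        unfolding m using True by (simp add: mult.left_commute)
      then show ?thesis unfolding d using True by (simp add: algebra_simps)
    next
      case False
      then show ?thesis unfolding d using True by (simp add: not_in_iff)
    qed
  next
    case False
    then have "add_mset i M - {#j#} = add_mset i (M - {#j#})" by (simp add: diff_add_mset_swap)
    then show ?thesis unfolding d using False by (simp add: mono_add)
  qed
qed

text \<open>The constant \<open>c\<close> is a product of falling factorials; only whether it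
  vanishes matters.\<close>

lemma dm_mono:
  "\<exists>c. (\<forall>y\<in>U. dm M' (shifted_mono x0 M) y = c * shifted_mono x0 (M - M') y) \<and> (c \<noteq> 0 \<longleftrightarrow> M' \<subseteq># M)"
proof (induction M')
  case empty
  show ?case by (rule exI[of _ 1]) simp
next
  case (add i M')
  then obtain c where c: "\<And>y. y \<in> U \<Longrightarrow> dm M' (shifted_mono x0 M) y = c * shifted_mono x0 (M - M') y" "c \<noteq> 0 \<longleftrightarrow> M' \<subseteq># M"
    by blast
  have 1: "\<forall>y\<in>U. dm (add_mset i M') (shifted_mono x0 M) y = (c * of_nat (count (M - M') i)) * shifted_mono x0 (M - add_mset i M') y"
  proof
    fix y assume y: "y \<in> U"
    have "dm (add_mset i M') (shifted_mono x0 M) y = partial_d i (\<lambda>y. c * shifted_mono x0 (M - M') y) y"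
      unfolding dm_add_mset[OF mono_holo y] by (rule partial_d_cong[OF U c(1) y])
    also have "\<dots> = c * (of_nat (count (M - M') i) * shifted_mono x0 (M - M' - {#i#}) y)"
      unfolding partial_d_cmult[OF mono_holo y] partial_mono[OF y] ..
    finally show "dm (add_mset i M') (shifted_mono x0 M) y = (c * of_nat (count (M - M') i)) * shifted_mono x0 (M - add_mset i M') y"
      by (simp add: mult.assoc)
  qed
  have 2: "c * of_nat (count (M - M') i) \<noteq> 0 \<longleftrightarrow> add_mset i M' \<subseteq># M"
  proof (cases "M' \<subseteq># M")
    case True
    have "add_mset i M' \<subseteq># M \<longleftrightarrow> {#i#} \<subseteq># M - M'"
      using subset_mset.le_diff_conv2[OF True, of "{#i#}"] by simp
    also have "\<dots> \<longleftrightarrow> count (M - M') i \<noteq> 0"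
      by (simp only: single_subset_iff count_eq_zero_iff not_not)
    finally have "add_mset i M' \<subseteq># M \<longleftrightarrow> count (M - M') i \<noteq> 0" .
    moreover have "c \<noteq> 0" using True c(2) by (rule iffD2[rotated])
    ultimately show ?thesis by (simp only: mult_eq_0_iff of_nat_eq_0_iff simp_thms)
  next
    case False
    then have "\<not> add_mset i M' \<subseteq># M" by (metis mset_subset_eq_insertD subset_mset.less_imp_le)
    moreover have "c = 0" using False c(2) by (metis c(2))
    ultimately show ?thesis by (simp only: mult_zero_left simp_thms)
  qed
  show ?case by (rule exI, rule conjI, rule 1, rule 2)
qed

lemma mono_at: "M \<noteq> {#} \<Longrightarrow> shifted_mono x0 M x0 = 0"
  by (induction M) (auto simp: shifted_mono_def)

text \<open>At \<open>x0\<close> every derivative of the monomial \<open>M\<close> centred there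
  vanishes except the derivative with index \<open>M\<close>. Applying \<open>P\<close> to these
  monomials therefore reads off its coefficients one at a time.\<close>

lemma nfp_zero:
  assumes "nfp P T" and zero: "\<And>p x. poly_fun p \<Longrightarrow> x \<in> U \<Longrightarrow> P p x = 0"
    and f: "holo_on U f" and x: "x \<in> U"
  shows "P f x = 0" "T f x = 0"
proof -
  obtain B a where "nfc P T B a" using nfp_coefficients[OF assms(1)] by blast
  note B = nfcD[OF this]
  have a0: "a M x0 = 0" if x0: "x0 \<in> U" for M x0
  proof (cases "M \<in> B")
    case True
    have off: "dm M' (shifted_mono x0 M) x0 = 0" if "M' \<noteq> M" for M'
    proof -
      obtain c where c: "\<forall>y\<in>U. dm M' (shifted_mono x0 M) y = c * shifted_mono x0 (M - M') y" "c \<noteq> 0 \<longleftrightarrow> M' \<subseteq># M"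
        using dm_mono by blast
      have "c = 0 \<or> M - M' \<noteq> {#}" using c(2) that by (auto simp: Diff_eq_empty_iff_mset subset_mset.antisym)
      then show ?thesis using c(1) x0 mono_at by auto
    qed
    obtain c where c: "\<forall>y\<in>U. dm M (shifted_mono x0 M) y = c * shifted_mono x0 (M - M) y" "c \<noteq> 0" using dm_mono by blast
    have "0 = (\<Sum>M'\<in>B. a M' x0 * dm M' (shifted_mono x0 M) x0)"
      using B(4)[OF mono_holo x0, of x0 M] zero[OF mono_poly x0] by simp
    also have "\<dots> = (\<Sum>M'\<in>{M}. a M' x0 * dm M' (shifted_mono x0 M) x0)"
      by (rule sum.mono_neutral_right) (use B True off in auto)
    also have "\<dots> = a M x0 * c" using c x0 by (simp add: shifted_mono_def)
    finally show ?thesis using c(2) by simp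
  qed (use B in simp)
  show "P f x = 0" using B(4)[OF f x] a0[OF x] by simp
  show "T f x = 0" unfolding B(5)[OF f x] by (intro sum.neutral ballI) (simp add: dm_zero[OF x] a0)
qed

theorem formal_adjoint_determined:
  assumes P: "formal_adjoint U P T" and Q: "formal_adjoint U Q S"
    and eq: "\<And>p x. poly_fun p \<Longrightarrow> x \<in> U \<Longrightarrow> P p x = Q p x"
  shows "op_eq U P Q" "op_eq U T S"
proof -
  have S: "good U S" using formal_adjoint_good[OF Q] by blast
  \<comment> \<open>The difference is written with the constant multiplier -1 composed with
    \<open>Q\<close>, so that the difference of the adjoints is produced along with it.\<close>
  note n = nfp.add[OF formal_adjoint_nfp[OF P] nfp_mult[OF holo_on_const[of U "- 1"] formal_adjoint_nfp[OF Q]]]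
  have z: "P f x + (mult_op (\<lambda>x. - 1) \<circ> Q) f x = 0" "T f x + (S \<circ> mult_op (\<lambda>x. - 1)) f x = 0"
    if "holo_on U f" "x \<in> U" for f x
    by (rule nfp_zero[OF n _ that]; simp add: mult_op_def eq)+
  show "op_eq U P Q"
    by (rule op_eqI) (use z(1) in \<open>fastforce simp: mult_op_def\<close>)
  show "op_eq U T S"
  proof (rule op_eqI)
    fix f x assume f: "holo_on U f" "x \<in> U"
    have "(S \<circ> mult_op (\<lambda>x. - 1)) f x = - S f x"
      using good_cmult[OF S f, of "- 1"] by (simp add: mult_op_def[abs_def])
    then show "T f x = S f x" using z(2)[OF f] by simp
  qed
qed

end

subsection \<open>Realising rational functions on open sets\<close>

text \<open>The denominator has no zero on all of \<open>U\<close>, so the function never takes a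
  value produced by division by zero.\<close>

definition rel :: "(complex^'n) set \<Rightarrow> (complex^'n \<Rightarrow> complex) \<Rightarrow> 'n::finite rfun \<Rightarrow> bool" where
  "rel U f \<phi> \<longleftrightarrow> (\<exists>a b. \<phi> = emb a / emb b \<and> b \<noteq> 0 \<and> (\<forall>x\<in>U. ev b x \<noteq> 0 \<and> f x = ev a x / ev b x))"

lemma relE:
  assumes "rel U f \<phi>"
  obtains a b where "\<phi> = emb a / emb b" "b \<noteq> 0" "\<And>x. x \<in> U \<Longrightarrow> ev b x \<noteq> 0" "\<And>x. x \<in> U \<Longrightarrow> f x = ev a x / ev b x"
  using assms unfolding rel_def by metis

lemma relI:
  assumes "\<phi> = emb a / emb b" "b \<noteq> 0" "\<And>x. x \<in> U \<Longrightarrow> ev b x \<noteq> 0" "\<And>x. x \<in> U \<Longrightarrow> f x = ev a x / ev b x"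
  shows "rel U f \<phi>"
  using assms unfolding rel_def by metis

lemma rel_cong: "rel U f \<phi> \<Longrightarrow> (\<And>x. x \<in> U \<Longrightarrow> f x = g x) \<Longrightarrow> rel U g \<phi>"
  by (erule relE, rule relI) auto

lemma rel_subset: "rel U f \<phi> \<Longrightarrow> V \<subseteq> U \<Longrightarrow> rel V f \<phi>"
  by (erule relE, rule relI) auto

lemma rel_emb: "rel U (ev p) (emb p)"
  by (rule relI[of _ p 1]) (auto simp: emb_hom)

lemma rel_const: "rel U (\<lambda>x. c) (cst c)"
  by (rule rel_cong[OF rel_emb]) simp

lemma rel_add: "rel U f \<phi> \<Longrightarrow> rel U g \<psi> \<Longrightarrow> rel U (\<lambda>x. f x + g x) (\<phi> + \<psi>)"
proof (elim relE)
  fix a b c d assume *: "\<phi> = emb a / emb b" "b \<noteq> 0" "\<And>x. x \<in> U \<Longrightarrow> ev b x \<noteq> 0" "\<And>x. x \<in> U \<Longrightarrow> f x = ev a x / ev b x"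
    "\<psi> = emb c / emb d" "d \<noteq> 0" "\<And>x. x \<in> U \<Longrightarrow> ev d x \<noteq> 0" "\<And>x. x \<in> U \<Longrightarrow> g x = ev c x / ev d x"
  then show ?thesis
    by (intro relI[of _ "a * d + c * b" "b * d"]) (simp_all add: emb_hom add_frac_eq)
qed

lemma rel_mult: "rel U f \<phi> \<Longrightarrow> rel U g \<psi> \<Longrightarrow> rel U (\<lambda>x. f x * g x) (\<phi> * \<psi>)"
proof (elim relE)
  fix a b c d assume *: "\<phi> = emb a / emb b" "b \<noteq> 0" "\<And>x. x \<in> U \<Longrightarrow> ev b x \<noteq> 0" "\<And>x. x \<in> U \<Longrightarrow> f x = ev a x / ev b x"
    "\<psi> = emb c / emb d" "d \<noteq> 0" "\<And>x. x \<in> U \<Longrightarrow> ev d x \<noteq> 0" "\<And>x. x \<in> U \<Longrightarrow> g x = ev c x / ev d x"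
  then show ?thesis
    by (intro relI[of _ "a * c" "b * d"]) (simp_all add: emb_hom)
qed

lemma rel_minus: "rel U f \<phi> \<Longrightarrow> rel U (\<lambda>x. - f x) (- \<phi>)"
  using rel_mult[OF rel_const[of U "- 1"]] by (simp add: pcst_hom emb_hom)

lemma rel_diff: "rel U f \<phi> \<Longrightarrow> rel U g \<psi> \<Longrightarrow> rel U (\<lambda>x. f x - g x) (\<phi> - \<psi>)"
  using rel_add[OF _ rel_minus] by force

lemma rel_sum: "(\<And>i. i \<in> I \<Longrightarrow> rel U (f i) (\<phi> i)) \<Longrightarrow> rel U (\<lambda>x. \<Sum>i\<in>I. f i x) (\<Sum>i\<in>I. \<phi> i)"
proof (induction I rule: infinite_finite_induct)
  case (insert i I)
  then show ?case using rel_add[of U "f i" "\<phi> i"] by simp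
qed (use rel_const[of _ 0] in \<open>simp_all add: pcst_hom emb_hom\<close>)

lemma rel_zero: "rel U f 0 \<Longrightarrow> x \<in> U \<Longrightarrow> f x = 0"
  by (erule relE) auto

lemma rel_holo: "rel U f \<phi> \<Longrightarrow> open U \<Longrightarrow> holo_on U f"
proof (elim relE)
  fix a b assume *: "b \<noteq> 0" "\<And>x. x \<in> U \<Longrightarrow> ev b x \<noteq> 0" "\<And>x. x \<in> U \<Longrightarrow> f x = ev a x / ev b x" and U: "open U"
  have "holo_on U (\<lambda>x. ev a x * inverse (ev b x))"
    using * by (intro holo_on_mult holo_on_inverse poly_fun_holo poly_fun_ev)
  then show ?thesis by (rule holo_on_cong[OF U, rotated]) (use * in \<open>simp add: divide_inverse\<close>)
qed

lemma rel_partial_d: "rel U f \<phi> \<Longrightarrow> open U \<Longrightarrow> rel U (partial_d i f) (pdf (axis i 1) \<phi>)"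
proof (elim relE)
  fix a b assume \<phi>: "\<phi> = emb a / emb b" and b: "b \<noteq> 0" and nz: "\<And>x. x \<in> U \<Longrightarrow> ev b x \<noteq> 0"
    and f: "\<And>x. x \<in> U \<Longrightarrow> f x = ev a x / ev b x" and U: "open U"
  have "partial_d i f x = ev (pd (axis i 1) a * b - a * pd (axis i 1) b) x / ev (b * b) x" if x: "x \<in> U" for x
  proof -
    have ax: "z *s axis i 1 = axis i z" for z :: complex using axis_scale[of i z 1] by simp
    have e: "((\<lambda>z. ev p (x + axis i z)) has_field_derivative ev (pd (axis i 1) p) x) (at 0)" for p
      using ev_pd[of p x "axis i 1"] by (simp only: ax)
    have 0: "x + axis i 0 = x" by (simp add: vec_eq_iff axis_def)
    have "partial_d i f x = partial_d i (\<lambda>x. ev a x / ev b x) x" by (rule partial_d_cong[OF U f x])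
    also have "\<dots> = (ev (pd (axis i 1) a) x * ev b x - ev a x * ev (pd (axis i 1) b) x) / (ev b x * ev b x)"
      unfolding partial_d_def using DERIV_divide[OF e[of a] e[of b]] nz[OF x]
      by (intro DERIV_imp_deriv) (simp add: 0)
    finally show ?thesis by simp
  qed
  then show ?thesis unfolding \<phi> pdf_quot[OF b] by (intro relI[OF refl]) (use b nz in auto)
qed

lemma rel_reflect:
  assumes "rel U f \<phi>" "bil \<alpha> \<alpha> \<noteq> 0"
  shows "rel {x. reflect \<alpha> x \<in> U} (\<lambda>x. f (reflect \<alpha> x)) (subf \<alpha> \<phi>)"
  using assms(1)
proof (elim relE)
  fix a b assume *: "\<phi> = emb a / emb b" "b \<noteq> 0" "\<And>x. x \<in> U \<Longrightarrow> ev b x \<noteq> 0" "\<And>x. x \<in> U \<Longrightarrow> f x = ev a x / ev b x"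
  then show ?thesis
    by (intro relI[of _ "psub \<alpha> a" "psub \<alpha> b"]) (simp_all add: subf_emb assms(2) psub_eq_0_iff)
qed

definition upot :: "(complex^'n) set \<Rightarrow> (complex^'n \<Rightarrow> complex) \<Rightarrow> 'n::finite rfun" where
  "upot A k = (\<Sum>\<alpha>\<in>A. cst (k \<alpha> * (k \<alpha> + 1) * bil \<alpha> \<alpha>) / tt \<alpha> ^ 2)"

lemma rel_potential:
  assumes "\<And>\<alpha>. \<alpha> \<in> A \<Longrightarrow> bil \<alpha> \<alpha> \<noteq> 0" "U \<subseteq> regular_points A"
  shows "rel U (potential A k) (upot A k)"
proof -
  have "rel U (\<lambda>x. \<Sum>\<alpha>\<in>A. k \<alpha> * (k \<alpha> + 1) * bil \<alpha> \<alpha> / (bil \<alpha> x)\<^sup>2) (upot A k)"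
    unfolding upot_def
  proof (rule rel_sum)
    fix \<alpha> assume "\<alpha> \<in> A"
    then show "rel U (\<lambda>x. k \<alpha> * (k \<alpha> + 1) * bil \<alpha> \<alpha> / (bil \<alpha> x)\<^sup>2) (cst (k \<alpha> * (k \<alpha> + 1) * bil \<alpha> \<alpha>) / tt \<alpha> ^ 2)"
      using assms lin_nonzero[of \<alpha>]
      by (intro relI[of _ "pcst (k \<alpha> * (k \<alpha> + 1) * bil \<alpha> \<alpha>)" "lin \<alpha> ^ 2"])
        (auto simp: emb_power regular_points_def)
  qed
  then show ?thesis by (rule rel_cong) (simp add: potential_def)
qed

definition euler_op :: "'n::finite diffop" where
  "euler_op f x = (\<Sum>i\<in>UNIV. x $ i * partial_d i f x)"

context
  fixes U :: "(complex^'n::finite) set"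
  assumes U: "open U"
begin

lemma rel_L_op:
  assumes "rel U (potential A k) u" "rel U f \<phi>"
  shows "rel U (L_op A k f) (app (lop u) \<phi>)"
proof -
  have "rel U (\<lambda>x. (\<Sum>i\<in>UNIV. partial_d i (partial_d i f) x) - potential A k x * f x)
      ((\<Sum>i\<in>UNIV. pdf (axis i 1) (pdf (axis i 1) \<phi>)) - u * \<phi>)"
    by (intro rel_diff rel_mult rel_sum rel_partial_d assms U)
  then show ?thesis
    by (simp add: L_op_def[abs_def] laplacian_def lop_def lapl_def app_sum)
qed

lemma rel_ad_pow:
  assumes "rel U (potential A k) u1" "rel U (potential B k) u2"
  shows "rel U f \<phi> \<Longrightarrow> rel U (((ad (L_op A k) (L_op B k) ^^ j) (mult_op (ev q))) f)
      (app ((adj u1 u2 ^^ j) (mul (emb q))) \<phi>)"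
proof (induction j arbitrary: f \<phi>)
  case 0
  then show ?case using rel_mult[OF rel_emb 0] by (simp add: mult_op_def[abs_def])
next
  case (Suc j)
  from rel_diff[OF rel_L_op[OF assms(1) Suc.IH[OF Suc.prems]] Suc.IH[OF rel_L_op[OF assms(2) Suc.prems]]]
  show ?case by (simp add: ad_def adj_def)
qed

lemma rel_euler_op: "rel U f \<phi> \<Longrightarrow> rel U (euler_op f) (app eu \<phi>)"
proof -
  assume "rel U f \<phi>"
  then have "rel U (\<lambda>x. \<Sum>i\<in>UNIV. ev (pcrd i) x * partial_d i f x)
      (\<Sum>i\<in>UNIV. emb (pcrd i) * pdf (axis i 1) \<phi>)"
    by (intro rel_sum rel_mult rel_emb rel_partial_d U)
  then show ?thesis by (simp add: euler_op_def[abs_def] eu_def app_sum)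
qed

subsection \<open>Differential operators\<close>

text \<open>The relation \<open>formal_adjoint\<close> is defined on the algebra generated by
  holomorphic functions and partial derivatives, so having an adjoint is a way of saying that an
  operator belongs to that algebra.\<close>

definition dop :: "'n diffop \<Rightarrow> bool" where
  "dop P \<longleftrightarrow> (\<exists>T. formal_adjoint U P T)"

lemma dop_good: "dop P \<Longrightarrow> good U P"
  using formal_adjoint_good[OF U] unfolding dop_def by blast

lemma op_eq_refl: "op_eq U P P"
  by (simp add: op_eq_def)

lemma formal_adjoint_scale:
  "formal_adjoint U P T \<Longrightarrow> formal_adjoint U (op_scale c P) (op_scale c T)"
proof -
  assume P: "formal_adjoint U P T"
  then have T: "good U T" using formal_adjoint_good[OF U] by blast
  show ?thesis
  proof (rule formal_adjoint.cong[OF formal_adjoint.comp[OF formal_adjoint.mult[OF holo_on_const[of U c]] P]])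
    show "op_eq U (mult_op (\<lambda>x. c) \<circ> P) (op_scale c P)" by (simp add: op_eq_def mult_op_def op_scale_def)
    show "op_eq U (T \<circ> mult_op (\<lambda>x. c)) (op_scale c T)"
      using good_cmult[OF T] by (simp add: op_eq_def mult_op_def[abs_def] op_scale_def)
  qed
qed

lemma formal_adjoint_sum:
  "finite I \<Longrightarrow> (\<And>i. i \<in> I \<Longrightarrow> formal_adjoint U (P i) (T i)) \<Longrightarrow>
    formal_adjoint U (\<lambda>f x. \<Sum>i\<in>I. P i f x) (\<lambda>f x. \<Sum>i\<in>I. T i f x)"
proof (induction I rule: finite_induct)
  case empty
  show ?case
    by (rule formal_adjoint.cong[OF formal_adjoint.mult[OF holo_on_const[of U 0]]])
      (simp_all add: op_eq_def mult_op_def)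
next
  case (insert i I)
  then have "formal_adjoint U (P i) (T i)" "formal_adjoint U (\<lambda>f x. \<Sum>i\<in>I. P i f x) (\<lambda>f x. \<Sum>i\<in>I. T i f x)" by auto
  from formal_adjoint.add[OF this] insert.hyps show ?case by simp
qed

lemma formal_adjoint_laplacian: "formal_adjoint U laplacian laplacian"
proof -
  have "formal_adjoint U (partial_d i \<circ> partial_d i) (partial_d i \<circ> partial_d i)" for i
  proof (rule formal_adjoint.cong[OF formal_adjoint.comp[OF formal_adjoint.partial formal_adjoint.partial, of U i i] op_eq_refl])
    show "op_eq U (op_scale (- 1) (partial_d i) \<circ> op_scale (- 1) (partial_d i)) (partial_d i \<circ> partial_d i)"
      by (auto simp: op_eq_def op_scale_def[abs_def] partial_d_minus[OF holo_on_partial_d[OF U]])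
  qed
  then have "formal_adjoint U (\<lambda>f x. \<Sum>i\<in>UNIV. (partial_d i \<circ> partial_d i) f x) (\<lambda>f x. \<Sum>i\<in>UNIV. (partial_d i \<circ> partial_d i) f x)"
    by (intro formal_adjoint_sum finite)
  then show ?thesis by (simp add: laplacian_def[abs_def])
qed

lemma formal_adjoint_schroedinger:
  assumes "holo_on U v"
  shows "formal_adjoint U (\<lambda>f x. laplacian f x + v x * f x) (\<lambda>f x. laplacian f x + v x * f x)"
  using formal_adjoint.add[OF formal_adjoint_laplacian formal_adjoint.mult[OF assms]]
  by (simp add: mult_op_def[abs_def])

lemma poly_fun_bil_self: "poly_fun (\<lambda>x. bil x x)"
  unfolding bil_def by (intro poly_fun_sum poly_fun.mult poly_fun.coord)

lemma formal_adjoint_L_osc: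
  assumes "holo_on U (potential A k)"
  shows "formal_adjoint U (op_shift (L_osc \<omega> A k) c) (op_shift (L_osc \<omega> A k) c)"
proof -
  have "holo_on U (\<lambda>x. c - \<omega>\<^sup>2 * bil x x - potential A k x)"
    by (intro holo_on_diff holo_on_const holo_on_cmult poly_fun_holo poly_fun_bil_self assms)
  from formal_adjoint_schroedinger[OF this] show ?thesis
    by (simp add: op_shift_def[abs_def] L_osc_def algebra_simps)
qed

lemma formal_adjoint_L_osc_0:
  "holo_on U (potential A k) \<Longrightarrow> formal_adjoint U (L_osc \<omega> A k) (L_osc \<omega> A k)"
  using formal_adjoint_L_osc[of A k \<omega> 0] by (simp add: op_shift_def[abs_def])

lemma dop_L_op: "holo_on U (potential A k) \<Longrightarrow> dop (L_op A k)"
proof -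
  assume "holo_on U (potential A k)"
  from formal_adjoint_L_osc_0[OF this, of 0] show ?thesis
    unfolding dop_def by (auto simp: L_osc_def[abs_def] L_op_def[abs_def])
qed

lemma dop_mult_op: "holo_on U a \<Longrightarrow> dop (mult_op a)"
  unfolding dop_def using formal_adjoint.mult by blast

lemma dop_comp: "dop P \<Longrightarrow> dop Q \<Longrightarrow> dop (P \<circ> Q)"
  unfolding dop_def using formal_adjoint.comp by blast

lemma dop_add: "dop P \<Longrightarrow> dop Q \<Longrightarrow> dop (\<lambda>f x. P f x + Q f x)"
  unfolding dop_def using formal_adjoint.add by blast

lemma dop_scale: "dop P \<Longrightarrow> dop (op_scale c P)"
  unfolding dop_def using formal_adjoint_scale by blast

lemma dop_ad: "dop A \<Longrightarrow> dop B \<Longrightarrow> dop M \<Longrightarrow> dop (ad A B M)"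
  using dop_add[OF dop_comp[of A M] dop_scale[OF dop_comp[of M B], of "- 1"]]
  by (simp add: ad_def[abs_def] op_scale_def[abs_def])

lemma dop_ad_pow: "dop A \<Longrightarrow> dop B \<Longrightarrow> dop M \<Longrightarrow> dop ((ad A B ^^ j) M)"
  by (induction j) (auto intro: dop_ad)

lemma dop_euler: "dop euler_op"
proof -
  have "formal_adjoint U (mult_op (\<lambda>x. x $ i) \<circ> partial_d i) (op_scale (- 1) (partial_d i) \<circ> mult_op (\<lambda>x. x $ i))" for i
    by (intro formal_adjoint.comp formal_adjoint.mult formal_adjoint.partial holo_on_coord)
  then have "formal_adjoint U (\<lambda>f x. \<Sum>i\<in>UNIV. (mult_op (\<lambda>x. x $ i) \<circ> partial_d i) f x)
      (\<lambda>f x. \<Sum>i\<in>UNIV. (op_scale (- 1) (partial_d i) \<circ> mult_op (\<lambda>x. x $ i)) f x)"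
    by (intro formal_adjoint_sum finite)
  then show ?thesis
    unfolding dop_def by (auto simp: euler_op_def[abs_def] mult_op_def)
qed

lemma dop_eqI:
  assumes "dop P" "dop Q" "\<And>p x. poly_fun p \<Longrightarrow> x \<in> U \<Longrightarrow> P p x = Q p x"
  shows "op_eq U P Q"
  using assms formal_adjoint_determined(1)[OF U] unfolding dop_def by blast

text \<open>Nilpotency of the rational counterpart gives the intertwining relation and the homogeneity
  of the operator of order \<open>r\<close>; both need only be checked on polynomials.\<close>
lemma intertwining:
  fixes c :: complex
  assumes u: "rel U (potential A k) u1" "rel U (potential B k) u2"
    and nil: "(adj u1 u2 ^^ Suc r) (mul (emb q)) = 0"
    and deg: "deg (- int r) ((adj u1 u2 ^^ r) (mul (emb q)))"
  defines "S \<equiv> op_scale c ((ad (L_op A k) (L_op B k) ^^ r) (mult_op (ev q)))"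
  shows "dop S"
    "\<And>f x. holo_on U f \<Longrightarrow> x \<in> U \<Longrightarrow> L_op A k (S f) x = S (L_op B k f) x"
    "\<And>f x. holo_on U f \<Longrightarrow> x \<in> U \<Longrightarrow> euler_op (S f) x = S (euler_op f) x - of_nat r * S f x"
proof -
  define P where "P = (ad (L_op A k) (L_op B k) ^^ r) (mult_op (ev q))"
  define X where "X = (adj u1 u2 ^^ r) (mul (emb q))"
  have S: "S = op_scale c P" by (simp add: S_def P_def)
  have L: "dop (L_op A k)" "dop (L_op B k)" by (intro dop_L_op rel_holo[OF u(1) U] rel_holo[OF u(2) U])+
  have P: "dop P" unfolding P_def
    by (intro dop_ad_pow L dop_mult_op poly_fun_holo poly_fun_ev)
  note gP = dop_good[OF P]
  show "dop S" unfolding S by (rule dop_scale[OF P])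
  have relP: "rel U (P f) (app X \<phi>)" if "rel U f \<phi>" for f \<phi>
    unfolding P_def X_def by (rule rel_ad_pow[OF u that])
  have "op_eq U (L_op A k \<circ> P) (P \<circ> L_op B k)"
  proof (rule dop_eqI[OF dop_comp[OF L(1) P] dop_comp[OF P L(2)]])
    fix p :: "complex^'n \<Rightarrow> complex" and x assume p: "poly_fun p" and x: "x \<in> U"
    have "rel U p (emb (Pol p))" using rel_emb[of U "Pol p"] by (simp add: ev_Pol[OF p])
    from rel_ad_pow[OF u this, of "Suc r" q]
    have "rel U (\<lambda>x. L_op A k (P p) x - P (L_op B k p) x) 0"
      unfolding nil by (simp add: P_def ad_def)
    from rel_zero[OF this x] show "(L_op A k \<circ> P) p x = (P \<circ> L_op B k) p x" by simp
  qed
  then have LP: "L_op A k (P f) x = P (L_op B k f) x" if "holo_on U f" "x \<in> U" for f x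
    using that by (auto simp: op_eq_def)
  have "op_eq U (euler_op \<circ> P) (\<lambda>f x. (P \<circ> euler_op) f x + op_scale (- of_nat r) P f x)"
  proof (rule dop_eqI[OF dop_comp[OF dop_euler P] dop_add[OF dop_comp[OF P dop_euler] dop_scale[OF P]]])
    fix p :: "complex^'n \<Rightarrow> complex" and x assume p: "poly_fun p" and x: "x \<in> U"
    define \<phi> where "\<phi> = emb (Pol p)"
    have \<phi>: "rel U p \<phi>" using rel_emb[of U "Pol p"] by (simp add: ev_Pol[OF p] \<phi>_def)
    have "app eu (app X \<phi>) - app X (app eu \<phi>) = - (of_nat r * app X \<phi>)"
      using arg_cong[OF deg[folded X_def, unfolded deg_def cm_def], of "\<lambda>Z. app Z \<phi>"] by simp
    then have z: "app eu (app X \<phi>) - (app X (app eu \<phi>) + cst (- of_nat r) * app X \<phi>) = 0"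
      using cst_of_nat[of r, where ?'a = 'n] by (simp add: pcst_hom emb_hom algebra_simps)
    have "rel U (\<lambda>x. euler_op (P p) x - (P (euler_op p) x + - of_nat r * P p x))
        (app eu (app X \<phi>) - (app X (app eu \<phi>) + cst (- of_nat r) * app X \<phi>))"
      by (intro rel_diff rel_add rel_mult rel_const relP rel_euler_op \<phi>)
    from rel_zero[OF this[unfolded z] x] show "(euler_op \<circ> P) p x = (P \<circ> euler_op) p x + op_scale (- of_nat r) P p x"
      by (simp add: op_scale_def)
  qed
  then have EP: "euler_op (P f) x = P (euler_op f) x - of_nat r * P f x" if "holo_on U f" "x \<in> U" for f x
    using that by (auto simp: op_eq_def op_scale_def)
  fix f x assume f: "holo_on U f" and x: "x \<in> U"
  show "L_op A k (S f) x = S (L_op B k f) x"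
    using good_cmult[OF dop_good[OF L(1)] good_holo[OF gP f] x] LP[OF f x] by (simp add: S op_scale_def[abs_def])
  show "euler_op (S f) x = S (euler_op f) x - of_nat r * S f x"
    using good_cmult[OF dop_good[OF dop_euler] good_holo[OF gP f] x] EP[OF f x]
    by (simp add: S op_scale_def[abs_def] algebra_simps)
qed

subsection \<open>Conjugation by the Gaussian\<close>

definition gauss :: "complex \<Rightarrow> complex^'n \<Rightarrow> complex" where
  "gauss \<omega> x = exp (\<omega> * bil x x / 2)"

lemma gauss_inverse: "gauss (- \<omega>) x * gauss \<omega> x = 1" "gauss \<omega> x * gauss (- \<omega>) x = 1"
  by (simp_all add: gauss_def flip: exp_add)

lemma gauss_conj_gauss: "gauss_conj \<omega> P = mult_op (gauss (- \<omega>)) \<circ> P \<circ> mult_op (gauss \<omega>)"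
  by (simp add: gauss_conj_def gauss_def[abs_def])

lemma holo_on_half_bil: "holo_on U (\<lambda>x. \<omega> * bil x x / 2)"
proof -
  have "holo_on U (\<lambda>x. (\<omega> / 2) * bil x x)"
    by (intro holo_on_cmult poly_fun_holo poly_fun_bil_self)
  then show ?thesis by simp
qed

lemma holo_on_gauss: "holo_on U (gauss \<omega>)"
  unfolding gauss_def[abs_def] by (rule holo_on_exp[OF holo_on_half_bil])

lemma partial_d_gauss:
  assumes x: "x \<in> U"
  shows "partial_d i (gauss \<omega>) x = \<omega> * x $ i * gauss \<omega> x"
proof -
  have "partial_d i (\<lambda>x. \<Sum>j\<in>UNIV. x $ j * x $ j) x = (\<Sum>j\<in>UNIV. partial_d i (\<lambda>x. x $ j * x $ j) x)"
    by (rule partial_d_sum[OF _ x]) (intro holo_on_mult holo_on_coord)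
  also have "\<dots> = (\<Sum>j\<in>UNIV. if i = j then 2 * x $ j else 0)"
    by (intro sum.cong refl) (simp add: partial_d_mult[OF holo_on_coord holo_on_coord x] partial_d_coord)
  finally have b: "partial_d i (\<lambda>x. bil x x) x = 2 * x $ i" by (simp add: bil_def)
  have "partial_d i (\<lambda>x. (\<omega> / 2) * bil x x) x = (\<omega> / 2) * (2 * x $ i)"
    unfolding b[symmetric] by (rule partial_d_cmult[OF poly_fun_holo[OF poly_fun_bil_self] x])
  then have d: "((\<lambda>z. (\<omega> / 2) * bil (x + axis i z) (x + axis i z)) has_field_derivative \<omega> * x $ i) (at 0)"
    using holo_on_partial[OF holo_on_half_bil[of \<omega>] x, of i] by simp
  have "((\<lambda>z. exp ((\<omega> / 2) * bil (x + axis i z) (x + axis i z))) has_field_derivative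
      exp ((\<omega> / 2) * bil (x + axis i 0) (x + axis i 0)) * (\<omega> * x $ i)) (at 0)"
    by (rule DERIV_chain2[OF DERIV_exp d])
  moreover have "x + axis i 0 = x" by (simp add: vec_eq_iff axis_def)
  ultimately show ?thesis unfolding partial_d_def
    by (intro DERIV_imp_deriv) (simp add: gauss_def mult.commute)
qed

text \<open>Conjugation turns each partial derivative into itself minus \<omega> times its
  coordinate. Summing the squares gives the Euler term, the dimension from commuting derivatives
  with coordinates, and a quadratic term that cancels the oscillator potential.\<close>

lemma L_osc_gauss:
  assumes h: "holo_on U h" and x: "x \<in> U"
  shows "L_osc \<omega> A k (\<lambda>x. gauss (- \<omega>) x * h x) x =
    gauss (- \<omega>) x * (L_op A k h x - \<omega> * (2 * euler_op h x + of_nat CARD('n) * h x))"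
proof -
  let ?g = "gauss (- \<omega>)"
  have d1: "partial_d i (\<lambda>x. ?g x * h x) x = ?g x * (partial_d i h x - \<omega> * (x $ i * h x))"
    if h: "holo_on U h" and x: "x \<in> U" for h x i
    unfolding partial_d_mult[OF holo_on_gauss h x] partial_d_gauss[OF x] by (simp add: algebra_simps)
  have d2: "partial_d i (partial_d i (\<lambda>x. ?g x * h x)) x =
      ?g x * (partial_d i (partial_d i h) x - \<omega> * h x - 2 * \<omega> * (x $ i * partial_d i h x) + \<omega>\<^sup>2 * (x $ i * x $ i) * h x)" for i
  proof -
    define h1 where "h1 x = partial_d i h x - \<omega> * (x $ i * h x)" for x
    have xh: "holo_on U (\<lambda>x. x $ i * h x)" by (rule holo_on_mult[OF holo_on_coord h])
    have h1: "holo_on U h1" unfolding h1_def[abs_def]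
      by (intro holo_on_diff holo_on_partial_d[OF U] holo_on_cmult xh h)
    have e1: "partial_d i h1 x = partial_d i (partial_d i h) x - \<omega> * (h x + x $ i * partial_d i h x)"
      unfolding h1_def[abs_def]
        partial_d_diff[OF holo_on_partial_d[OF U h] holo_on_cmult[OF xh] x]
        partial_d_cmult[OF xh x] partial_d_mult[OF holo_on_coord h x] by (simp add: partial_d_coord)
    have e2: "partial_d i (partial_d i (\<lambda>x. ?g x * h x)) x = partial_d i (\<lambda>x. ?g x * h1 x) x"
      unfolding h1_def by (rule partial_d_cong[OF U d1[OF h] x])
    show ?thesis
      unfolding e2 d1[OF h1 x] e1 by (simp add: h1_def algebra_simps power2_eq_square)
  qed
  have "laplacian (\<lambda>x. ?g x * h x) x = ?g x * (laplacian h x - \<omega> * (of_nat CARD('n) * h x)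
      - 2 * \<omega> * euler_op h x + \<omega>\<^sup>2 * bil x x * h x)"
    unfolding laplacian_def d2
    by (simp add: euler_op_def bil_def sum.distrib sum_subtractf sum_distrib_left
        sum_distrib_right algebra_simps)
  then show ?thesis by (simp add: L_osc_def L_op_def algebra_simps)
qed

text \<open>After conjugation the oscillators become L - 2\<omega>E - n\<omega>. The scalar
  n\<omega> is the same on both sides; moving -2\<omega>E past \<open>S\<close>, which lowers the
  Euler degree by \<open>r\<close>, leaves +2\<omega>r.\<close>

lemma gauss_conj_intertwining:
  assumes S: "good U S" and pot: "holo_on U (potential A k)" "holo_on U (potential B k)"
    and LS: "\<And>f x. holo_on U f \<Longrightarrow> x \<in> U \<Longrightarrow> L_op A k (S f) x = S (L_op B k f) x"
    and ES: "\<And>f x. holo_on U f \<Longrightarrow> x \<in> U \<Longrightarrow> euler_op (S f) x = S (euler_op f) x - of_nat r * S f x"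
    and f: "holo_on U f" and x: "x \<in> U"
  shows "L_osc \<omega> A k (gauss_conj \<omega> S f) x =
    gauss_conj \<omega> S (L_osc \<omega> B k f) x + 2 * \<omega> * of_nat r * gauss_conj \<omega> S f x"
proof -
  define n :: complex where "n = of_nat CARD('n)"
  define g where "g x = gauss \<omega> x * f x" for x
  have g: "holo_on U g" unfolding g_def[abs_def] by (rule holo_on_mult[OF holo_on_gauss f])
  have conj: "gauss_conj \<omega> S h x = gauss (- \<omega>) x * S (\<lambda>x. gauss \<omega> x * h x) x" for h x
    by (simp add: gauss_conj_gauss mult_op_def[abs_def])
  have fg: "f x = gauss (- \<omega>) x * g x" for x
    by (simp add: g_def gauss_inverse flip: mult.assoc)
  have Sg: "holo_on U (S g)" by (rule good_holo[OF S g])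
  have Lg: "holo_on U (L_op B k g)" by (rule good_holo[OF dop_good[OF dop_L_op[OF pot(2)]] g])
  have Eg: "holo_on U (euler_op g)" by (rule good_holo[OF dop_good[OF dop_euler] g])
  have "S (\<lambda>x. gauss \<omega> x * L_osc \<omega> B k f x) x = S (\<lambda>x. L_op B k g x + (- 2 * \<omega> * euler_op g x + - \<omega> * n * g x)) x"
  proof (rule good_cong[OF S, symmetric])
    show "holo_on U (\<lambda>x. L_op B k g x + (- 2 * \<omega> * euler_op g x + - \<omega> * n * g x))"
      by (intro holo_on_add holo_on_cmult Lg Eg g)
    fix x assume "x \<in> U"
    have "(\<lambda>x. gauss (- \<omega>) x * g x) = f" by (rule ext) (rule fg[symmetric])
    from L_osc_gauss[OF g \<open>x \<in> U\<close>, of \<omega> B k, unfolded this]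
    have "gauss \<omega> x * L_osc \<omega> B k f x = L_op B k g x - \<omega> * (2 * euler_op g x + n * g x)"
      by (simp only: mult.assoc[symmetric] gauss_inverse mult_1_left n_def)
    then show "L_op B k g x + (- 2 * \<omega> * euler_op g x + - \<omega> * n * g x) = gauss \<omega> x * L_osc \<omega> B k f x"
      by (simp only:) (simp add: algebra_simps)
  qed (rule x)
  also have "\<dots> = S (L_op B k g) x + (- 2 * \<omega> * S (euler_op g) x + - \<omega> * n * S g x)"
    by (simp only: good_add[OF S Lg holo_on_add[OF holo_on_cmult[OF Eg] holo_on_cmult[OF g]] x]
        good_add[OF S holo_on_cmult[OF Eg] holo_on_cmult[OF g] x] good_cmult[OF S Eg x] good_cmult[OF S g x])
  finally have R: "gauss_conj \<omega> S (L_osc \<omega> B k f) x =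
      gauss (- \<omega>) x * (S (L_op B k g) x + (- 2 * \<omega> * S (euler_op g) x + - \<omega> * n * S g x))"
    by (simp add: conj)
  have gc: "gauss_conj \<omega> S f = (\<lambda>x. gauss (- \<omega>) x * S g x)"
    by (simp add: fun_eq_iff conj g_def[abs_def])
  show ?thesis
    unfolding R unfolding gc L_osc_gauss[OF Sg x] LS[OF g x] ES[OF g x]
    by (simp add: n_def algebra_simps)
qed

lemma formal_adjoint_gauss_conj:
  assumes "dop S"
  shows "dop (gauss_conj \<omega> S)"
  unfolding gauss_conj_gauss by (intro dop_comp dop_mult_op holo_on_gauss assms)

text \<open>Both oscillators are formally self-adjoint, so by uniqueness of adjoints the relation
  for \<open>S\<close> yields one for \<open>T\<close> with the factors reversed and the same shift
  \<open>c\<close>. Moving through \<open>T\<close> and then through \<open>S\<close> returns the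
  original operator.\<close>

lemma op_commute_adjoint:
  assumes S: "formal_adjoint U S T"
    and pot: "holo_on U (potential A k)" "holo_on U (potential B k)"
    and LS: "op_eq U (L_osc \<omega> A k \<circ> S) (S \<circ> op_shift (L_osc \<omega> B k) c)"
  shows "op_commute U (S \<circ> T) (L_osc \<omega> A k)"
proof -
  note gS = formal_adjoint_good[OF U S]
  have "op_eq U (T \<circ> L_osc \<omega> A k) (op_shift (L_osc \<omega> B k) c \<circ> T)"
  proof (rule formal_adjoint_determined(2)[OF U
        formal_adjoint.comp[OF formal_adjoint_L_osc_0[OF pot(1)] S]
        formal_adjoint.comp[OF S formal_adjoint_L_osc[OF pot(2)]]])
    fix p :: "complex^'n \<Rightarrow> complex" and x assume "poly_fun p" "x \<in> U"
    then show "(L_osc \<omega> A k \<circ> S) p x = (S \<circ> op_shift (L_osc \<omega> B k) c) p x"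
      using LS poly_fun_holo unfolding op_eq_def by blast
  qed
  then have TL: "T (L_osc \<omega> A k f) x = op_shift (L_osc \<omega> B k) c (T f) x" if "holo_on U f" "x \<in> U" for f x
    using that by (auto simp: op_eq_def)
  have gA: "good U (L_osc \<omega> A k)" using formal_adjoint_good[OF U formal_adjoint_L_osc_0[OF pot(1)]] by blast
  show ?thesis unfolding op_commute_def op_eq_def
  proof (intro allI impI ballI)
    fix f x assume f: "holo_on U f" and x: "x \<in> U"
    have Tf: "holo_on U (T f)" using good_holo gS f by blast
    have "S (T (L_osc \<omega> A k f)) x = S (op_shift (L_osc \<omega> B k) c (T f)) x"
    proof (rule good_cong[OF conjunct1[OF gS] _ _ x])
      show "holo_on U (T (L_osc \<omega> A k f))" using good_holo gS good_holo[OF gA f] by blast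
    qed (rule TL[OF f])
    also have "\<dots> = L_osc \<omega> A k (S (T f)) x"
      using LS Tf x by (simp add: op_eq_def)
    finally show "(S \<circ> T \<circ> L_osc \<omega> A k) f x = (L_osc \<omega> A k \<circ> (S \<circ> T)) f x" by simp
  qed
qed

lemma op_commute_product:
  assumes good: "good U P" "good U Q" "good U L"
    and P: "\<And>f x. holo_on U f \<Longrightarrow> x \<in> U \<Longrightarrow> L (P f) x = P (L f) x + c * P f x"
    and Q: "\<And>f x. holo_on U f \<Longrightarrow> x \<in> U \<Longrightarrow> L (Q f) x = Q (L f) x - c * Q f x"
  shows "op_commute U (P \<circ> Q) L"
  unfolding op_commute_def op_eq_def
proof (intro allI impI ballI)
  fix f x assume f: "holo_on U f" and x: "x \<in> U"
  note Qf = good_holo[OF good(2) f]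
  note LQf = good_holo[OF good(3) Qf]
  have "P (Q (L f)) x = P (\<lambda>x. L (Q f) x + c * Q f x) x"
    by (rule good_cong[OF good(1) good_holo[OF good(2) good_holo[OF good(3) f]] _ x]) (simp add: Q[OF f])
  also have "\<dots> = P (L (Q f)) x + c * P (Q f) x"
    by (simp only: good_add[OF good(1) LQf holo_on_cmult[OF Qf] x] good_cmult[OF good(1) Qf x])
  also have "\<dots> = L (P (Q f)) x" using P[OF Qf x] by simp
  finally show "(P \<circ> Q \<circ> L) f x = (L \<circ> (P \<circ> Q)) f x" by simp
qed

end

section \<open>Intertwiners for two potentials with a nilpotent commutator\<close>

context
  fixes U :: "(complex^'n::finite) set" and k :: "complex^'n \<Rightarrow> complex" and A B :: "(complex^'n) set"
    and u1 u2 :: "'n rfun" and q :: "'n pol" and r :: nat and c :: complex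
  assumes U: "open U" and u: "rel U (potential A k) u1" "rel U (potential B k) u2"
    and nil: "(adj u1 u2 ^^ Suc r) (mul (emb q)) = 0"
    and deg: "deg (- int r) ((adj u1 u2 ^^ r) (mul (emb q)))"
begin

abbreviation S :: "'n diffop" where
  "S \<equiv> op_scale c ((ad (L_op A k) (L_op B k) ^^ r) (mult_op (ev q)))"

lemmas S_intertwining = intertwining[OF U u nil deg, where c = c]
lemmas pot_holo = rel_holo[OF u(1) U] rel_holo[OF u(2) U]

lemma good_L_osc: "good U (L_osc \<omega> A k)" "good U (L_osc \<omega> B k)"
  using formal_adjoint_good[OF U formal_adjoint_L_osc_0[OF U pot_holo(1)]]
    formal_adjoint_good[OF U formal_adjoint_L_osc_0[OF U pot_holo(2)]] by blast+

lemma dop_conj: "dop U (gauss_conj \<omega> S)"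
  by (rule formal_adjoint_gauss_conj[OF U S_intertwining(1)])

lemma conj_intertwining:
  "holo_on U f \<Longrightarrow> x \<in> U \<Longrightarrow> L_osc \<omega> A k (gauss_conj \<omega> S f) x =
    gauss_conj \<omega> S (L_osc \<omega> B k f) x + 2 * \<omega> * of_nat r * gauss_conj \<omega> S f x"
  by (rule gauss_conj_intertwining[OF U dop_good[OF U S_intertwining(1)] pot_holo S_intertwining(2,3)])

lemma conj_intertwining_op:
  "op_eq U (L_osc \<omega> A k \<circ> gauss_conj \<omega> S)
    (gauss_conj \<omega> S \<circ> op_shift (L_osc \<omega> B k) (2 * \<omega> * of_nat r))"
  unfolding op_eq_def
proof (intro allI impI ballI)
  fix f x assume f: "holo_on U f" and x: "x \<in> U"
  note G = dop_good[OF U dop_conj[of \<omega>]]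
  show "(L_osc \<omega> A k \<circ> gauss_conj \<omega> S) f x =
      (gauss_conj \<omega> S \<circ> op_shift (L_osc \<omega> B k) (2 * \<omega> * of_nat r)) f x"
    using good_add[OF G good_holo[OF good_L_osc(2) f] holo_on_cmult[OF f] x] good_cmult[OF G f x]
      conj_intertwining[OF f x] by (simp add: op_shift_def[abs_def])
qed

lemma conj_adjoint_commute:
  "formal_adjoint U (gauss_conj \<omega> S) T \<Longrightarrow> op_commute U (gauss_conj \<omega> S \<circ> T) (L_osc \<omega> A k)"
  by (rule op_commute_adjoint[OF U _ pot_holo conj_intertwining_op])

lemma conj_adjoint_exists: "\<exists>T. formal_adjoint U (gauss_conj \<omega> S) T"
  using dop_conj unfolding dop_def[OF U] .

lemma conj_shift:
  assumes "L_op B k = L_op A k" "L_osc \<omega> B k = L_osc \<omega> A k"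
  shows "op_eq U (gauss_conj \<omega> S \<circ> L_osc \<omega> A k)
    (op_shift (L_osc \<omega> A k) (- 2 * \<omega> * of_nat r) \<circ> gauss_conj \<omega> S)"
  using conj_intertwining[of _ _ \<omega>] by (simp add: op_eq_def op_shift_def assms)

lemma conj_product_commute:
  assumes "L_op B k = L_op A k" "L_osc \<omega> B k = L_osc \<omega> A k"
  shows "op_commute U (gauss_conj \<omega> S \<circ> gauss_conj (- \<omega>) S) (L_osc \<omega> A k)"
proof (rule op_commute_product[OF U dop_good[OF U dop_conj] dop_good[OF U dop_conj] good_L_osc(1),
      where c = "2 * \<omega> * of_nat r"])
  fix f x assume f: "holo_on U f" "x \<in> U"
  show "L_osc \<omega> A k (gauss_conj \<omega> S f) x =
      gauss_conj \<omega> S (L_osc \<omega> A k f) x + 2 * \<omega> * of_nat r * gauss_conj \<omega> S f x"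
    using conj_intertwining[OF f, of \<omega>] by (simp add: assms)
  \<comment> \<open>The oscillator depends only on the square of \<omega>, so changing the sign of
    \<omega> in the conjugation reverses only the shift.\<close>
  have "L_osc (- \<omega>) A k = L_osc \<omega> A k" "L_osc (- \<omega>) B k = L_osc \<omega> B k"
    by (simp_all add: fun_eq_iff L_osc_def)
  then show "L_osc \<omega> A k (gauss_conj (- \<omega>) S f) x =
      gauss_conj (- \<omega>) S (L_osc \<omega> A k f) x - 2 * \<omega> * of_nat r * gauss_conj (- \<omega>) S f x"
    using conj_intertwining[OF f, of "- \<omega>"] by (simp add: assms)
qed

end

subsection \<open>Potentials of configurations\<close>

lemma full_uminus: "\<alpha> \<in> full A \<Longrightarrow> - \<alpha> \<in> full A"
  by (auto simp: full_def)

lemma in_full_iff: "\<alpha> \<in> full A \<longleftrightarrow> \<alpha> \<in> A \<or> - \<alpha> \<in> A"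
  by (auto simp: full_def image_iff) (metis minus_minus)

text \<open>A reflection permutes the full set of vectors but not the chosen half. Sums over halves
  are therefore compared through the full set, at the price of a factor 2.\<close>

lemma sum_full:
  fixes g :: "'a::ab_group_add \<Rightarrow> 'b::comm_ring_1"
  assumes "finite A" "\<And>\<alpha>. \<alpha> \<in> A \<Longrightarrow> - \<alpha> \<notin> A" "\<And>\<alpha>. \<alpha> \<in> A \<Longrightarrow> g (- \<alpha>) = g \<alpha>"
  shows "(\<Sum>\<alpha>\<in>A \<union> uminus ` A. g \<alpha>) = 2 * (\<Sum>\<alpha>\<in>A. g \<alpha>)"
proof -
  have "(\<Sum>\<alpha>\<in>A \<union> uminus ` A. g \<alpha>) = (\<Sum>\<alpha>\<in>A. g \<alpha>) + (\<Sum>\<alpha>\<in>uminus ` A. g \<alpha>)"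
    using assms(1,2) by (intro sum.union_disjoint) auto
  also have "(\<Sum>\<alpha>\<in>uminus ` A. g \<alpha>) = (\<Sum>\<alpha>\<in>A. g (- \<alpha>))"
    by (simp add: sum.reindex)
  also have "\<dots> = (\<Sum>\<alpha>\<in>A. g \<alpha>)" by (rule sum.cong[OF refl assms(3)])
  finally show ?thesis by (simp only: mult_2)
qed

lemma two_rfun: "(2 :: 'n::finite rfun) \<noteq> 0"
proof
  assume "(2 :: 'n rfun) = 0"
  with cst_of_nat[of 2, where ?'a = 'n] have "cst 2 = (0 :: 'n rfun)" by simp
  then show False unfolding emb_eq_0_iff pcst_eq_0_iff by simp
qed

lemma regular_points_full: "regular_points A = {x. \<forall>\<alpha>\<in>full A. bil \<alpha> x \<noteq> 0}"
  by (auto simp: regular_points_def full_def bil_minus_left)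

lemma open_regular_points:
  assumes "finite (A :: (complex^'n::finite) set)"
  shows "open (regular_points A)"
proof -
  have "open {x. bil \<alpha> x \<noteq> 0}" for \<alpha> :: "complex^'n"
    by (rule open_Collect_neq)
      (auto intro: holo_on_imp_continuous_on poly_fun_holo poly_fun_bil continuous_on_const)
  then have "open (\<Inter>\<alpha>\<in>A. {x. bil \<alpha> x \<noteq> 0})" using assms by blast
  moreover have "(\<Inter>\<alpha>\<in>A. {x. bil \<alpha> x \<noteq> 0}) = regular_points A" by (auto simp: regular_points_def)
  ultimately show ?thesis by simp
qed

text \<open>The projection of \<beta> to the hyperplane is nonzero, so it has a nonzero coordinate;
  projecting the corresponding basis vector gives a point of the hyperplane where \<beta> does not
  vanish.\<close>

lemma lin_not_dvd:
  assumes ani: "bil \<alpha> \<alpha> \<noteq> 0" and par: "\<nexists>c. \<beta> = c *s \<alpha>"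
  shows "\<not> lin \<alpha> dvd lin \<beta>"
proof -
  define pr where "pr z = z - (bil \<alpha> z / bil \<alpha> \<alpha>) *s \<alpha>" for z
  have o: "bil \<alpha> (pr z) = 0" for z using ani by (simp add: pr_def bil_simps)
  have b: "\<beta> = (bil \<alpha> \<beta> / bil \<alpha> \<alpha>) *s \<alpha> + pr \<beta>" by (simp add: pr_def)
  have "pr \<beta> \<noteq> 0" using par b by (metis add.right_neutral)
  then obtain i where "pr \<beta> $ i \<noteq> 0" by (auto simp: vec_eq_iff)
  then have "bil (pr \<beta>) (axis i 1) \<noteq> 0" by (simp add: bil_axis_right)
  moreover have "bil (pr \<beta>) (axis i 1) = bil (pr \<beta>) (pr (axis i 1))"
    using o[of \<beta>] by (simp add: pr_def[of "axis i 1"] bil_simps bil_commute[of "pr \<beta>" \<alpha>])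
  moreover have "bil \<beta> (pr (axis i 1)) = bil (pr \<beta>) (pr (axis i 1))"
    using o[of "axis i 1"] by (subst b) (simp add: bil_simps)
  ultimately show ?thesis unfolding lin_dvd_iff[OF ani] ev_simps using o by metis
qed

lemma reg_upot:
  assumes "bil \<alpha> \<alpha> \<noteq> 0" "\<And>\<beta>. \<beta> \<in> A \<Longrightarrow> \<nexists>c. \<beta> = c *s \<alpha>"
  shows "reg \<alpha> (upot A k)"
  unfolding upot_def
proof (rule reg_sum[OF assms(1)])
  fix \<beta> assume "\<beta> \<in> A"
  then have nd: "\<not> lin \<alpha> dvd lin \<beta> ^ 2"
    using lin_not_dvd[OF assms(1) assms(2)] prime[OF assms(1)] prime_elem_dvd_power by blast
  show "reg \<alpha> (cst (k \<beta> * (k \<beta> + 1) * bil \<beta> \<beta>) / tt \<beta> ^ 2)"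
    using reg_divide[OF assms(1) reg_emb[OF assms(1)] nd] unfolding emb_power .
qed

lemma upot_split:
  "finite A \<Longrightarrow> \<alpha> \<in> A \<Longrightarrow> upot A k = cst (k \<alpha> * (k \<alpha> + 1) * bil \<alpha> \<alpha>) / tt \<alpha> ^ 2 + upot (A - {\<alpha>}) k"
  by (simp add: upot_def sum.remove)

lemma upot_invariant:
  assumes fin: "finite A" and ani: "bil \<alpha> \<alpha> \<noteq> 0"
    and anti: "\<And>\<beta>. \<beta> \<in> A \<Longrightarrow> - \<beta> \<notin> A" and even: "\<And>\<beta>. \<beta> \<in> A \<Longrightarrow> k (- \<beta>) = k \<beta>"
    and inv: "reflect \<alpha> ` full A = full A" "\<And>\<beta>. \<beta> \<in> full A \<Longrightarrow> k (reflect \<alpha> \<beta>) = k \<beta>"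
  shows "subf \<alpha> (upot A k) = upot A k"
proof -
  define g where "g \<beta> = cst (k \<beta> * (k \<beta> + 1) * bil \<beta> \<beta>) / tt \<beta> ^ 2" for \<beta>
  have m: "tt (- \<beta>) = - tt \<beta>" for \<beta> :: "complex^'a"
    unfolding emb_hom(4)[symmetric] emb_inj by (rule pol_eqI) (simp add: bil_simps)
  have ge: "g (- \<beta>) = g \<beta>" if "\<beta> \<in> A" for \<beta> using even[OF that] by (simp add: g_def m bil_simps)
  have gs: "subf \<alpha> (g \<beta>) = g (reflect \<alpha> \<beta>)" if "\<beta> \<in> full A" for \<beta>
    by (simp add: g_def subf_lin[OF ani] inv(2)[OF that] bil_reflect[OF ani])
  have inj: "inj_on (reflect \<alpha>) (full A)" by (rule inj_onI) (metis reflect_invol[OF ani])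
  have "2 * subf \<alpha> (upot A k) = 2 * (\<Sum>\<beta>\<in>A. subf \<alpha> (g \<beta>))" by (simp add: upot_def g_def subf_sum)
  also have "\<dots> = (\<Sum>\<beta>\<in>full A. subf \<alpha> (g \<beta>))"
    unfolding full_def by (rule sum_full[OF fin anti, symmetric]) (simp_all add: ge)
  also have "\<dots> = (\<Sum>\<beta>\<in>full A. g (reflect \<alpha> \<beta>))" by (intro sum.cong refl gs)
  also have "\<dots> = (\<Sum>\<beta>\<in>full A. g \<beta>)" by (subst (2) inv(1)[symmetric]) (simp add: sum.reindex[OF inj])
  also have "\<dots> = 2 * (\<Sum>\<beta>\<in>A. g \<beta>)"
    unfolding full_def by (rule sum_full[OF fin anti]) (simp_all add: ge)
  finally show ?thesis by (simp only: mult_left_cancel[OF two_rfun] upot_def g_def)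
qed

lemma eu_mult: "app eu (f * g) = app eu f * g + f * app eu g"
  by (simp add: eu_def app_sum sum.distrib sum_distrib_left sum_distrib_right algebra_simps)

lemma eu_upot:
  assumes "\<And>\<alpha>. \<alpha> \<in> A \<Longrightarrow> bil \<alpha> \<alpha> \<noteq> 0"
  shows "app eu (upot A k) = - 2 * upot A k"
proof -
  have "app eu (cst c / tt \<alpha> ^ 2) = - 2 * (cst c / tt \<alpha> ^ 2)" if "\<alpha> \<in> A" for \<alpha> and c
  proof -
    define t i where "t = tt \<alpha>" and "i = inverse t"
    have t: "t \<noteq> 0" "app eu t = t" using tt_nonzero[OF assms[OF that]] by (simp_all add: t_def app_eu_lin)
    have z: "app eu (cst c) = 0" for c by (simp add: eu_def app_sum emb_hom)
    have "app eu (t * i) = 0" using z[of 1] t(1) by (simp add: i_def pcst_hom emb_hom)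
    then have "t * i + t * app eu i = 0" by (simp add: eu_mult t(2))
    then have "t * (i + app eu i) = 0" by (simp only: distrib_left)
    then have "app eu i = - i" using t(1) by (simp add: eq_neg_iff_add_eq_0 add.commute)
    moreover have "cst c / t ^ 2 = cst c * (i * i)" by (simp add: i_def divide_inverse power2_eq_square)
    ultimately show ?thesis unfolding t_def[symmetric] by (simp add: eu_mult z)
  qed
  then show ?thesis by (simp add: upot_def app_sum_right sum_distrib_left)
qed

lemma eu_homogeneous:
  assumes "homogeneous r (ev q)"
  shows "app eu (emb q) = of_nat r * emb q"
proof -
  have "(\<Sum>i\<in>UNIV. pcrd i * pd (axis i 1) q) = pcst (of_nat r) * q"
  proof (rule pol_eqI)
    fix x :: "complex^'a"
    have s: "x + z *s x = (1 + z) *s x" for z by (simp add: vec_eq_iff algebra_simps)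
    have "ev q (x + z *s x) = (1 + z) ^ r * ev q x" for z
      unfolding s using assms unfolding homogeneous_def by blast
    then have "(\<lambda>z. ev q (x + z *s x)) = (\<lambda>z. (1 + z) ^ r * ev q x)" by (rule ext)
    moreover have "((\<lambda>z. (1 + z) ^ r * ev q x) has_field_derivative of_nat r * ev q x) (at 0)"
      by (auto intro!: derivative_eq_intros)
    ultimately have "ev (pd x q) x = of_nat r * ev q x" using ev_pd[of q x x] DERIV_unique by metis
    then show "ev (\<Sum>i\<in>UNIV. pcrd i * pd (axis i 1) q) x = ev (pcst (of_nat r) * q) x"
      by (simp add: ev_euler)
  qed
  then have "emb (\<Sum>i\<in>UNIV. pcrd i * pd (axis i 1) q) = of_nat r * emb q"
    by (simp add: emb_hom cst_of_nat)
  then show ?thesis by (simp add: eu_def app_sum emb_sum emb_hom)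
qed

lemma den_upot:
  assumes "finite T" "A \<subseteq> T" "\<And>\<alpha>. \<alpha> \<in> T \<Longrightarrow> bil \<alpha> \<alpha> \<noteq> 0"
  shows "den (\<Prod>\<alpha>\<in>T. lin \<alpha>) (upot A k)"
  unfolding upot_def
proof (rule den_sum)
  fix \<alpha> assume \<alpha>: "\<alpha> \<in> A"
  then have "(\<Prod>\<alpha>\<in>T. lin \<alpha>) = lin \<alpha> * (\<Prod>\<alpha>\<in>T - {\<alpha>}. lin \<alpha>)" using assms by (intro prod.remove) auto
  then have "inverse (tt \<alpha>) * emb (\<Prod>\<alpha>\<in>T. lin \<alpha>) ^ 1 = emb (\<Prod>\<alpha>\<in>T - {\<alpha>}. lin \<alpha>)"
    using tt_nonzero[OF assms(3), of \<alpha>] \<alpha> assms(2) by (auto simp: emb_hom)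
  then have "den (\<Prod>\<alpha>\<in>T. lin \<alpha>) (inverse (tt \<alpha>))" unfolding den_def by blast
  then have "den (\<Prod>\<alpha>\<in>T. lin \<alpha>) (cst (k \<alpha> * (k \<alpha> + 1) * bil \<alpha> \<alpha>) * (inverse (tt \<alpha>) * inverse (tt \<alpha>)))"
    by (intro den_mult den_emb)
  then show "den (\<Prod>\<alpha>\<in>T. lin \<alpha>) (cst (k \<alpha> * (k \<alpha> + 1) * bil \<alpha> \<alpha>) / tt \<alpha> ^ 2)"
    by (simp add: divide_inverse power2_eq_square)
qed

text \<open>A rational identity valid off finitely many hyperplanes holds identically.\<close>
lemma generically_divisible_reg:
  assumes div: "generically_divisible D f \<alpha> m" and rel: "rel D f \<psi>"
    and ani: "bil \<alpha> \<alpha> \<noteq> 0" and e: "e \<noteq> 0" "\<And>x. ev e x \<noteq> 0 \<Longrightarrow> x \<in> D"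
  shows "reg \<alpha> (\<psi> / tt \<alpha> ^ m)"
proof -
  obtain P Q y where PQ: "poly_fun P" "poly_fun Q" "bil \<alpha> y = 0" "Q y \<noteq> 0"
    "\<And>x. x \<in> D \<Longrightarrow> f x * Q x = bil \<alpha> x ^ m * P x"
    using div unfolding generically_divisible_def by blast
  define p q where "p = Pol P" and "q = Pol Q"
  have ev: "ev p = P" "ev q = Q" using PQ by (simp_all add: p_def q_def ev_Pol)
  obtain a b where ab: "\<psi> = emb a / emb b" "b \<noteq> 0" "\<And>x. x \<in> D \<Longrightarrow> ev b x \<noteq> 0"
    "\<And>x. x \<in> D \<Longrightarrow> f x = ev a x / ev b x" using rel by (rule relE) blast
  have q: "\<not> lin \<alpha> dvd q" using PQ(3,4) ani by (auto simp: lin_dvd_iff ev)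
  have "e * (a * q - lin \<alpha> ^ m * p * b) = 0"
  proof (rule pol_eqI)
    fix x
    show "ev (e * (a * q - lin \<alpha> ^ m * p * b)) x = ev 0 x"
    proof (cases "ev e x = 0")
      case False
      then have "x \<in> D" by (rule e(2))
      then have "ev a x / ev b x * ev q x = bil \<alpha> x ^ m * ev p x" "ev b x \<noteq> 0" using PQ(5) ab by (auto simp: ev)
      then show ?thesis by (simp add: field_simps)
    qed simp
  qed
  then have eq: "a * q = lin \<alpha> ^ m * p * b" using e(1) by simp
  have "q \<noteq> 0" using q by auto
  have "emb a * emb q = tt \<alpha> ^ m * emb p * emb b" using arg_cong[OF eq, of emb] by (simp add: emb_hom emb_power)
  moreover have "emb a = emb b * \<psi>" using ab(1,2) by simp
  ultimately have "emb b * (\<psi> * emb q) = emb b * (tt \<alpha> ^ m * emb p)" by (simp only: mult.assoc mult.commute[of _ "emb b"])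
  then have "\<psi> * emb q = tt \<alpha> ^ m * emb p" using ab(2) by (metis emb_eq_0_iff mult_left_cancel)
  then have "\<psi> / tt \<alpha> ^ m = emb p / emb q"
    using \<open>q \<noteq> 0\<close> tt_nonzero[OF ani] by (simp add: frac_eq_eq mult.commute)
  then show ?thesis using q by (auto simp: reg_def)
qed

section \<open>Locus configurations\<close>

context
  fixes W :: "(complex^'n::finite \<Rightarrow> complex^'n) set" and Rp Ap :: "(complex^'n) set"
    and k :: "complex^'n \<Rightarrow> complex"
  assumes lc: "locus_configuration W Rp Ap k"
begin

lemma fin: "finite Ap" and ani: "\<alpha> \<in> Ap \<Longrightarrow> bil \<alpha> \<alpha> \<noteq> 0"
  and par: "\<alpha> \<in> Ap \<Longrightarrow> \<beta> \<in> Ap \<Longrightarrow> \<alpha> \<noteq> \<beta> \<Longrightarrow> \<nexists>c. \<beta> = c *s \<alpha>"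
  and keven: "\<alpha> \<in> Ap \<Longrightarrow> k (- \<alpha>) = k \<alpha>"
  using lc unfolding locus_configuration_def configuration_def by blast+

text \<open>The roots with the signs chosen in \<open>Ap\<close>. The set \<open>Rp\<close> may use
  other signs and need not be contained in \<open>Ap\<close>; potentials and regular points do not
  depend on the signs.\<close>

definition R where "R = Ap \<inter> full Rp"

lemma R_subset: "R \<subseteq> Ap"
  by (simp add: R_def)

lemma full_Rp: "full Rp \<subseteq> full Ap"
  using lc unfolding locus_configuration_def by blast

lemma full_R: "full R = full Rp"
proof
  show "full R \<subseteq> full Rp"
  proof
    fix \<alpha> assume "\<alpha> \<in> full R"
    then have "\<alpha> \<in> R \<or> - \<alpha> \<in> R" by (simp only: in_full_iff)
    then have "\<alpha> \<in> full Rp \<or> - \<alpha> \<in> full Rp" by (auto simp: R_def)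
    then show "\<alpha> \<in> full Rp" using full_uminus[of "- \<alpha>" Rp] by auto
  qed
  show "full Rp \<subseteq> full R"
  proof
    fix \<alpha> assume a: "\<alpha> \<in> full Rp"
    then have "\<alpha> \<in> Ap \<or> - \<alpha> \<in> Ap" using full_Rp in_full_iff by blast
    then have "\<alpha> \<in> R \<or> - \<alpha> \<in> R" using a full_uminus[OF a] by (auto simp: R_def)
    then show "\<alpha> \<in> full R" by (simp only: in_full_iff)
  qed
qed

lemma Ap_minus_R: "Ap - R = Ap - full Rp"
  by (auto simp: R_def)

lemma regular_points_R: "regular_points Rp = regular_points R"
  by (simp add: regular_points_full full_R)

lemma keven_full: "\<alpha> \<in> full Ap \<Longrightarrow> k (- \<alpha>) = k \<alpha>"
  using keven by (auto simp: full_def)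

lemma antipodal: "\<alpha> \<in> Ap \<Longrightarrow> - \<alpha> \<notin> Ap"
proof
  assume a: "\<alpha> \<in> Ap" "- \<alpha> \<in> Ap"
  have "\<alpha> \<noteq> - \<alpha>"
  proof
    assume "\<alpha> = - \<alpha>"
    then have "bil \<alpha> \<alpha> = - bil \<alpha> \<alpha>" by (metis bil_minus_left)
    then show False using ani[OF a(1)] by simp
  qed
  moreover have "- \<alpha> = (- 1) *s \<alpha>" by (simp add: vec_eq_iff)
  ultimately show False using par[OF a] by blast
qed

lemma potential_R: "potential Rp k = potential R k"
proof
  fix x :: "complex^'n"
  define g where "g \<alpha> = k \<alpha> * (k \<alpha> + 1) * bil \<alpha> \<alpha> / (bil \<alpha> x)\<^sup>2" for \<alpha>
  have g: "g (- \<alpha>) = g \<alpha>" if "\<alpha> \<in> full Ap" for \<alpha>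
    using keven_full[OF that] by (simp add: g_def bil_simps)
  have root: "\<And>\<alpha>. \<alpha> \<in> Rp \<Longrightarrow> bil \<alpha> \<alpha> \<noteq> 0" "inj_on reflect Rp"
    using lc unfolding locus_configuration_def root_system_def bij_betw_def by blast+
  have anti: "- \<alpha> \<notin> Rp" if "\<alpha> \<in> Rp" for \<alpha>
  proof
    assume "- \<alpha> \<in> Rp"
    then have "- \<alpha> = \<alpha>" using root(2) that reflect_minus_root[of \<alpha>] by (auto dest: inj_onD)
    then have "bil \<alpha> \<alpha> = - bil \<alpha> \<alpha>" by (metis bil_minus_left)
    then show False using root(1)[OF that] by simp
  qed
  have RpA: "Rp \<subseteq> full Ap" using full_Rp by (auto simp: full_def)
  have "finite (full Ap)" using fin by (simp add: full_def)
  then have finRp: "finite Rp" using RpA finite_subset by blast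
  have "2 * (\<Sum>\<alpha>\<in>Rp. g \<alpha>) = (\<Sum>\<alpha>\<in>full Rp. g \<alpha>)"
    unfolding full_def by (rule sum_full[symmetric, OF finRp anti]) (use g RpA in auto)
  also have "\<dots> = 2 * (\<Sum>\<alpha>\<in>R. g \<alpha>)"
    unfolding full_R[symmetric] unfolding full_def
    by (rule sum_full) (use fin R_subset antipodal g in \<open>auto intro: finite_subset simp: full_def\<close>)
  finally show "potential Rp k x = potential R k x" by (simp add: potential_def g_def)
qed

lemma L_op_R: "L_op Rp k = L_op R k" and L_osc_R: "L_osc \<omega> Rp k = L_osc \<omega> R k"
  by (simp_all add: fun_eq_iff L_op_def L_osc_def potential_R)

lemma reflect_in_W: "\<alpha> \<in> R \<Longrightarrow> reflect \<alpha> \<in> W"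
proof -
  assume "\<alpha> \<in> R"
  then have "\<alpha> \<in> Rp \<or> - \<alpha> \<in> Rp" by (simp add: R_def in_full_iff)
  moreover have "reflect \<beta> \<in> W" if "\<beta> \<in> Rp" for \<beta>
  proof -
    have "reflect ` Rp = reflections_in W"
      using lc unfolding locus_configuration_def root_system_def bij_betw_def by blast
    then show ?thesis using that by (auto simp: reflections_in_def)
  qed
  ultimately show ?thesis using reflect_minus_root[of \<alpha>] by metis
qed

lemma W_invariant: "w \<in> W \<Longrightarrow> w ` full Ap = full Ap" "w \<in> W \<Longrightarrow> w ` full R = full R"
    "w \<in> W \<Longrightarrow> \<alpha> \<in> full Ap \<Longrightarrow> k (w \<alpha>) = k \<alpha>"
  using lc unfolding full_R locus_configuration_def root_system_def by blast+

text \<open>The reflection in \<alpha> belongs to \<open>W\<close>, so it preserves the potential.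
  Removing the term of \<alpha>, which is even by itself, leaves an even function, regular because
  no other vector is parallel to \<alpha>.\<close>

lemma even_potential:
  assumes \<alpha>: "\<alpha> \<in> R" and A: "A = Ap \<or> A = R"
  shows "\<exists>v. upot A k = cst (k \<alpha> * (k \<alpha> + 1) * bil \<alpha> \<alpha>) / tt \<alpha> ^ 2 + v \<and> reg \<alpha> v \<and> subf \<alpha> v = v"
proof -
  have sub: "A \<subseteq> Ap" "\<alpha> \<in> A" using A R_subset \<alpha> by auto
  then have "\<alpha> \<in> Ap" by auto
  note a = ani[OF this]
  have finA: "finite A" using sub fin finite_subset by blast
  note W = reflect_in_W[OF \<alpha>]
  have inv: "subf \<alpha> (upot A k) = upot A k"
  proof (rule upot_invariant[OF finA a])
    show "reflect \<alpha> ` full A = full A" using W_invariant(1,2)[OF W] A by auto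
    fix \<beta>
    show "\<beta> \<in> A \<Longrightarrow> - \<beta> \<notin> A" using antipodal sub by blast
    show "\<beta> \<in> A \<Longrightarrow> k (- \<beta>) = k \<beta>" using keven sub by blast
    assume "\<beta> \<in> full A"
    then have "\<beta> \<in> full Ap" using sub(1) by (auto simp: full_def)
    then show "k (reflect \<alpha> \<beta>) = k \<beta>" by (rule W_invariant(3)[OF W])
  qed
  note s = upot_split[OF finA sub(2), of k]
  have t: "subf \<alpha> (cst c / tt \<alpha> ^ 2) = cst c / tt \<alpha> ^ 2" for c
    by (simp only: subf_divide subf_cst subf_power subf_lin_self[OF a] power2_minus)
  have "subf \<alpha> (upot (A - {\<alpha>}) k) = upot (A - {\<alpha>}) k"
  proof -
    have "cst (k \<alpha> * (k \<alpha> + 1) * bil \<alpha> \<alpha>) / tt \<alpha> ^ 2 + subf \<alpha> (upot (A - {\<alpha>}) k) =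
        cst (k \<alpha> * (k \<alpha> + 1) * bil \<alpha> \<alpha>) / tt \<alpha> ^ 2 + upot (A - {\<alpha>}) k"
      using inv unfolding s subf_add t .
    then show ?thesis by (rule add_left_imp_eq)
  qed
  moreover have "reg \<alpha> (upot (A - {\<alpha>}) k)"
  proof (rule reg_upot[OF a])
    fix \<beta> assume "\<beta> \<in> A - {\<alpha>}"
    then have "\<beta> \<in> Ap" "\<alpha> \<noteq> \<beta>" using sub by auto
    then show "\<nexists>c. \<beta> = c *s \<alpha>" by (rule par[OF \<open>\<alpha> \<in> Ap\<close>])
  qed
  ultimately show ?thesis using s by (intro exI conjI)
qed

text \<open>The term of \<alpha> is even and drops out of the difference in the locus condition,
  which thus becomes a condition on the regular remainder \<open>v\<close>.\<close>

lemma locus_potential: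
  assumes \<alpha>: "\<alpha> \<in> Ap - R"
  defines "K \<equiv> nat_mult k \<alpha>"
  shows "\<exists>v. upot Ap k = of_nat (K * Suc K) * cst (bil \<alpha> \<alpha>) / tt \<alpha> ^ 2 + v \<and> locmult \<alpha> K v"
proof -
  have \<alpha>': "\<alpha> \<in> Ap" "\<alpha> \<in> full Ap - full Rp" using \<alpha> by (auto simp: R_def full_def)
  note a = ani[OF \<alpha>'(1)]
  define D where "D = {x. x \<in> regular_points Ap \<and> reflect \<alpha> x \<in> regular_points Ap}"
  have kN: "k \<alpha> \<in> \<nat>" and div: "generically_divisible D (\<lambda>x. potential Ap k x - potential Ap k (reflect \<alpha> x)) \<alpha> (2 * K)"
    using lc \<alpha>'(2) unfolding locus_configuration_def D_def K_def by blast+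
  then obtain m where "k \<alpha> = of_nat m" by (auto elim: Nats_cases)
  then have kK: "k \<alpha> = of_nat K" by (simp add: K_def nat_mult_def)
  define v where "v = upot (Ap - {\<alpha>}) k"
  have "k \<alpha> * (k \<alpha> + 1) * bil \<alpha> \<alpha> = of_nat (K * Suc K) * bil \<alpha> \<alpha>" by (simp add: kK algebra_simps)
  then have u: "upot Ap k = of_nat (K * Suc K) * cst (bil \<alpha> \<alpha>) / tt \<alpha> ^ 2 + v"
    using upot_split[OF fin \<alpha>'(1), of k] by (simp only: v_def pcst_hom emb_hom cst_of_nat)
  have v: "reg \<alpha> v" unfolding v_def
  proof (rule reg_upot[OF a])
    fix \<beta> assume "\<beta> \<in> Ap - {\<alpha>}"
    then have "\<beta> \<in> Ap" "\<alpha> \<noteq> \<beta>" by auto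
    then show "\<nexists>c. \<beta> = c *s \<alpha>" by (rule par[OF \<alpha>'(1)])
  qed
  have rel: "rel (regular_points Ap) (potential Ap k) (upot Ap k)"
    by (rule rel_potential[OF ani subset_refl])
  have "rel D (\<lambda>x. potential Ap k x - potential Ap k (reflect \<alpha> x)) (upot Ap k - subf \<alpha> (upot Ap k))"
    by (intro rel_diff rel_subset[OF rel] rel_subset[OF rel_reflect[OF rel a]]) (auto simp: D_def)
  \<comment> \<open>The set \<open>D\<close> contains all points where \<open>e\<close> is nonzero,
    so a polynomial identity on \<open>D\<close> extends after multiplication by
    \<open>e\<close>.\<close>
  moreover define e where "e = (\<Prod>\<beta>\<in>Ap. lin \<beta>) * psub \<alpha> (\<Prod>\<beta>\<in>Ap. lin \<beta>)"
  have "(\<Prod>\<beta>\<in>Ap. lin \<beta>) \<noteq> 0" unfolding prod_zero_iff[OF fin] using lin_nonzero[OF ani] by blast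
  then have "e \<noteq> 0" by (simp add: e_def psub_eq_0_iff[OF a])
  moreover have "x \<in> D" if "ev e x \<noteq> 0" for x
    using that fin by (simp add: e_def D_def regular_points_def prod_zero_iff)
  ultimately have "reg \<alpha> ((upot Ap k - subf \<alpha> (upot Ap k)) / tt \<alpha> ^ (2 * K))"
    using generically_divisible_reg[OF div _ a] by blast
  moreover have "subf \<alpha> (of_nat (K * Suc K)) = of_nat (K * Suc K)"
    using subf_cst[of \<alpha> "of_nat (K * Suc K)"] by (simp only: cst_of_nat)
  then have "upot Ap k - subf \<alpha> (upot Ap k) = v - subf \<alpha> v"
    unfolding u by (simp add: subf_lin_self[OF a] del: of_nat_mult of_nat_Suc)
  ultimately have "locmult \<alpha> K v" using locmultI[OF a v] by simp
  then show ?thesis using u by blast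
qed

lemma invariant_psub:
  assumes "ev q \<in> invariant_polys W" "\<alpha> \<in> R"
  shows "psub \<alpha> q = q"
  using assms reflect_in_W by (intro pol_eqI) (auto simp: invariant_polys_def)

lemma nilpotent_R:
  assumes "ev q \<in> invariant_polys W" "homogeneous r (ev q)"
  shows "(adj (upot R k) (upot R k) ^^ Suc r) (mul (emb q)) = 0"
proof (rule adj_nilpotent[of R])
  show "finite R" using fin R_subset finite_subset by blast
  show an: "bil \<alpha> \<alpha> \<noteq> 0" if "\<alpha> \<in> R" for \<alpha> using ani R_subset that by blast
  show "den (\<Prod>\<alpha>\<in>R. lin \<alpha>) (upot R k)" "den (\<Prod>\<alpha>\<in>R. lin \<alpha>) (upot R k)"
    by (intro den_upot \<open>finite R\<close> subset_refl an; assumption)+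
  show "app eu (upot R k) = - 2 * upot R k" "app eu (upot R k) = - 2 * upot R k"
    by (intro eu_upot an; assumption)+
  show "app eu (emb q) = of_nat r * emb q" by (rule eu_homogeneous[OF assms(2)])
  fix \<alpha> assume \<alpha>: "\<alpha> \<in> R"
  obtain v where "upot R k = cst (k \<alpha> * (k \<alpha> + 1) * bil \<alpha> \<alpha>) / tt \<alpha> ^ 2 + v" "reg \<alpha> v" "subf \<alpha> v = v"
    using even_potential[OF \<alpha>, of R] by blast
  then show "(\<exists>c v1 v2. upot R k = cst c / tt \<alpha> ^ 2 + v1 \<and> reg \<alpha> v1 \<and> subf \<alpha> v1 = v1 \<and>
        upot R k = cst c / tt \<alpha> ^ 2 + v2 \<and> reg \<alpha> v2 \<and> subf \<alpha> v2 = v2 \<and> psub \<alpha> q = q) \<or>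
      (\<exists>K. \<forall>j. bounded \<alpha> K ((adj (upot R k) (upot R k) ^^ j) (mul (emb q))))"
    using invariant_psub[OF assms(1) \<alpha>] by blast
qed

lemma den_Ap: "A \<subseteq> Ap \<Longrightarrow> den (\<Prod>\<alpha>\<in>Ap. lin \<alpha>) (upot A k)"
  by (rule den_upot[OF fin _ ani])

lemma nilpotent_Ap:
  assumes q: "ev q \<in> quasi_invariants W Rp Ap k" and hom: "homogeneous r (ev q)"
  shows "(adj (upot Ap k) (upot Ap k) ^^ Suc r) (mul (emb q)) = 0"
proof (rule adj_nilpotent[OF fin ani den_Ap[OF subset_refl] den_Ap[OF subset_refl] eu_upot[OF ani]
      eu_upot[OF ani] eu_homogeneous[OF hom]])
  fix \<alpha> assume \<alpha>: "\<alpha> \<in> Ap"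
  note a = ani[OF \<alpha>]
  show "(\<exists>c v1 v2. upot Ap k = cst c / tt \<alpha> ^ 2 + v1 \<and> reg \<alpha> v1 \<and> subf \<alpha> v1 = v1 \<and>
        upot Ap k = cst c / tt \<alpha> ^ 2 + v2 \<and> reg \<alpha> v2 \<and> subf \<alpha> v2 = v2 \<and> psub \<alpha> q = q) \<or>
      (\<exists>K. \<forall>j. bounded \<alpha> K ((adj (upot Ap k) (upot Ap k) ^^ j) (mul (emb q))))"
  proof (cases "\<alpha> \<in> R")
    case True
    obtain v where "upot Ap k = cst (k \<alpha> * (k \<alpha> + 1) * bil \<alpha> \<alpha>) / tt \<alpha> ^ 2 + v" "reg \<alpha> v" "subf \<alpha> v = v"
      using even_potential[OF True, of Ap] by blast
    moreover have "psub \<alpha> q = q" using q True by (intro invariant_psub) (auto simp: quasi_invariants_def)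
    ultimately show ?thesis by blast
  next
    case False
    define K where "K = nat_mult k \<alpha>"
    obtain v where v: "upot Ap k = of_nat (K * Suc K) * cst (bil \<alpha> \<alpha>) / tt \<alpha> ^ 2 + v" "locmult \<alpha> K v"
      using locus_potential[of \<alpha>] \<alpha> False unfolding K_def by blast
    have "\<alpha> \<in> Ap - full Rp" using \<alpha> False by (simp add: R_def)
    then obtain p where p: "poly_fun p" "\<And>x. ev q x - ev q (reflect \<alpha> x) = bil \<alpha> x ^ (2 * K) * p x"
      using q unfolding quasi_invariants_def K_def by blast
    have "q - psub \<alpha> q = lin \<alpha> ^ (2 * K) * Pol p"
      by (rule pol_eqI) (simp add: p ev_Pol)
    from arg_cong[OF this, of emb] have "emb q - subf \<alpha> (emb q) = tt \<alpha> ^ (2 * K) * emb (Pol p)"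
      by (simp only: subf_emb[OF a] emb_power emb_hom)
    then have "(emb q - subf \<alpha> (emb q)) / tt \<alpha> ^ (2 * K) = emb (Pol p)"
      using tt_nonzero[OF a] by simp
    \<comment> \<open>Quasi-invariance of \<open>q\<close> is the same divisibility as the locus
      condition on the potential, so multiplication by \<open>q\<close> preserves the same space of
      functions.\<close>
    then have q': "locmult \<alpha> K (emb q)" by (intro locmultI[OF a] reg_emb[OF a]) (simp add: reg_emb[OF a])
    have "bounded \<alpha> K ((adj (upot Ap k) (upot Ap k) ^^ j) (mul (emb q)))" for j
      by (rule bounded_adj_locmod[OF a, of "locmod \<alpha> K" K "upot Ap k" "emb q" "upot Ap k" v j,
            OF locmod_regular_multiple[OF a] locmod_lop[OF a v] locmod_mult[OF a q'] v])
    then show ?thesis by blast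
  qed
qed

definition dpol :: "'n pol" where
  "dpol = (\<Prod>\<alpha>\<in>Ap - R. lin \<alpha> ^ nat_mult k \<alpha>)"

lemma ev_dpol: "ev dpol = delta Rp Ap k"
  by (simp add: fun_eq_iff dpol_def delta_def Ap_minus_R)

lemma homogeneous_dpol: "homogeneous (deg_delta Rp Ap k) (ev dpol)"
  unfolding homogeneous_def
  by (simp add: dpol_def deg_delta_def Ap_minus_R bil_simps power_mult_distrib prod.distrib power_sum)

text \<open>The reflection permutes the factors only up to sign, so it is first seen to preserve the
  square: the product over both signs is a constant times this square. Hence \<open>dpol\<close> is
  even or odd; an odd one would be divisible by (\<alpha>,x), but no factor is parallel to
  \<alpha>.\<close>

lemma dpol_invariant:
  assumes \<alpha>: "\<alpha> \<in> R"
  shows "psub \<alpha> dpol = dpol"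
proof -
  have \<alpha>': "\<alpha> \<in> Ap" using \<alpha> R_subset by blast
  note a = ani[OF \<alpha>'] and W = reflect_in_W[OF \<alpha>]
  define F where "F = full Ap - full Rp"
  define h where "h \<beta> = lin \<beta> ^ nat_mult k \<beta>" for \<beta>
  define e :: "'n pol" where "e = (\<Prod>\<beta>\<in>Ap - R. (- 1) ^ nat_mult k \<beta>)"
  have F: "F = (Ap - R) \<union> uminus ` (Ap - R)"
  proof -
    have "\<beta> \<in> full Rp \<longleftrightarrow> - \<beta> \<in> full Rp" for \<beta> using full_uminus[of \<beta> Rp] full_uminus[of "- \<beta>" Rp] by auto
    then show ?thesis unfolding F_def Ap_minus_R by (auto simp: full_def[of Ap])
  qed
  have m: "lin (- \<beta>) = - lin \<beta>" for \<beta> :: "complex^'n" by (rule pol_eqI) (simp add: bil_simps)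
  have he: "h (- \<beta>) = (- 1) ^ nat_mult k \<beta> * h \<beta>" if "\<beta> \<in> Ap" for \<beta>
    using keven[OF that] power_minus[of "lin \<beta>"] by (simp add: h_def m nat_mult_def)
  have "(\<Prod>\<beta>\<in>F. h \<beta>) = (\<Prod>\<beta>\<in>Ap - R. h \<beta>) * (\<Prod>\<beta>\<in>uminus ` (Ap - R). h \<beta>)"
    unfolding F using fin antipodal by (intro prod.union_disjoint) auto
  also have "(\<Prod>\<beta>\<in>uminus ` (Ap - R). h \<beta>) = (\<Prod>\<beta>\<in>Ap - R. h (- \<beta>))" by (simp add: prod.reindex)
  also have "\<dots> = (\<Prod>\<beta>\<in>Ap - R. (- 1) ^ nat_mult k \<beta> * h \<beta>)" by (intro prod.cong refl he) simp
  also have "\<dots> = e * (\<Prod>\<beta>\<in>Ap - R. h \<beta>)" by (simp add: e_def prod.distrib)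
  also have "(\<Prod>\<beta>\<in>Ap - R. h \<beta>) = dpol" by (simp add: h_def dpol_def)
  finally have hF: "(\<Prod>\<beta>\<in>F. h \<beta>) = e * dpol ^ 2" by (simp add: power2_eq_square mult.left_commute)
  have p: "psub \<alpha> (x ^ n) = psub \<alpha> x ^ n" for x n by (induction n) auto
  have hs: "psub \<alpha> (h \<beta>) = h (reflect \<alpha> \<beta>)" if "\<beta> \<in> full Ap" for \<beta>
  proof -
    have "psub \<alpha> (lin \<beta>) = lin (reflect \<alpha> \<beta>)" by (rule pol_eqI) (simp add: reflect_adjoint)
    then show ?thesis using W_invariant(3)[OF W that] by (simp add: h_def p nat_mult_def)
  qed
  have inj: "inj_on (reflect \<alpha>) S" for S by (rule inj_onI) (metis reflect_invol[OF a])
  have imF: "reflect \<alpha> ` F = F"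
    unfolding F_def image_set_diff[OF inj] using W_invariant(1,2)[OF W] by (simp add: full_R)
  have pp: "psub \<alpha> (prod g S) = (\<Prod>\<beta>\<in>S. psub \<alpha> (g \<beta>))" for g :: "complex^'n \<Rightarrow> 'n pol" and S
    by (induction S rule: infinite_finite_induct) auto
  have "psub \<alpha> (\<Prod>\<beta>\<in>F. h \<beta>) = (\<Prod>\<beta>\<in>F. h (reflect \<alpha> \<beta>))"
    unfolding pp by (intro prod.cong refl hs) (simp add: F_def)
  also have "\<dots> = (\<Prod>\<beta>\<in>F. h \<beta>)" by (subst (2) imF[symmetric]) (simp add: prod.reindex[OF inj])
  finally have "psub \<alpha> e * psub \<alpha> dpol ^ 2 = e * dpol ^ 2" unfolding hF by (simp add: p)
  moreover have "psub \<alpha> e = e" unfolding e_def pp by (simp add: p)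
  moreover have "e \<noteq> 0" using fin by (simp add: e_def prod_zero_iff)
  ultimately have "psub \<alpha> dpol = dpol \<or> psub \<alpha> dpol = - dpol" by (simp add: power2_eq_iff)
  moreover have "\<not> lin \<alpha> dvd dpol"
  proof -
    have "\<not> lin \<alpha> dvd (\<Prod>\<beta>\<in>S. lin \<beta> ^ nat_mult k \<beta>)" if "S \<subseteq> Ap - R" for S
      using finite_subset[OF that] fin that
    proof (induction S rule: infinite_finite_induct)
      case empty
      show ?case using prime[OF a] by (auto simp: prime_elem_def)
    next
      case (insert \<beta> S)
      then have "\<beta> \<in> Ap" "\<alpha> \<noteq> \<beta>" using \<alpha> by auto
      then have "\<not> lin \<alpha> dvd lin \<beta>" by (intro lin_not_dvd[OF a] par[OF \<alpha>'])
      then have "\<not> lin \<alpha> dvd lin \<beta> ^ nat_mult k \<beta>" using prime_elem_dvd_power[OF prime[OF a]] by blast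
      moreover have "\<not> lin \<alpha> dvd (\<Prod>\<beta>\<in>S. lin \<beta> ^ nat_mult k \<beta>)" using insert by simp
      ultimately show ?case using insert.hyps prime_elem_dvd_mult_iff[OF prime[OF a]] by simp
    qed simp
    then show ?thesis by (simp add: dpol_def)
  qed
  ultimately show ?thesis using lin_dvd_odd[OF a] by blast
qed

lemma nilpotent_S:
  "(adj (upot Ap k) (upot R k) ^^ Suc (deg_delta Rp Ap k)) (mul (emb dpol)) = 0"
proof (rule adj_nilpotent[OF fin ani den_Ap[OF subset_refl] den_Ap[OF R_subset] eu_upot[OF ani]
      eu_upot eu_homogeneous[OF homogeneous_dpol]])
  show "\<alpha> \<in> R \<Longrightarrow> bil \<alpha> \<alpha> \<noteq> 0" for \<alpha> using ani R_subset by blast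
  fix \<alpha> assume \<alpha>: "\<alpha> \<in> Ap"
  note a = ani[OF \<alpha>]
  show "(\<exists>c v1 v2. upot Ap k = cst c / tt \<alpha> ^ 2 + v1 \<and> reg \<alpha> v1 \<and> subf \<alpha> v1 = v1 \<and>
        upot R k = cst c / tt \<alpha> ^ 2 + v2 \<and> reg \<alpha> v2 \<and> subf \<alpha> v2 = v2 \<and> psub \<alpha> dpol = dpol) \<or>
      (\<exists>K. \<forall>j. bounded \<alpha> K ((adj (upot Ap k) (upot R k) ^^ j) (mul (emb dpol))))"
  proof (cases "\<alpha> \<in> R")
    case True
    obtain v where "upot Ap k = cst (k \<alpha> * (k \<alpha> + 1) * bil \<alpha> \<alpha>) / tt \<alpha> ^ 2 + v" "reg \<alpha> v" "subf \<alpha> v = v"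
      using even_potential[OF True, of Ap] by blast
    moreover obtain w where "upot R k = cst (k \<alpha> * (k \<alpha> + 1) * bil \<alpha> \<alpha>) / tt \<alpha> ^ 2 + w" "reg \<alpha> w" "subf \<alpha> w = w"
      using even_potential[OF True, of R] by blast
    ultimately show ?thesis using dpol_invariant[OF True] by blast
  next
    case False
    define K where "K = nat_mult k \<alpha>"
    obtain v where v: "upot Ap k = of_nat (K * Suc K) * cst (bil \<alpha> \<alpha>) / tt \<alpha> ^ 2 + v" "locmult \<alpha> K v"
      using locus_potential[of \<alpha>] \<alpha> False unfolding K_def by blast
    define d where "d = (\<Prod>\<beta>\<in>Ap - R - {\<alpha>}. lin \<beta> ^ nat_mult k \<beta>)"
    \<comment> \<open>The factor of order \<open>K\<close> is exactly what carries regular functions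
      into \<open>locmod \<alpha> K\<close>; on the source side the potential of \<open>W\<close>
      has no pole at this hyperplane.\<close>
    have d: "dpol = lin \<alpha> ^ K * d"
      unfolding dpol_def d_def K_def using \<alpha> False fin by (intro prod.remove) auto
    have u2: "reg \<alpha> (upot R k)"
    proof (rule reg_upot[OF a])
      fix \<beta> assume "\<beta> \<in> R"
      then have "\<beta> \<in> Ap" "\<alpha> \<noteq> \<beta>" using R_subset False by auto
      then show "\<nexists>c. \<beta> = c *s \<alpha>" by (rule par[OF \<alpha>])
    qed
    have src: "reg \<alpha> (tt \<alpha> ^ K * f)" if "reg \<alpha> f" for f
      by (intro reg_mult[OF a] reg_power[OF a] reg_emb[OF a] that)
    have q: "locmod \<alpha> K (emb dpol * f)" if "reg \<alpha> f" for f
      using locmod_regular_multiple[OF a reg_mult[OF a reg_emb[OF a, of d] that], of K]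
      by (simp add: d emb_hom emb_power mult.assoc)
    have "bounded \<alpha> K ((adj (upot Ap k) (upot R k) ^^ j) (mul (emb dpol)))" for j
      by (rule bounded_adj_locmod[OF a, of "reg \<alpha>" K "upot R k" "emb dpol" "upot Ap k" v j,
            OF src regular_lop[OF a u2] q v])
    then show ?thesis by blast
  qed
qed

lemma deg_pow:
  assumes "homogeneous r (ev q)" "A = Ap \<or> A = R" "B = Ap \<or> B = R"
  shows "deg (- int r) ((adj (upot A k) (upot B k) ^^ r) (mul (emb q)))"
proof -
  have an: "\<And>\<alpha>. \<alpha> \<in> A \<Longrightarrow> bil \<alpha> \<alpha> \<noteq> 0" "\<And>\<alpha>. \<alpha> \<in> B \<Longrightarrow> bil \<alpha> \<alpha> \<noteq> 0"
    using assms(2,3) R_subset ani by auto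
  have "deg (int r) (mul (emb q))" by (rule deg_mul) (simp add: eu_homogeneous[OF assms(1)])
  from deg_adj_pow[OF this eu_upot[OF an(1), where k = k] eu_upot[OF an(2), where k = k], where j = r] show ?thesis by simp
qed

lemma rel_R: "rel (regular_points R) (potential R k) (upot R k)"
  by (rule rel_potential[OF _ subset_refl]) (use R_subset ani in auto)

lemma rel_Ap: "rel (regular_points Ap) (potential Ap k) (upot Ap k)"
  by (rule rel_potential[OF ani subset_refl])

lemma rel_R_Ap: "rel (regular_points Ap) (potential R k) (upot R k)"
  by (rule rel_subset[OF rel_R]) (use R_subset in \<open>auto simp: regular_points_def\<close>)

lemmas open_Ap = open_regular_points[OF fin]
lemmas open_R = open_regular_points[OF finite_subset[OF R_subset fin]]

lemma S_op_eq: "S_op Rp Ap k = op_scale (1 / (2 ^ deg_delta Rp Ap k * fact (deg_delta Rp Ap k)))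
    ((ad (L_op Ap k) (L_op R k) ^^ deg_delta Rp Ap k) (mult_op (ev dpol)))"
  by (simp add: S_op_def Let_def ev_dpol L_op_R)

lemmas S_context = open_Ap rel_Ap rel_R_Ap nilpotent_S deg_pow[OF homogeneous_dpol disjI1[OF refl] disjI2[OF refl]]

lemma conjugated_S:
  shows "op_eq (regular_points Ap) (L_osc \<omega> Ap k \<circ> gauss_conj \<omega> (S_op Rp Ap k))
      (gauss_conj \<omega> (S_op Rp Ap k) \<circ> op_shift (L_osc \<omega> Rp k) (2 * \<omega> * of_nat (deg_delta Rp Ap k)))"
    and "\<exists>T. formal_adjoint (regular_points Ap) (gauss_conj \<omega> (S_op Rp Ap k)) T"
    and "formal_adjoint (regular_points Ap) (gauss_conj \<omega> (S_op Rp Ap k)) T \<Longrightarrow>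
      op_commute (regular_points Ap) (gauss_conj \<omega> (S_op Rp Ap k) \<circ> T) (L_osc \<omega> Ap k)"
  unfolding S_op_eq L_osc_R
  by (rule conj_intertwining_op[OF S_context] conj_adjoint_exists[OF S_context]
      conj_adjoint_commute[OF S_context], assumption?)+

text \<open>Only the mirrors of \<open>W\<close> are singular here, so the relations hold on the
  larger open set \<open>regular_points Rp\<close>.\<close>

lemma conjugated_L_W:
  assumes "q \<in> invariant_polys W" "homogeneous r q"
  shows "op_eq (regular_points Rp) (gauss_conj \<omega> (Lq_op Rp k r q) \<circ> L_osc \<omega> Rp k)
      (op_shift (L_osc \<omega> Rp k) (- 2 * \<omega> * of_nat r) \<circ> gauss_conj \<omega> (Lq_op Rp k r q))"
    and "op_commute (regular_points Rp)
      (gauss_conj \<omega> (Lq_op Rp k r q) \<circ> gauss_conj (- \<omega>) (Lq_op Rp k r q)) (L_osc \<omega> Rp k)"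
proof -
  have q: "ev (Pol q) = q" using assms(1) by (intro ev_Pol) (simp add: invariant_polys_def)
  have a: "ev (Pol q) \<in> invariant_polys W" "homogeneous r (ev (Pol q))" using assms by (simp_all only: q)
  note c = open_R rel_R rel_R nilpotent_R[OF a] deg_pow[OF a(2) disjI2[OF refl] disjI2[OF refl]]
  show "op_eq (regular_points Rp) (gauss_conj \<omega> (Lq_op Rp k r q) \<circ> L_osc \<omega> Rp k)
      (op_shift (L_osc \<omega> Rp k) (- 2 * \<omega> * of_nat r) \<circ> gauss_conj \<omega> (Lq_op Rp k r q))"
    using conj_shift[OF c refl refl] unfolding Lq_op_def L_op_R L_osc_R regular_points_R q .
  show "op_commute (regular_points Rp)
      (gauss_conj \<omega> (Lq_op Rp k r q) \<circ> gauss_conj (- \<omega>) (Lq_op Rp k r q)) (L_osc \<omega> Rp k)"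
    using conj_product_commute[OF c refl refl] unfolding Lq_op_def L_op_R L_osc_R regular_points_R q .
qed

lemma conjugated_L_Ap:
  assumes "q \<in> quasi_invariants W Rp Ap k" "homogeneous r q"
  shows "op_eq (regular_points Ap) (gauss_conj \<omega> (Lq_op Ap k r q) \<circ> L_osc \<omega> Ap k)
      (op_shift (L_osc \<omega> Ap k) (- 2 * \<omega> * of_nat r) \<circ> gauss_conj \<omega> (Lq_op Ap k r q))"
    and "op_commute (regular_points Ap)
      (gauss_conj \<omega> (Lq_op Ap k r q) \<circ> gauss_conj (- \<omega>) (Lq_op Ap k r q)) (L_osc \<omega> Ap k)"
proof -
  have q: "ev (Pol q) = q"
    using assms(1) by (intro ev_Pol) (simp add: quasi_invariants_def invariant_polys_def)
  have a: "ev (Pol q) \<in> quasi_invariants W Rp Ap k" "homogeneous r (ev (Pol q))"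
    using assms by (simp_all only: q)
  note c = open_Ap rel_Ap rel_Ap nilpotent_Ap[OF a] deg_pow[OF a(2) disjI1[OF refl] disjI1[OF refl]]
  show "op_eq (regular_points Ap) (gauss_conj \<omega> (Lq_op Ap k r q) \<circ> L_osc \<omega> Ap k)
      (op_shift (L_osc \<omega> Ap k) (- 2 * \<omega> * of_nat r) \<circ> gauss_conj \<omega> (Lq_op Ap k r q))"
    using conj_shift[OF c refl refl] unfolding Lq_op_def q .
  show "op_commute (regular_points Ap)
      (gauss_conj \<omega> (Lq_op Ap k r q) \<circ> gauss_conj (- \<omega>) (Lq_op Ap k r q)) (L_osc \<omega> Ap k)"
    using conj_product_commute[OF c refl refl] unfolding Lq_op_def q .
qed

end

text \<open>A formal adjoint is determined only up to \<open>op_eq\<close>, so the first part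
  asserts that one exists and that the product with any of them commutes with the
  oscillator.\<close>

theorem theorem8p1:
  fixes W :: "(complex^'n \<Rightarrow> complex^'n) set"
    and Rp Ap :: "(complex^'n) set"
    and k :: "complex^'n \<Rightarrow> complex"
    and \<omega> :: complex
  assumes "locus_configuration W Rp Ap k"
  shows
    "(let N = deg_delta Rp Ap k; S\<omega> = gauss_conj \<omega> (S_op Rp Ap k); U = regular_points Ap in
        op_eq U (L_osc \<omega> Ap k \<circ> S\<omega>) (S\<omega> \<circ> op_shift (L_osc \<omega> Rp k) (2 * \<omega> * of_nat N)) \<and>
        (\<exists>T. formal_adjoint U S\<omega> T) \<and>
        (\<forall>T. formal_adjoint U S\<omega> T \<longrightarrow> op_commute U (S\<omega> \<circ> T) (L_osc \<omega> Ap k)))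
     \<and>
     (\<forall>q r. q \<in> invariant_polys W \<and> homogeneous r q \<longrightarrow>
        (let Lq = (\<lambda>\<nu>. gauss_conj \<nu> (Lq_op Rp k r q)); U = regular_points Rp in
           op_eq U (Lq \<omega> \<circ> L_osc \<omega> Rp k)
                   (op_shift (L_osc \<omega> Rp k) (- 2 * \<omega> * of_nat r) \<circ> Lq \<omega>) \<and>
           op_commute U (Lq \<omega> \<circ> Lq (- \<omega>)) (L_osc \<omega> Rp k)))
     \<and>
     (\<forall>q r. q \<in> quasi_invariants W Rp Ap k \<and> homogeneous r q \<longrightarrow>
        (let Lq = (\<lambda>\<nu>. gauss_conj \<nu> (Lq_op Ap k r q)); U = regular_points Ap in
           op_eq U (Lq \<omega> \<circ> L_osc \<omega> Ap k)
                   (op_shift (L_osc \<omega> Ap k) (- 2 * \<omega> * of_nat r) \<circ> Lq \<omega>) \<and>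
           op_commute U (Lq \<omega> \<circ> Lq (- \<omega>)) (L_osc \<omega> Ap k)))"
  unfolding Let_def
  by (intro conjI allI impI; (elim conjE)?;
      rule conjugated_S[OF assms] conjugated_L_W[OF assms] conjugated_L_Ap[OF assms]; assumption?)

end
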